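(* Let $\mathbb{K}$ be a field and let $\Delta$ be a simplicial complex on the vertex set $X=\{x_1,\dots,x_n\}$. Then $\Delta$ is initially Cohen--Macaulay (over $\mathbb{K}$) if and only if its initial-dimension skeleton $\Delta^{\mathrm{indim}\,\Delta}$ is Cohen--Macaulay (over $\mathbb{K}$).
   Context: Let $R=\mathbb{K}[x_1,\dots,x_n]$ with the standard grading and $M=(x_1,\dots,x_n)$. The Stanley--Reisner ideal $I_\Delta\subset R$ is generated by the monomials $\prod_{x_i\in F}x_i$ for $F$ a minimal non-face of $\Delta$, and $\mathbb{K}[\Delta]=R/I_\Delta$. The initial dimension of a module $N$ is $\mathrm{indim}\,N=\inf\{\dim R/P\mid P\in\mathrm{Ass}_R N\}$, and $\mathrm{indim}\,\Delta=\mathrm{indim}\,\mathbb{K}[\Delta]-1$, i.e. the minimum dimension of a facet of $\Delta$ (where $\dim F=|F|-1$). The complex $\Delta$ is initially Cohen--Macaulay over $\mathbb{K}$ if $\mathrm{depth}\,\mathbb{K}[\Delta]=\mathrm{indim}\,\mathbb{K}[\Delta]$ (or $\mathbb{K}[\Delta]=0$), depth being taken with respect to $M$; it is Cohen--Macaulay over $\mathbb{K}$ if $\mathbb{K}[\Delta]$ is Cohen--Macaulay. The $i$-skeleton $\Delta^i$ consists of all faces of $\Delta$ of dimension at most $i$. *)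

theory Defs
  imports
    "HOL-Library.Extended_Real"
    "HOL-Library.Poly_Mapping"
    "HOL-Algebra.Module"
    "HOL-Algebra.QuotRing"
begin

section \<open>Dimension and depth of modules\<close>

text \<open>Dimensions and depths are extended reals, so that suprema and infima of empty sets are
  \<open>-\<infinity>\<close> and \<open>\<infinity>\<close>, and \<open>indim - 1\<close> is meaningful when \<open>indim\<close> is \<open>0\<close> or \<open>\<infinity>\<close>.\<close>

definition krull_dim :: "('a, 'm) ring_scheme \<Rightarrow> ereal" where
  "krull_dim R =
    (SUP Ps \<in> {Ps. Ps \<noteq> [] \<and> (\<forall>P \<in> set Ps. primeideal P R) \<and> sorted_wrt (\<subset>) Ps}.
      ereal (real (length Ps - 1)))"

definition elem_annihilator :: "('a, 'm) ring_scheme \<Rightarrow> ('a, 'b, 'n) module_scheme \<Rightarrow> 'b \<Rightarrow> 'a set" where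
  "elem_annihilator R N x = {r \<in> carrier R. r \<odot>\<^bsub>N\<^esub> x = \<zero>\<^bsub>N\<^esub>}"

definition annihilator :: "('a, 'm) ring_scheme \<Rightarrow> ('a, 'b, 'n) module_scheme \<Rightarrow> 'a set" where
  "annihilator R N = {r \<in> carrier R. \<forall>x \<in> carrier N. r \<odot>\<^bsub>N\<^esub> x = \<zero>\<^bsub>N\<^esub>}"

definition associated_primes :: "('a, 'm) ring_scheme \<Rightarrow> ('a, 'b, 'n) module_scheme \<Rightarrow> 'a set set" where
  "associated_primes R N = {P. primeideal P R \<and> (\<exists>x \<in> carrier N. P = elem_annihilator R N x)}"

definition module_dim :: "('a, 'm) ring_scheme \<Rightarrow> ('a, 'b, 'n) module_scheme \<Rightarrow> ereal" where
  "module_dim R N = krull_dim (R Quot annihilator R N)"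

definition indim :: "('a, 'm) ring_scheme \<Rightarrow> ('a, 'b, 'n) module_scheme \<Rightarrow> ereal" where
  "indim R N = (INF P \<in> associated_primes R N. krull_dim (R Quot P))"

text \<open>The submodule \<open>(r\<^sub>1, \<dots>, r\<^sub>k)N = r\<^sub>1N + \<dots> + r\<^sub>kN\<close> of \<open>N\<close>.\<close>

definition list_smult_module :: "('a, 'b, 'n) module_scheme \<Rightarrow> 'a list \<Rightarrow> 'b set" where
  "list_smult_module N rs =
    {\<Oplus>\<^bsub>N\<^esub>j \<in> {..<length rs}. (rs ! j) \<odot>\<^bsub>N\<^esub> y j | y. y \<in> {..<length rs} \<rightarrow> carrier N}"

text \<open>The middle condition says that \<open>r\<^sub>i\<close> is a non-zero-divisor on
  \<open>N / (r\<^sub>1, \<dots>, r\<^sub>i\<^sub>-\<^sub>1)N\<close>, the last one that \<open>N / (r\<^sub>1, \<dots>, r\<^sub>k)N\<close> is nonzero.\<close>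

definition regular_sequence ::
    "('a, 'm) ring_scheme \<Rightarrow> ('a, 'b, 'n) module_scheme \<Rightarrow> 'a list \<Rightarrow> bool" where
  "regular_sequence R N rs \<longleftrightarrow>
    set rs \<subseteq> carrier R \<and>
    (\<forall>i < length rs. \<forall>x \<in> carrier N.
      (rs ! i) \<odot>\<^bsub>N\<^esub> x \<in> list_smult_module N (take i rs) \<longrightarrow>
      x \<in> list_smult_module N (take i rs)) \<and>
    list_smult_module N rs \<noteq> carrier N"

definition depth :: "('a, 'm) ring_scheme \<Rightarrow> 'a set \<Rightarrow> ('a, 'b, 'n) module_scheme \<Rightarrow> ereal" where
  "depth R I N = (SUP rs \<in> {rs. set rs \<subseteq> I \<and> regular_sequence R N rs}. ereal (real (length rs)))"

text \<open>Both notions below are used for \<open>R\<close> a polynomial ring over a field, \<open>I\<close> its graded maximal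
  ideal and \<open>N\<close> a finitely generated graded module; the zero module has both properties.\<close>

definition initially_CM_module ::
    "('a, 'm) ring_scheme \<Rightarrow> 'a set \<Rightarrow> ('a, 'b, 'n) module_scheme \<Rightarrow> bool" where
  "initially_CM_module R I N \<longleftrightarrow> carrier N = {\<zero>\<^bsub>N\<^esub>} \<or> depth R I N = indim R N"

definition CM_module ::
    "('a, 'm) ring_scheme \<Rightarrow> 'a set \<Rightarrow> ('a, 'b, 'n) module_scheme \<Rightarrow> bool" where
  "CM_module R I N \<longleftrightarrow> carrier N = {\<zero>\<^bsub>N\<^esub>} \<or> depth R I N = module_dim R N"

text \<open>\<open>R/I\<close> as an \<open>R\<close>-module.\<close>

definition quotient_module :: "('a, 'm) ring_scheme \<Rightarrow> 'a set \<Rightarrow> ('a, 'a set) module" where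
  "quotient_module R I =
    \<lparr>carrier = carrier (R Quot I), monoid.mult = monoid.mult (R Quot I), one = one (R Quot I),
     ring.zero = ring.zero (R Quot I), ring.add = ring.add (R Quot I),
     smult = (\<lambda>r C. (I +>\<^bsub>R\<^esub> r) \<otimes>\<^bsub>R Quot I\<^esub> C)\<rparr>"

lemma quotient_module_simps:
  "carrier (quotient_module R I) = carrier (R Quot I)"
  "\<zero>\<^bsub>quotient_module R I\<^esub> = \<zero>\<^bsub>R Quot I\<^esub>"
  "x \<oplus>\<^bsub>quotient_module R I\<^esub> y = x \<oplus>\<^bsub>R Quot I\<^esub> y"
  "r \<odot>\<^bsub>quotient_module R I\<^esub> x = (I +>\<^bsub>R\<^esub> r) \<otimes>\<^bsub>R Quot I\<^esub> x"
  by (simp_all add: quotient_module_def)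

lemma module_quotient_module:
  assumes "cring R" and "ideal I R"
  shows "module R (quotient_module R I)"
proof -
  interpret R: cring R by fact
  interpret I: ideal I R by fact
  interpret Q: cring "R Quot I" by (rule I.quotient_is_cring) fact
  interpret h: ring_hom_ring R "R Quot I" "(+>\<^bsub>R\<^esub>) I" by (rule I.rcos_ring_hom_ring)
  have "abelian_group (quotient_module R I)"
    by (rule abelian_groupI, unfold quotient_module_simps)
      (fact Q.a_closed Q.zero_closed Q.a_assoc Q.a_comm Q.l_zero
        | metis Q.l_neg Q.a_inv_closed)+
  then show ?thesis
    by (intro moduleI)
      (simp_all add: quotient_module_simps Q.l_distr Q.r_distr Q.m_assoc R.is_cring)
qed

section \<open>Polynomial rings\<close>

text \<open>The polynomials in \<open>('v \<Rightarrow>\<^sub>0 nat) \<Rightarrow>\<^sub>0 'k\<close> involving only variables indexed by \<open>V\<close>; a key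
  \<open>m :: 'v \<Rightarrow>\<^sub>0 nat\<close> stands for the monomial with exponent vector \<open>m\<close>.\<close>

definition mpoly_ring :: "'v set \<Rightarrow> (('v \<Rightarrow>\<^sub>0 nat) \<Rightarrow>\<^sub>0 'k :: field) ring" where
  "mpoly_ring V =
    \<lparr>carrier = {p. \<forall>m \<in> Poly_Mapping.keys p. Poly_Mapping.keys m \<subseteq> V},
     monoid.mult = (*), one = 1, ring.zero = 0, ring.add = (+)\<rparr>"

definition mpoly_var :: "'v \<Rightarrow> ('v \<Rightarrow>\<^sub>0 nat) \<Rightarrow>\<^sub>0 'k :: field" where
  "mpoly_var v = Poly_Mapping.single (Poly_Mapping.single v 1) 1"

definition irrelevant_ideal :: "'v set \<Rightarrow> (('v \<Rightarrow>\<^sub>0 nat) \<Rightarrow>\<^sub>0 'k :: field) set" where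
  "irrelevant_ideal V = Idl\<^bsub>mpoly_ring V\<^esub> (mpoly_var ` V)"

lemma cring_mpoly_ring: "cring (mpoly_ring V :: (('v \<Rightarrow>\<^sub>0 nat) \<Rightarrow>\<^sub>0 'k :: field) ring)"
proof (rule cringI)
  show "abelian_group (mpoly_ring V :: (('v \<Rightarrow>\<^sub>0 nat) \<Rightarrow>\<^sub>0 'k) ring)"
  proof (rule abelian_groupI)
    fix p assume "p \<in> carrier (mpoly_ring V :: (('v \<Rightarrow>\<^sub>0 nat) \<Rightarrow>\<^sub>0 'k) ring)"
    then show "\<exists>q \<in> carrier (mpoly_ring V). q \<oplus>\<^bsub>mpoly_ring V\<^esub> p = \<zero>\<^bsub>mpoly_ring V\<^esub>"
      by (intro bexI[of _ "- p"]) (auto simp: mpoly_ring_def)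
  qed (use keys_add in \<open>fastforce simp: mpoly_ring_def ac_simps\<close>)+
  show "comm_monoid (mpoly_ring V :: (('v \<Rightarrow>\<^sub>0 nat) \<Rightarrow>\<^sub>0 'k) ring)"
  proof (rule comm_monoidI)
    fix p q assume p: "p \<in> carrier (mpoly_ring V :: (('v \<Rightarrow>\<^sub>0 nat) \<Rightarrow>\<^sub>0 'k) ring)"
      and q: "q \<in> carrier (mpoly_ring V :: (('v \<Rightarrow>\<^sub>0 nat) \<Rightarrow>\<^sub>0 'k) ring)"
    have "Poly_Mapping.keys m \<subseteq> V" if "m \<in> Poly_Mapping.keys (p * q)" for m
    proof -
      obtain a b where "a \<in> Poly_Mapping.keys p" "b \<in> Poly_Mapping.keys q" "m = a + b"
        using \<open>m \<in> Poly_Mapping.keys (p * q)\<close> keys_mult[of p q] by blast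
      then show ?thesis
        using p q keys_add[of a b] unfolding mpoly_ring_def by fastforce
    qed
    then show "p \<otimes>\<^bsub>mpoly_ring V\<^esub> q \<in> carrier (mpoly_ring V)"
      by (auto simp: mpoly_ring_def)
  qed (auto simp: mpoly_ring_def ac_simps)
qed (auto simp: mpoly_ring_def algebra_simps)

section \<open>Simplicial complexes and Stanley-Reisner rings\<close>

text \<open>Neither the void complex \<open>{}\<close> nor vertices \<open>v\<close> with \<open>{v} \<notin> \<Delta>\<close> are excluded.\<close>

definition simplicial_complex_on :: "'v set \<Rightarrow> 'v set set \<Rightarrow> bool" where
  "simplicial_complex_on V \<Delta> \<longleftrightarrow> \<Delta> \<subseteq> Pow V \<and> (\<forall>F \<in> \<Delta>. \<forall>G. G \<subseteq> F \<longrightarrow> G \<in> \<Delta>)"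

definition minimal_nonfaces :: "'v set \<Rightarrow> 'v set set \<Rightarrow> 'v set set" where
  "minimal_nonfaces V \<Delta> = {F. F \<subseteq> V \<and> F \<notin> \<Delta> \<and> (\<forall>G. G \<subset> F \<longrightarrow> G \<in> \<Delta>)}"

definition SR_ideal :: "'v set \<Rightarrow> 'v set set \<Rightarrow> (('v \<Rightarrow>\<^sub>0 nat) \<Rightarrow>\<^sub>0 'k :: field) set" where
  "SR_ideal V \<Delta> = Idl\<^bsub>mpoly_ring V\<^esub> ((\<lambda>F. \<Prod>v \<in> F. mpoly_var v) ` minimal_nonfaces V \<Delta>)"

definition SR_module ::
    "'v set \<Rightarrow> 'v set set \<Rightarrow>
      (('v \<Rightarrow>\<^sub>0 nat) \<Rightarrow>\<^sub>0 'k :: field, (('v \<Rightarrow>\<^sub>0 nat) \<Rightarrow>\<^sub>0 'k) set) module" where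
  "SR_module V \<Delta> = quotient_module (mpoly_ring V) (SR_ideal V \<Delta>)"

definition initially_CM_complex :: "'k :: field itself \<Rightarrow> 'v set \<Rightarrow> 'v set set \<Rightarrow> bool" where
  "initially_CM_complex k V \<Delta> \<longleftrightarrow>
    initially_CM_module (mpoly_ring V) (irrelevant_ideal V)
      (SR_module V \<Delta> :: (('v \<Rightarrow>\<^sub>0 nat) \<Rightarrow>\<^sub>0 'k, _) module)"

definition CM_complex :: "'k :: field itself \<Rightarrow> 'v set \<Rightarrow> 'v set set \<Rightarrow> bool" where
  "CM_complex k V \<Delta> \<longleftrightarrow>
    CM_module (mpoly_ring V) (irrelevant_ideal V)
      (SR_module V \<Delta> :: (('v \<Rightarrow>\<^sub>0 nat) \<Rightarrow>\<^sub>0 'k, _) module)"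

definition indim_complex :: "'k :: field itself \<Rightarrow> 'v set \<Rightarrow> 'v set set \<Rightarrow> ereal" where
  "indim_complex k V \<Delta> =
    indim (mpoly_ring V) (SR_module V \<Delta> :: (('v \<Rightarrow>\<^sub>0 nat) \<Rightarrow>\<^sub>0 'k, _) module) - 1"

text \<open>The index is an extended real because \<^const>\<open>indim_complex\<close> can be \<open>-1\<close> (for \<open>\<Delta> = {{}}\<close>)
  or \<open>\<infinity>\<close> (for \<open>\<Delta> = {}\<close>).\<close>

definition skeleton :: "ereal \<Rightarrow> 'v set set \<Rightarrow> 'v set set" where
  "skeleton i \<Delta> = {F \<in> \<Delta>. ereal (real (card F) - 1) \<le> i}"

end

theory Submission
  imports Defs
begin

text \<open>Let \<open>m\<close> be the least cardinality of a facet of \<open>\<Delta>\<close>, and \<open>\<Gamma>\<close> the complex of the faces with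
  at most \<open>m\<close> vertices. Associated primes of \<open>K[\<Delta>]\<close> are the primes of facets and \<open>dim K[\<Gamma>] = m\<close>, so the
  claim is that \<open>K[\<Delta>]\<close> has depth \<open>m\<close> iff \<open>K[\<Gamma>]\<close> has. Depth is controlled by the Koszul cohomology of the
  elementary symmetric polynomials \<open>e\<^sub>1, \<dots>, e\<^sub>n\<close>, which generate the irrelevant ideal up to radical: a regular
  sequence of length \<open>t\<close> makes the cohomology vanish in degrees below \<open>t\<close>. The kernel of \<open>K[\<Delta>] \<rightarrow> K[\<Gamma>]\<close>
  is filtered by the modules \<open>x\<^sub>F K[x\<^sub>F]\<close> with \<open>|F| > m\<close>, whose cohomology vanishes below degree \<open>m + 1\<close>,
  so vanishing below \<open>m\<close> passes between \<open>K[\<Delta>]\<close> and \<open>K[\<Gamma>]\<close>. In the other direction, \<open>e\<^sub>j\<close> is zero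
  on \<open>K[\<Gamma>]\<close> for \<open>j > m\<close> and on \<open>x\<^sub>F K[x\<^sub>F]\<close> for \<open>j > |F|\<close>, and a graded Nakayama argument removes the
  superfluous \<open>e\<^sub>j\<close> one at a time, so that \<open>e\<^sub>1, \<dots>, e\<^sub>m\<close> itself turns out to be a regular sequence.\<close>

section \<open>Koszul cohomology\<close>

text \<open>The variables would have the same radical and the same degrees, but on K[\<Gamma>] none
  of them need act as zero. The e_j do so beyond an explicit index, and this leaves as many of them
  as the wanted depth. They thus give a concrete candidate for a maximal regular sequence over every
  field, where general linear forms would ask for an infinite one. The obstacle is an accounting of
  degrees. Removing an element from the list by the Nakayama argument costs one degree of vanishing,
  while removing one that acts as zero is free. On K[\<Delta>] an e_j with j > m need not act as
  zero, so both directions must choose with care at which moment and on which module the list is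
  shortened. The same accounting bounds the depth by the size of any facet F: after e_1, ..., e_|F|
  have been removed at the price of |F| degrees, the other e_j annihilate the nonzero class of x_F,
  so no vanishing in degree 0 can be left.\<close>

text \<open>A Koszul cochain is encoded as a function on bool lists of length \<open>length ys\<close>, a list standing for
  the basis element indexed by the positions of its \<^const>\<open>True\<close> entries. The recursion exhibits the complex for
  \<open>y # ys\<close> as the mapping cone of multiplication by \<open>y\<close>. Values at lists of other lengths are junk.\<close>

primrec koszul_d :: "'a::comm_ring_1 list \<Rightarrow> (bool list \<Rightarrow> 'a) \<Rightarrow> bool list \<Rightarrow> 'a" where
  "koszul_d [] \<phi> bs = 0"
| "koszul_d (y # ys) \<phi> bs = (case bs of [] \<Rightarrow> 0 | b # bs' \<Rightarrow>
    if b then y * \<phi> (False # bs') - koszul_d ys (\<lambda>t. \<phi> (True # t)) bs'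
    else koszul_d ys (\<lambda>t. \<phi> (False # t)) bs')"

text \<open>Contraction with the \<open>k\<close>-th basis element, a null-homotopy of multiplication by \<open>ys ! k\<close>.\<close>

fun koszul_h :: "nat \<Rightarrow> (bool list \<Rightarrow> 'a::comm_ring_1) \<Rightarrow> bool list \<Rightarrow> 'a" where
  "koszul_h k \<phi> [] = 0"
| "koszul_h 0 \<phi> (b # bs) = (if b then 0 else \<phi> (True # bs))"
| "koszul_h (Suc k) \<phi> (b # bs) =
    (if b then - koszul_h k (\<lambda>t. \<phi> (True # t)) bs else koszul_h k (\<lambda>t. \<phi> (False # t)) bs)"

text \<open>The basis elements of cohomological degree \<open>j\<close>. Cochains are not confined
  to one degree; conditions on them are imposed on these lists instead.\<close>

definition koszul_idx :: "nat \<Rightarrow> nat \<Rightarrow> bool list set" where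
  "koszul_idx n j = {bs. length bs = n \<and> count_list bs True = j}"

lemma koszul_idx_Cons [simp]:
  "True # bs \<in> koszul_idx (Suc n) (Suc j) \<longleftrightarrow> bs \<in> koszul_idx n j"
  "True # bs \<notin> koszul_idx n 0"
  "False # bs \<in> koszul_idx (Suc n) j \<longleftrightarrow> bs \<in> koszul_idx n j"
  by (auto simp: koszul_idx_def)

lemma koszul_d_add: "koszul_d ys (\<lambda>t. \<phi> t + \<psi> t) bs = koszul_d ys \<phi> bs + koszul_d ys \<psi> bs"
  by (induction ys arbitrary: \<phi> \<psi> bs) (auto split: list.split simp: algebra_simps)

lemma koszul_d_mult: "koszul_d ys (\<lambda>t. a * \<phi> t) bs = a * koszul_d ys \<phi> bs"
  by (induction ys arbitrary: \<phi> bs) (auto split: list.split simp: algebra_simps)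

lemma koszul_d_zero [simp]: "koszul_d ys (\<lambda>t. 0) bs = 0"
  by (induction ys arbitrary: bs) (auto split: list.split)

lemma koszul_d_uminus: "koszul_d ys (\<lambda>t. - \<phi> t) bs = - koszul_d ys \<phi> bs"
  using koszul_d_mult[of ys "-1" \<phi> bs] by simp

lemma koszul_d_diff: "koszul_d ys (\<lambda>t. \<phi> t - \<psi> t) bs = koszul_d ys \<phi> bs - koszul_d ys \<psi> bs"
  using koszul_d_add[of ys \<phi> "\<lambda>t. - \<psi> t" bs] by (simp add: koszul_d_uminus)

lemma koszul_d_d: "koszul_d ys (koszul_d ys \<phi>) bs = 0"
proof (induction ys arbitrary: \<phi> bs)
  case (Cons y ys)
  then show ?case
    by (auto split: list.split simp: koszul_d_diff koszul_d_mult)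
qed simp

text \<open>Induction along the mapping cone. For the head of the list the two copies of
  \<open>koszul_d ys\<close> cancel; for a later position the sign of \<open>koszul_h\<close> at
  \<open>True\<close> matches that of \<open>koszul_d\<close>.\<close>

lemma koszul_homotopy:
  assumes "k < length ys" and "length bs = length ys"
  shows "ys ! k * \<phi> bs = koszul_d ys (koszul_h k \<phi>) bs + koszul_h k (koszul_d ys \<phi>) bs"
proof -
  have um: "koszul_h k (\<lambda>t. - \<phi> t) bs = - koszul_h k \<phi> bs" for k \<phi> and bs :: "bool list"
    by (induction k \<phi> bs rule: koszul_h.induct) auto
  have ad: "koszul_h k (\<lambda>t. \<phi> t + \<psi> t) bs = koszul_h k \<phi> bs + koszul_h k \<psi> bs"
    for k and \<phi> \<psi> :: "bool list \<Rightarrow> 'a" and bs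
  proof (induction k \<phi> bs arbitrary: \<psi> rule: koszul_h.induct)
    case (3 k \<phi> b bs)
    show ?case using "3.IH"(1)[of "\<lambda>t. \<psi> (True # t)"] "3.IH"(2)[of "\<lambda>t. \<psi> (False # t)"] by auto
  qed auto
  have di: "koszul_h k (\<lambda>t. \<phi> t - \<psi> t) bs = koszul_h k \<phi> bs - koszul_h k \<psi> bs"
    for k and \<phi> \<psi> :: "bool list \<Rightarrow> 'a" and bs
    using ad[of k \<phi> "\<lambda>t. - \<psi> t" bs] by (simp add: um)
  have mu: "koszul_h k (\<lambda>t. a * \<phi> t) bs = a * koszul_h k \<phi> bs" for k a and \<phi> :: "bool list \<Rightarrow> 'a" and bs
    by (induction k \<phi> bs rule: koszul_h.induct) auto
  show ?thesis
    using assms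
  proof (induction ys arbitrary: k \<phi> bs)
    case (Cons y ys)
    then obtain b bs' where bs: "bs = b # bs'" and len: "length bs' = length ys" by (cases bs) auto
    show ?case
    proof (cases k)
      case 0
      then show ?thesis by (simp add: bs)
    next
      case (Suc k')
      with Cons.prems have k': "k' < length ys" by simp
      show ?thesis
        using Cons.IH[OF k' len, of "\<lambda>t. \<phi> (b # t)"]
        by (cases b) (simp_all add: bs Suc di mu koszul_d_uminus algebra_simps)
    qed
  qed simp
qed

text \<open>Contraction lowers the degree by one and only copies values up to sign, which explains
  the closure properties asked of \<open>U\<close>.\<close>

lemma koszul_h_idx:
  assumes "\<And>bs. bs \<in> koszul_idx n (Suc j) \<Longrightarrow> \<phi> bs \<in> U" "bs \<in> koszul_idx n j"
    and "0 \<in> U" and "\<And>x. x \<in> U \<Longrightarrow> - x \<in> U"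
  shows "koszul_h k \<phi> bs \<in> U"
  using assms(1,2)
proof (induction k \<phi> bs arbitrary: n j rule: koszul_h.induct)
  case (2 \<phi> b bs)
  then show ?case using assms(3) by (cases n; cases b) (simp_all add: koszul_idx_def)
next
  case (3 k \<phi> b bs)
  obtain n' where n: "n = Suc n'" using 3(4) by (cases n) (auto simp: koszul_idx_def)
  show ?case
  proof (cases b)
    case True
    then obtain j' where j: "j = Suc j'" using 3(4) by (cases j) auto
    have "koszul_h k (\<lambda>t. \<phi> (True # t)) bs \<in> U"
      by (rule "3.IH"(1)[of n' j']) (use 3 True n j in auto)
    then show ?thesis using True assms(4) by auto
  next
    case False
    have "koszul_h k (\<lambda>t. \<phi> (False # t)) bs \<in> U"
      by (rule "3.IH"(2)[of n' j]) (use 3 False n in auto)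
    then show ?thesis using False by auto
  qed
qed (use assms(3) in auto)

text \<open>Degree 0 has no incoming differential: every value that \<open>koszul_d\<close> reads
  has one \<open>True\<close> entry fewer.\<close>

lemma koszul_d_idx_zero:
  assumes "bs \<in> koszul_idx n 0" shows "koszul_d ys \<phi> bs = 0"
  using assms
proof (induction ys arbitrary: \<phi> bs n)
  case (Cons y ys)
  show ?case
  proof (cases bs)
    case (Cons c ds)
    moreover have "n = Suc (length ds)" using Cons \<open>bs \<in> _\<close> by (auto simp: koszul_idx_def)
    ultimately show ?thesis using Cons.IH[of ds "length ds"] \<open>bs \<in> _\<close> by (cases c) auto
  qed auto
qed simp

text \<open>Vanishing in degrees below \<open>t\<close> of the cohomology with coefficients in \<open>N / U\<close>. Quotient modules are
  represented throughout by pairs of submodules of the ambient ring.\<close>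

definition koszul_vanish :: "'a::comm_ring_1 list \<Rightarrow> nat \<Rightarrow> 'a set \<Rightarrow> 'a set \<Rightarrow> bool" where
  "koszul_vanish ys t N U \<longleftrightarrow> (\<forall>j<t. \<forall>\<phi>. (\<forall>bs. \<phi> bs \<in> N) \<longrightarrow>
    (\<forall>bs\<in>koszul_idx (length ys) (Suc j). koszul_d ys \<phi> bs \<in> U) \<longrightarrow>
    (\<exists>\<psi>. (\<forall>bs. \<psi> bs \<in> N) \<and> (\<forall>bs\<in>koszul_idx (length ys) j. \<phi> bs - koszul_d ys \<psi> bs \<in> U)))"

lemma koszul_vanishE:
  assumes "koszul_vanish ys t N U" "j < t" "\<And>bs. \<phi> bs \<in> N"
    "\<And>bs. bs \<in> koszul_idx (length ys) (Suc j) \<Longrightarrow> koszul_d ys \<phi> bs \<in> U"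
  obtains \<psi> where "\<And>bs. \<psi> bs \<in> N"
    "\<And>bs. bs \<in> koszul_idx (length ys) j \<Longrightarrow> \<phi> bs - koszul_d ys \<psi> bs \<in> U"
proof -
  have "\<exists>\<psi>. (\<forall>bs. \<psi> bs \<in> N) \<and> (\<forall>bs\<in>koszul_idx (length ys) j. \<phi> bs - koszul_d ys \<psi> bs \<in> U)"
    using assms(1)[unfolded koszul_vanish_def, rule_format, OF assms(2)] assms(3,4) by simp
  then show ?thesis using that by blast
qed

lemma koszul_vanishI:
  assumes "\<And>j \<phi>. j < t \<Longrightarrow> (\<And>bs. \<phi> bs \<in> N) \<Longrightarrow>
      (\<And>bs. bs \<in> koszul_idx (length ys) (Suc j) \<Longrightarrow> koszul_d ys \<phi> bs \<in> U) \<Longrightarrow>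
      \<exists>\<psi>. (\<forall>bs. \<psi> bs \<in> N) \<and> (\<forall>bs\<in>koszul_idx (length ys) j. \<phi> bs - koszul_d ys \<psi> bs \<in> U)"
  shows "koszul_vanish ys t N U"
  unfolding koszul_vanish_def by (intro allI impI assms) simp_all

lemma koszul_vanish_mono: "koszul_vanish ys t N U \<Longrightarrow> s \<le> t \<Longrightarrow> koszul_vanish ys s N U"
  by (auto simp: koszul_vanish_def)

text \<open>The submodule (ys) N; for \<open>N = S\<close> it is the ideal generated by
  \<open>ys\<close>.\<close>

primrec lin_combs :: "'a::comm_ring_1 set \<Rightarrow> 'a list \<Rightarrow> 'a set" where
  "lin_combs N [] = {0}"
| "lin_combs N (y # ys) = {y * a + b | a b. a \<in> N \<and> b \<in> lin_combs N ys}"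

text \<open>For submodules \<open>U\<close> of \<open>N\<close>, the preimage in \<open>N\<close> of
  (rs)(N/U), so that the quotient of \<open>N\<close> by it is N/U modulo \<open>rs\<close>.\<close>

definition submod_plus :: "'a::comm_ring_1 set \<Rightarrow> 'a set \<Rightarrow> 'a list \<Rightarrow> 'a set" where
  "submod_plus N U rs = {u + b | u b. u \<in> U \<and> b \<in> lin_combs N rs}"

text \<open>Polynomials in prescribed variables form a subset of a type, so the scalars are confined
  to a subring \<open>S\<close> of the ambient ring.\<close>

locale base_ring =
  fixes S :: "'a::comm_ring_1 set"
  assumes S_one: "1 \<in> S" and S_uminus: "x \<in> S \<Longrightarrow> - x \<in> S"
    and S_add: "x \<in> S \<Longrightarrow> y \<in> S \<Longrightarrow> x + y \<in> S" and S_mult: "x \<in> S \<Longrightarrow> y \<in> S \<Longrightarrow> x * y \<in> S"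
begin

definition submod :: "'a set \<Rightarrow> bool" where
  "submod N \<longleftrightarrow> 0 \<in> N \<and> (\<forall>x\<in>N. \<forall>y\<in>N. x + y \<in> N) \<and> (\<forall>s\<in>S. \<forall>x\<in>N. s * x \<in> N)"

lemma submod_zero: "submod N \<Longrightarrow> 0 \<in> N"
  and submod_add: "submod N \<Longrightarrow> x \<in> N \<Longrightarrow> y \<in> N \<Longrightarrow> x + y \<in> N"
  and submod_mult: "submod N \<Longrightarrow> s \<in> S \<Longrightarrow> x \<in> N \<Longrightarrow> s * x \<in> N"
  by (auto simp: submod_def)

lemma submod_uminus: "submod N \<Longrightarrow> x \<in> N \<Longrightarrow> - x \<in> N"
  using submod_mult[of N "-1" x] S_uminus[OF S_one] by simp

lemma submod_diff: "submod N \<Longrightarrow> x \<in> N \<Longrightarrow> y \<in> N \<Longrightarrow> x - y \<in> N"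
  using submod_add[of N x "- y"] submod_uminus by simp

lemma submod_sum: "submod N \<Longrightarrow> (\<And>i. i \<in> A \<Longrightarrow> f i \<in> N) \<Longrightarrow> sum f A \<in> N"
  by (induction A rule: infinite_finite_induct) (auto simp: submod_zero submod_add)

lemma submod_S: "submod S"
  using S_add[OF S_one S_uminus[OF S_one]] by (auto simp: submod_def S_add S_mult)

lemma S_power: "x \<in> S \<Longrightarrow> x ^ k \<in> S"
  by (induction k) (auto simp: S_one S_mult)

lemma koszul_d_mem:
  "submod N \<Longrightarrow> set ys \<subseteq> S \<Longrightarrow> (\<And>bs. \<phi> bs \<in> N) \<Longrightarrow> koszul_d ys \<phi> bs \<in> N"
  by (induction ys arbitrary: \<phi> bs)
    (auto split: list.split simp: submod_zero intro!: submod_diff submod_mult)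

lemma koszul_h_mem: "submod N \<Longrightarrow> (\<And>bs. \<phi> bs \<in> N) \<Longrightarrow> koszul_h k \<phi> bs \<in> N"
  by (induction k \<phi> bs rule: koszul_h.induct) (auto simp: submod_zero submod_uminus)

text \<open>Counterpart of \<open>koszul_h_idx\<close>: in degree \<open>j + 1\<close> the
  differential reads only values of degree \<open>j\<close>. Cochains can therefore be altered in
  other degrees without disturbing a cocycle condition.\<close>

lemma koszul_d_idx:
  assumes "submod U" "set ys \<subseteq> S" "\<And>bs. bs \<in> koszul_idx (length ys) j \<Longrightarrow> \<phi> bs \<in> U"
    "bs \<in> koszul_idx (length ys) (Suc j)"
  shows "koszul_d ys \<phi> bs \<in> U"
  using assms(2-4)
proof (induction ys arbitrary: \<phi> bs j)
  case (Cons y ys)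
  then obtain b bs' where bs: "bs = b # bs'" by (cases bs) (auto simp: koszul_idx_def)
  show ?case
  proof (cases b)
    case True
    have 1: "y * \<phi> (False # bs') \<in> U"
      using Cons.prems bs True by (auto intro!: submod_mult[OF assms(1)])
    \<comment> \<open>For \<open>j = 0\<close> the tail has degree 0, and no differential arrives
      there.\<close>
    have 2: "koszul_d ys (\<lambda>t. \<phi> (True # t)) bs' \<in> U"
    proof (cases j)
      case 0
      have "koszul_d ys \<theta> cs = 0" if "cs \<in> koszul_idx m 0" for \<theta> cs and m
        using that
      proof (induction ys arbitrary: \<theta> cs m)
        case (Cons y ys)
        show ?case
        proof (cases cs)
          case (Cons c ds)
          moreover have "m = Suc (length ds)" using Cons \<open>cs \<in> _\<close> by (auto simp: koszul_idx_def)
          ultimately show ?thesis using Cons.IH[of ds "length ds"] \<open>cs \<in> _\<close> by (cases c) auto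
        qed auto
      qed simp
      then show ?thesis using Cons.prems(3) submod_zero[OF assms(1)] by (simp add: bs True 0)
    next
      case (Suc j')
      show ?thesis by (rule Cons.IH[of j']) (use Cons.prems bs True Suc in auto)
    qed
    show ?thesis using submod_diff[OF assms(1) 1 2] by (simp add: bs True)
  next
    case False
    have "koszul_d ys (\<lambda>t. \<phi> (False # t)) bs' \<in> U"
      by (rule Cons.IH[of j]) (use Cons.prems bs False in auto)
    then show ?thesis by (simp add: bs False)
  qed
qed (use submod_zero[OF assms(1)] in simp)

section \<open>Exact sequences in cohomology\<close>

lemma koszul_vanish_self:
  assumes "submod U" shows "koszul_vanish ys t U U"
  by (rule koszul_vanishI) (rule exI[of _ "\<lambda>_. 0"], auto simp: submod_zero[OF assms])

text \<open>Exactness of H^j(U/W) -> H^j(N/W) -> H^j(N/U) in the middle: up to a coboundary a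
  cocycle modulo \<open>W\<close> has values in \<open>U\<close>, and there it is a coboundary
  modulo \<open>W\<close>.\<close>

lemma koszul_vanish_ext:
  assumes "submod N" "submod U" "submod W" "U \<subseteq> N" "W \<subseteq> U" "set ys \<subseteq> S"
    and NU: "koszul_vanish ys t N U" and UW: "koszul_vanish ys t U W"
  shows "koszul_vanish ys t N W"
proof (rule koszul_vanishI)
  fix j \<phi> assume j: "j < t" and \<phi>: "\<And>bs. \<phi> bs \<in> N"
    and c: "\<And>bs. bs \<in> koszul_idx (length ys) (Suc j) \<Longrightarrow> koszul_d ys \<phi> bs \<in> W"
  obtain \<psi> where \<psi>: "\<And>bs. \<psi> bs \<in> N"
      "\<And>bs. bs \<in> koszul_idx (length ys) j \<Longrightarrow> \<phi> bs - koszul_d ys \<psi> bs \<in> U"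
    using koszul_vanishE[OF NU j, of \<phi>] \<phi> c \<open>W \<subseteq> U\<close> by blast
  \<comment> \<open>The correction is cut off outside degree \<open>j\<close> so that all its values
    lie in \<open>U\<close>; its differential in degree \<open>j + 1\<close> does not
    notice.\<close>
  define u where "u bs = (if bs \<in> koszul_idx (length ys) j then \<phi> bs - koszul_d ys \<psi> bs else 0)" for bs
  have u: "u bs \<in> U" for bs using \<psi> submod_zero[OF \<open>submod U\<close>] by (auto simp: u_def)
  have "koszul_d ys u bs \<in> W" if bs: "bs \<in> koszul_idx (length ys) (Suc j)" for bs
  proof -
    have "koszul_d ys (\<lambda>t. u t - (\<phi> t - koszul_d ys \<psi> t)) bs \<in> W"
      by (rule koszul_d_idx[OF _ _ _ bs])
        (auto simp: u_def submod_zero[OF \<open>submod W\<close>] assms)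
    then have "koszul_d ys u bs - koszul_d ys \<phi> bs \<in> W"
      by (simp add: koszul_d_diff koszul_d_d)
    from submod_add[OF \<open>submod W\<close> this c[OF bs]] show ?thesis by simp
  qed
  then obtain \<theta> where \<theta>: "\<And>bs. \<theta> bs \<in> U"
      "\<And>bs. bs \<in> koszul_idx (length ys) j \<Longrightarrow> u bs - koszul_d ys \<theta> bs \<in> W"
    using koszul_vanishE[OF UW j, of u] u by blast
  show "\<exists>\<psi>. (\<forall>bs. \<psi> bs \<in> N) \<and> (\<forall>bs\<in>koszul_idx (length ys) j. \<phi> bs - koszul_d ys \<psi> bs \<in> W)"
  proof (intro exI[of _ "\<lambda>t. \<psi> t + \<theta> t"] conjI ballI allI)
    fix bs
    show "\<psi> bs + \<theta> bs \<in> N" using \<psi>(1) \<theta>(1) \<open>U \<subseteq> N\<close> submod_add[OF \<open>submod N\<close>] by blast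
    assume bs: "bs \<in> koszul_idx (length ys) j"
    show "\<phi> bs - koszul_d ys (\<lambda>t. \<psi> t + \<theta> t) bs \<in> W"
      using \<theta>(2)[OF bs] bs by (simp add: u_def koszul_d_add algebra_simps)
  qed
qed

text \<open>Exactness of H^j(N/W) -> H^j(N/U) -> H^(j+1)(U/W). The connecting map raises the degree,
  hence \<open>Suc t\<close> for \<open>U\<close> over \<open>W\<close>.\<close>

lemma koszul_vanish_quotient:
  assumes "submod N" "submod U" "submod W" "U \<subseteq> N" "W \<subseteq> U" "set ys \<subseteq> S"
    and UW: "koszul_vanish ys (Suc t) U W" and NW: "koszul_vanish ys t N W"
  shows "koszul_vanish ys t N U"
proof (rule koszul_vanishI)
  fix j \<phi> assume j: "j < t" and \<phi>: "\<And>bs. \<phi> bs \<in> N"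
    and c: "\<And>bs. bs \<in> koszul_idx (length ys) (Suc j) \<Longrightarrow> koszul_d ys \<phi> bs \<in> U"
  \<comment> \<open>The connecting cocycle, cut off outside degree \<open>j + 1\<close>. Writing it
    as the differential of \<open>\<theta>\<close> modulo \<open>W\<close> turns
    \<open>\<phi> - \<theta>\<close> into a cocycle modulo \<open>W\<close>.\<close>
  define u where "u bs = (if bs \<in> koszul_idx (length ys) (Suc j) then koszul_d ys \<phi> bs else 0)" for bs
  have u: "u bs \<in> U" for bs using c submod_zero[OF \<open>submod U\<close>] by (auto simp: u_def)
  have d: "koszul_d ys u bs \<in> W" if bs: "bs \<in> koszul_idx (length ys) (Suc (Suc j))" for bs
  proof -
    have "koszul_d ys (\<lambda>t. u t - koszul_d ys \<phi> t) bs \<in> W"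
      by (rule koszul_d_idx[OF _ _ _ bs])
        (auto simp: u_def submod_zero[OF \<open>submod W\<close>] assms)
    then show ?thesis by (simp add: koszul_d_diff koszul_d_d)
  qed
  have "Suc j < Suc t" using j by simp
  obtain \<theta> where \<theta>: "\<And>bs. \<theta> bs \<in> U"
      "\<And>bs. bs \<in> koszul_idx (length ys) (Suc j) \<Longrightarrow> u bs - koszul_d ys \<theta> bs \<in> W"
    using koszul_vanishE[OF UW \<open>Suc j < Suc t\<close> u d] by blast
  have "koszul_d ys (\<lambda>t. \<phi> t - \<theta> t) bs \<in> W" if "bs \<in> koszul_idx (length ys) (Suc j)" for bs
    using \<theta>(2)[OF that] that by (simp add: u_def koszul_d_diff)
  moreover have "\<phi> t - \<theta> t \<in> N" for t
    using \<phi> \<theta>(1) \<open>U \<subseteq> N\<close> submod_diff[OF \<open>submod N\<close>] by blast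
  ultimately obtain \<psi> where \<psi>: "\<And>bs. \<psi> bs \<in> N"
      "\<And>bs. bs \<in> koszul_idx (length ys) j \<Longrightarrow> \<phi> bs - \<theta> bs - koszul_d ys \<psi> bs \<in> W"
    using koszul_vanishE[OF NW j, of "\<lambda>t. \<phi> t - \<theta> t"] by blast
  show "\<exists>\<psi>. (\<forall>bs. \<psi> bs \<in> N) \<and> (\<forall>bs\<in>koszul_idx (length ys) j. \<phi> bs - koszul_d ys \<psi> bs \<in> U)"
  proof (intro exI[of _ \<psi>] conjI ballI allI)
    fix bs assume bs: "bs \<in> koszul_idx (length ys) j"
    have "\<theta> bs + (\<phi> bs - \<theta> bs - koszul_d ys \<psi> bs) \<in> U"
      using \<theta>(1) \<psi>(2)[OF bs] \<open>W \<subseteq> U\<close> submod_add[OF \<open>submod U\<close>] by blast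
    then show "\<phi> bs - koszul_d ys \<psi> bs \<in> U" by simp
  qed (use \<psi> in blast)
qed

section \<open>Submodules generated by a list and their action on cohomology\<close>

lemma submod_lin_combs:
  assumes "submod N" "set ys \<subseteq> S" shows "submod (lin_combs N ys)"
  using assms(2)
proof (induction ys)
  case (Cons y ys)
  then have IH: "submod (lin_combs N ys)" by simp
  show ?case
    unfolding submod_def lin_combs.simps
  proof (intro conjI ballI)
    show "0 \<in> {y * a + b | a b. a \<in> N \<and> b \<in> lin_combs N ys}"
      using submod_zero[OF IH] submod_zero[OF assms(1)] by force
  next
    fix u v assume "u \<in> {y * a + b | a b. a \<in> N \<and> b \<in> lin_combs N ys}" "v \<in> {y * a + b | a b. a \<in> N \<and> b \<in> lin_combs N ys}"
    then obtain a b c d where *: "u = y * a + b" "v = y * c + d" "a \<in> N" "b \<in> lin_combs N ys" "c \<in> N" "d \<in> lin_combs N ys" by auto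
    then have "u + v = y * (a + c) + (b + d)" by (simp add: algebra_simps)
    then show "u + v \<in> {y * a + b | a b. a \<in> N \<and> b \<in> lin_combs N ys}"
      using submod_add[OF IH *(4,6)] submod_add[OF assms(1) *(3,5)] by blast
  next
    fix s u assume s: "s \<in> S" and "u \<in> {y * a + b | a b. a \<in> N \<and> b \<in> lin_combs N ys}"
    then obtain a b where *: "u = y * a + b" "a \<in> N" "b \<in> lin_combs N ys" by auto
    then have "s * u = y * (s * a) + s * b" by (simp add: algebra_simps)
    then show "s * u \<in> {y * a + b | a b. a \<in> N \<and> b \<in> lin_combs N ys}"
      using submod_mult[OF IH s *(3)] submod_mult[OF assms(1) s *(2)] by blast
  qed
qed (auto simp: submod_def)

lemma lin_combs_subset: "submod U \<Longrightarrow> (\<And>y a. y \<in> set ys \<Longrightarrow> a \<in> N \<Longrightarrow> y * a \<in> U) \<Longrightarrow> lin_combs N ys \<subseteq> U"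
  by (induction ys) (auto simp: submod_zero intro!: submod_add)

lemma lin_combs_member: "submod N \<Longrightarrow> set ys \<subseteq> S \<Longrightarrow> y \<in> set ys \<Longrightarrow> a \<in> N \<Longrightarrow> y * a \<in> lin_combs N ys"
proof (induction ys)
  case (Cons z ys)
  show ?case
  proof (cases "y = z")
    case True
    then show ?thesis using Cons submod_zero[OF submod_lin_combs, of N ys] by force
  next
    case False
    then have "y * a \<in> lin_combs N ys" using Cons by simp
    then show ?thesis using submod_zero[OF Cons.prems(1)] by force
  qed
qed simp

text \<open>By the homotopies, the elements of the ideal generated by \<open>ys\<close> act as zero on cohomology.\<close>

lemma koszul_kill:
  assumes "submod N" "submod U" "U \<subseteq> N" "set ys \<subseteq> S" "f \<in> lin_combs S ys"
    and \<phi>: "\<And>bs. \<phi> bs \<in> N"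
    and c: "\<And>bs. bs \<in> koszul_idx (length ys) (Suc j) \<Longrightarrow> koszul_d ys \<phi> bs \<in> U"
  shows "\<exists>\<psi>. (\<forall>bs. \<psi> bs \<in> N) \<and> (\<forall>bs\<in>koszul_idx (length ys) j. f * \<phi> bs - koszul_d ys \<psi> bs \<in> U)"
proof -
  define K where "K = {f. \<exists>\<psi>. (\<forall>bs. \<psi> bs \<in> N) \<and>
    (\<forall>bs\<in>koszul_idx (length ys) j. f * \<phi> bs - koszul_d ys \<psi> bs \<in> U)}"
  have K: "submod K"
    unfolding submod_def
  proof (intro conjI ballI)
    show "0 \<in> K" using submod_zero[OF assms(1)] submod_zero[OF assms(2)]
      by (auto simp: K_def intro!: exI[of _ "\<lambda>_. 0"])
  next
    fix f g assume "f \<in> K" "g \<in> K"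
    then obtain \<psi> \<theta> where *: "\<forall>bs. \<psi> bs \<in> N" "\<forall>bs. \<theta> bs \<in> N"
      "\<forall>bs\<in>koszul_idx (length ys) j. f * \<phi> bs - koszul_d ys \<psi> bs \<in> U"
      "\<forall>bs\<in>koszul_idx (length ys) j. g * \<phi> bs - koszul_d ys \<theta> bs \<in> U" unfolding K_def by blast
    have "(f + g) * \<phi> bs - koszul_d ys (\<lambda>t. \<psi> t + \<theta> t) bs \<in> U" if "bs \<in> koszul_idx (length ys) j" for bs
      using submod_add[OF assms(2) *(3)[rule_format, OF that] *(4)[rule_format, OF that]]
      by (simp add: koszul_d_add algebra_simps)
    then show "f + g \<in> K" using *(1,2) submod_add[OF assms(1)] unfolding K_def
      by (intro CollectI exI[of _ "\<lambda>t. \<psi> t + \<theta> t"]) simp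
  next
    fix s f assume "s \<in> S" "f \<in> K"
    then obtain \<psi> where *: "\<forall>bs. \<psi> bs \<in> N"
      "\<forall>bs\<in>koszul_idx (length ys) j. f * \<phi> bs - koszul_d ys \<psi> bs \<in> U" unfolding K_def by blast
    have "(s * f) * \<phi> bs - koszul_d ys (\<lambda>t. s * \<psi> t) bs \<in> U" if "bs \<in> koszul_idx (length ys) j" for bs
      using submod_mult[OF assms(2) \<open>s \<in> S\<close> *(2)[rule_format, OF that]]
      by (simp add: koszul_d_mult algebra_simps)
    then show "s * f \<in> K" using *(1) submod_mult[OF assms(1) \<open>s \<in> S\<close>] unfolding K_def
      by (intro CollectI exI[of _ "\<lambda>t. s * \<psi> t"]) simp
  qed
  have "y \<in> K" if "y \<in> set ys" for y
  proof -
    obtain k where k: "k < length ys" "y = ys ! k" using \<open>y \<in> set ys\<close> by (metis in_set_conv_nth)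
    have "y * \<phi> bs - koszul_d ys (koszul_h k \<phi>) bs \<in> U" if bs: "bs \<in> koszul_idx (length ys) j" for bs
    proof -
      have "y * \<phi> bs - koszul_d ys (koszul_h k \<phi>) bs = koszul_h k (koszul_d ys \<phi>) bs"
        using koszul_homotopy[OF k(1), of bs \<phi>] bs by (simp add: k koszul_idx_def)
      then show ?thesis using koszul_h_idx[OF c bs] submod_zero[OF assms(2)] submod_uminus[OF assms(2)] by auto
    qed
    then show ?thesis unfolding K_def using koszul_h_mem[OF assms(1) \<phi>]
      by (intro CollectI exI[of _ "koszul_h k \<phi>"]) simp
  qed
  then have "lin_combs S ys \<subseteq> K"
    by (intro lin_combs_subset[OF K]) (metis K mult.commute submod_mult)
  then show ?thesis using assms(5) unfolding K_def by blast
qed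

text \<open>In the sequence 0 -> N/U -> N/U -> N/(U + fN) -> 0, vanishing of H^(j-1) of the cokernel
  makes \<open>f\<close> injective on H^j(N/U). Since a power of \<open>f\<close> acts there as zero
  by \<open>koszul_kill\<close>, H^j(N/U) vanishes.\<close>

lemma koszul_vanish_regular:
  assumes "submod N" "submod U" "U \<subseteq> N" "set ys \<subseteq> S" "f \<in> S" "f ^ k \<in> lin_combs S ys"
    and reg: "\<And>x. x \<in> N \<Longrightarrow> f * x \<in> U \<Longrightarrow> x \<in> U"
    and van: "koszul_vanish ys t N {u + f * a | u a. u \<in> U \<and> a \<in> N}"
  shows "koszul_vanish ys (Suc t) N U"
proof (rule koszul_vanishI)
  fix j \<phi> assume j: "j < Suc t" and \<phi>: "\<And>bs. \<phi> bs \<in> N"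
    and c: "\<And>bs. bs \<in> koszul_idx (length ys) (Suc j) \<Longrightarrow> koszul_d ys \<phi> bs \<in> U"
  \<comment> \<open>\<open>?B k\<close> says that \<open>f ^ k\<close> kills the class of
    \<open>\<phi>\<close>; injectivity brings the exponent down to 0.\<close>
  let ?B = "\<lambda>k. \<exists>\<psi>. (\<forall>bs. \<psi> bs \<in> N) \<and>
      (\<forall>bs\<in>koszul_idx (length ys) j. f ^ k * \<phi> bs - koszul_d ys \<psi> bs \<in> U)"
  have step: "?B k" if B: "?B (Suc k)" for k
  proof (cases j)
    case 0
    \<comment> \<open>In degree 0 there are no coboundaries, and regularity of \<open>f\<close> on
      N/U applies directly.\<close>
    have "f ^ k * \<phi> bs - koszul_d ys (\<lambda>_. 0) bs \<in> U" if bs: "bs \<in> koszul_idx (length ys) j" for bs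
    proof -
      have "f * (f ^ k * \<phi> bs) \<in> U"
        using B bs koszul_d_idx_zero[of bs "length ys" ys] by (auto simp: 0 ac_simps)
      moreover have "f ^ k * \<phi> bs \<in> N"
        using submod_mult[OF assms(1) S_power[OF assms(5)] \<phi>] .
      ultimately show ?thesis using reg by simp
    qed
    then show ?thesis using submod_zero[OF assms(1)] by (intro exI[of _ "\<lambda>_. 0"]) auto
  next
    case (Suc i)
    obtain \<psi> where \<psi>: "\<And>bs. \<psi> bs \<in> N"
      "\<And>bs. bs \<in> koszul_idx (length ys) j \<Longrightarrow> f ^ Suc k * \<phi> bs - koszul_d ys \<psi> bs \<in> U"
      using B by blast
    \<comment> \<open>Modulo \<open>U + f N\<close> the cochain \<open>\<psi>\<close> is a cocycle
      one degree lower, hence a coboundary; \<open>\<beta>\<close> below is what remains of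
      \<open>\<psi>\<close>, divided by \<open>f\<close>.\<close>
    have d: "koszul_d ys \<psi> bs \<in> {u + f * a | u a. u \<in> U \<and> a \<in> N}" if bs: "bs \<in> koszul_idx (length ys) (Suc i)" for bs
    proof -
      have "- (f ^ Suc k * \<phi> bs - koszul_d ys \<psi> bs) \<in> U"
        using submod_uminus[OF assms(2) \<psi>(2)] bs Suc by blast
      moreover have "f ^ k * \<phi> bs \<in> N"
        using submod_mult[OF assms(1) S_power[OF assms(5)] \<phi>] .
      moreover have "koszul_d ys \<psi> bs = - (f ^ Suc k * \<phi> bs - koszul_d ys \<psi> bs) + f * (f ^ k * \<phi> bs)"
        by (simp add: algebra_simps)
      ultimately show ?thesis by blast
    qed
    have "i < t" using j Suc by simp
    obtain \<alpha> where \<alpha>: "\<And>bs. \<alpha> bs \<in> N"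
      "\<And>bs. bs \<in> koszul_idx (length ys) i \<Longrightarrow> \<psi> bs - koszul_d ys \<alpha> bs \<in> {u + f * a | u a. u \<in> U \<and> a \<in> N}"
      using koszul_vanishE[OF van \<open>i < t\<close> \<psi>(1) d] by blast
    have "\<exists>a. a \<in> N \<and> (bs \<in> koszul_idx (length ys) i \<longrightarrow> \<psi> bs - koszul_d ys \<alpha> bs - f * a \<in> U)" for bs
    proof (cases "bs \<in> koszul_idx (length ys) i")
      case True
      then obtain u a where "\<psi> bs - koszul_d ys \<alpha> bs = u + f * a" "u \<in> U" "a \<in> N" using \<alpha>(2) by blast
      then show ?thesis by (intro exI[of _ a]) simp
    qed (use submod_zero[OF assms(1)] in blast)
    then obtain \<beta> where \<beta>: "\<And>bs. \<beta> bs \<in> N"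
      "\<And>bs. bs \<in> koszul_idx (length ys) i \<Longrightarrow> \<psi> bs - koszul_d ys \<alpha> bs - f * \<beta> bs \<in> U"
      by metis
    have "f ^ k * \<phi> bs - koszul_d ys \<beta> bs \<in> U" if bs: "bs \<in> koszul_idx (length ys) j" for bs
    proof (rule reg)
      show "f ^ k * \<phi> bs - koszul_d ys \<beta> bs \<in> N"
        by (intro submod_diff[OF assms(1)] submod_mult[OF assms(1) S_power[OF assms(5)] \<phi>]
            koszul_d_mem[OF assms(1,4) \<beta>(1)])
      have "koszul_d ys (\<lambda>t. \<psi> t - koszul_d ys \<alpha> t - f * \<beta> t) bs \<in> U"
        by (rule koszul_d_idx[OF assms(2,4) \<beta>(2)]) (use bs Suc in auto)
      then have "koszul_d ys \<psi> bs - f * koszul_d ys \<beta> bs \<in> U"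
        by (simp add: koszul_d_diff koszul_d_d koszul_d_mult)
      from submod_add[OF assms(2) \<psi>(2)[OF bs] this]
      show "f * (f ^ k * \<phi> bs - koszul_d ys \<beta> bs) \<in> U" by (simp add: algebra_simps)
    qed
    then show ?thesis using \<beta>(1) by (intro exI[of _ \<beta>]) simp
  qed
  have "?B k" using koszul_kill[OF assms(1-4,6) \<phi> c] .
  then have "?B 0" by (induction k) (use step in blast)+
  then show "\<exists>\<psi>. (\<forall>bs. \<psi> bs \<in> N) \<and> (\<forall>bs\<in>koszul_idx (length ys) j. \<phi> bs - koszul_d ys \<psi> bs \<in> U)"
    by simp
qed

text \<open>If \<open>y\<close> acts as zero on N/U, the mapping cone splits: extending a cocycle
  for \<open>ys\<close> by zero to the lists that begin with \<open>True\<close> gives a cocycle for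
  \<open>y # ys\<close>.\<close>

lemma koszul_vanish_drop_zero:
  assumes "submod N" "submod U" "U \<subseteq> N" "y \<in> S" "set ys \<subseteq> S" "\<And>x. x \<in> N \<Longrightarrow> y * x \<in> U"
    and van: "koszul_vanish (y # ys) t N U"
  shows "koszul_vanish ys t N U"
proof (rule koszul_vanishI)
  fix j \<phi> assume j: "j < t" and \<phi>: "\<And>bs. \<phi> bs \<in> N"
    and c: "\<And>bs. bs \<in> koszul_idx (length ys) (Suc j) \<Longrightarrow> koszul_d ys \<phi> bs \<in> U"
  define \<Phi> where "\<Phi> bs = (case bs of [] \<Rightarrow> 0 | b # bs' \<Rightarrow> if b then 0 else \<phi> bs')" for bs
  have \<Phi>: "\<Phi> bs \<in> N" for bs using \<phi> submod_zero[OF assms(1)] by (auto simp: \<Phi>_def split: list.split)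
  have "koszul_d (y # ys) \<Phi> bs \<in> U" if bs: "bs \<in> koszul_idx (length (y # ys)) (Suc j)" for bs
  proof -
    obtain b bs' where b: "bs = b # bs'" using bs by (cases bs) (auto simp: koszul_idx_def)
    show ?thesis using bs c \<phi> assms(6) by (cases b) (auto simp: b \<Phi>_def)
  qed
  then obtain \<Psi> where \<Psi>: "\<And>bs. \<Psi> bs \<in> N"
    "\<And>bs. bs \<in> koszul_idx (length (y # ys)) j \<Longrightarrow> \<Phi> bs - koszul_d (y # ys) \<Psi> bs \<in> U"
    using koszul_vanishE[OF van j, of \<Phi>] \<Phi> by blast
  have "\<phi> bs - koszul_d ys (\<lambda>t. \<Psi> (False # t)) bs \<in> U" if "bs \<in> koszul_idx (length ys) j" for bs
    using \<Psi>(2)[of "False # bs"] that by (simp add: \<Phi>_def)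
  then show "\<exists>\<psi>. (\<forall>bs. \<psi> bs \<in> N) \<and> (\<forall>bs\<in>koszul_idx (length ys) j. \<phi> bs - koszul_d ys \<psi> bs \<in> U)"
    using \<Psi>(1) by (intro exI[of _ "\<lambda>t. \<Psi> (False # t)"]) simp
qed

text \<open>In the cone sequence H^j(ys) -> H^j(ys) -> H^(j+1)(y # ys) the first map is
  multiplication by \<open>y\<close> up to sign and the last group is zero. So every class is
  divisible by \<open>y\<close>, and by iteration by each of its powers.\<close>

lemma koszul_vanish_divisible:
  assumes "submod N" "submod U" "U \<subseteq> N" "y \<in> S" "set ys \<subseteq> S"
    and van: "koszul_vanish (y # ys) (Suc t) N U"
    and j: "j < t" and \<phi>: "\<And>bs. \<phi> bs \<in> N"
    and c: "\<And>bs. bs \<in> koszul_idx (length ys) (Suc j) \<Longrightarrow> koszul_d ys \<phi> bs \<in> U"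
  shows "\<exists>\<phi>' \<psi>. (\<forall>bs. \<phi>' bs \<in> N) \<and> (\<forall>bs. \<psi> bs \<in> N) \<and>
    (\<forall>bs\<in>koszul_idx (length ys) j. \<phi> bs - y ^ k * \<phi>' bs - koszul_d ys \<psi> bs \<in> U) \<and>
    (\<forall>bs\<in>koszul_idx (length ys) (Suc j). koszul_d ys \<phi>' bs \<in> U)"
proof (induction k)
  case 0
  show ?case
    by (rule exI[of _ \<phi>], rule exI[of _ "\<lambda>_. 0"]) (use \<phi> c submod_zero[OF assms(1)] submod_zero[OF assms(2)] in auto)
next
  case (Suc k)
  then obtain \<phi>' \<psi> where *: "\<And>bs. \<phi>' bs \<in> N" "\<And>bs. \<psi> bs \<in> N"
    "\<And>bs. bs\<in>koszul_idx (length ys) j \<Longrightarrow> \<phi> bs - y ^ k * \<phi>' bs - koszul_d ys \<psi> bs \<in> U"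
    "\<And>bs. bs\<in>koszul_idx (length ys) (Suc j) \<Longrightarrow> koszul_d ys \<phi>' bs \<in> U" by blast
  \<comment> \<open>Placed on the lists that begin with \<open>True\<close>, \<open>\<phi>'\<close>
    becomes a cocycle of degree \<open>j + 1\<close> for \<open>y # ys\<close>, and a primitive of
    it divides \<open>\<phi>'\<close> by \<open>y\<close>.\<close>
  define \<Phi> where "\<Phi> bs = (case bs of [] \<Rightarrow> 0 | b # bs' \<Rightarrow> if b then \<phi>' bs' else 0)" for bs
  have \<Phi>: "\<Phi> bs \<in> N" for bs using *(1) submod_zero[OF assms(1)] by (auto simp: \<Phi>_def split: list.split)
  have d: "koszul_d (y # ys) \<Phi> bs \<in> U" if bs: "bs \<in> koszul_idx (length (y # ys)) (Suc (Suc j))" for bs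
  proof -
    obtain b bs' where b: "bs = b # bs'" using bs by (cases bs) (auto simp: koszul_idx_def)
    show ?thesis using bs *(4) submod_zero[OF assms(2)] submod_uminus[OF assms(2)]
      by (cases b) (auto simp: b \<Phi>_def)
  qed
  have "Suc j < Suc t" using j by simp
  obtain \<Psi> where \<Psi>: "\<And>bs. \<Psi> bs \<in> N"
    "\<And>bs. bs \<in> koszul_idx (length (y # ys)) (Suc j) \<Longrightarrow> \<Phi> bs - koszul_d (y # ys) \<Psi> bs \<in> U"
    using koszul_vanishE[OF van \<open>Suc j < Suc t\<close> \<Phi> d] by blast
  have 1: "\<phi>' bs - y * \<Psi> (False # bs) + koszul_d ys (\<lambda>t. \<Psi> (True # t)) bs \<in> U"
    if "bs \<in> koszul_idx (length ys) j" for bs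
    using \<Psi>(2)[of "True # bs"] that by (simp add: \<Phi>_def algebra_simps)
  have 2: "koszul_d ys (\<lambda>t. \<Psi> (False # t)) bs \<in> U" if "bs \<in> koszul_idx (length ys) (Suc j)" for bs
    using \<Psi>(2)[of "False # bs"] that submod_uminus[OF assms(2)] by (force simp: \<Phi>_def)
  show ?case
  \<comment> \<open>The \<open>False\<close> part of the primitive is the new quotient; its
    \<open>True\<close> part, scaled by \<open>y ^ k\<close>, joins the accumulated
    coboundary.\<close>
  proof (rule exI[of _ "\<lambda>t. \<Psi> (False # t)"], rule exI[of _ "\<lambda>t. \<psi> t - y ^ k * \<Psi> (True # t)"],
      intro conjI allI ballI)
    fix bs
    show "\<psi> bs - y ^ k * \<Psi> (True # bs) \<in> N"
      by (intro submod_diff[OF assms(1)] submod_mult[OF assms(1) S_power[OF \<open>y \<in> S\<close>]] *(2) \<Psi>(1))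
  next
    fix bs assume bs: "bs \<in> koszul_idx (length ys) j"
    show "\<phi> bs - y ^ Suc k * \<Psi> (False # bs) - koszul_d ys (\<lambda>t. \<psi> t - y ^ k * \<Psi> (True # t)) bs \<in> U"
      using submod_add[OF assms(2) *(3)[OF bs] submod_mult[OF assms(2) S_power[OF \<open>y \<in> S\<close>, of k] 1[OF bs]]]
      by (simp add: koszul_d_diff koszul_d_mult algebra_simps)
  qed (use \<Psi> 2 in blast)+
qed

text \<open>The all-\<open>True\<close> list is the only basis element of top degree, and the
  coboundaries there are exactly (ys) N.\<close>

lemma koszul_d_top:
  assumes "submod N" "set ys \<subseteq> S"
  shows "b \<in> lin_combs N ys \<Longrightarrow> \<exists>\<phi>. (\<forall>bs. \<phi> bs \<in> N) \<and> koszul_d ys \<phi> (replicate (length ys) True) = b"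
    and "(\<And>bs. \<phi> bs \<in> N) \<Longrightarrow> koszul_d ys \<phi> (replicate (length ys) True) \<in> lin_combs N ys"
proof -
  show "b \<in> lin_combs N ys \<Longrightarrow> \<exists>\<phi>. (\<forall>bs. \<phi> bs \<in> N) \<and> koszul_d ys \<phi> (replicate (length ys) True) = b"
  proof (induction ys arbitrary: b)
    case Nil
    then show ?case using submod_zero[OF assms(1)] by (auto intro!: exI[of _ "\<lambda>_. 0"])
  next
    case (Cons y ys)
    then obtain a c where b: "b = y * a + c" "a \<in> N" "c \<in> lin_combs N ys" by auto
    with Cons.IH obtain \<phi> where \<phi>: "\<forall>bs. \<phi> bs \<in> N" "koszul_d ys \<phi> (replicate (length ys) True) = c" by blast
    \<comment> \<open>The minus sign undoes the one in \<open>koszul_d\<close>. Of the lists not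
      beginning with \<open>True\<close> only one is read; the value \<open>a\<close> at all of them
      keeps the cochain in \<open>N\<close>.\<close>
    let ?\<Phi> = "\<lambda>bs. case bs of [] \<Rightarrow> a | b # bs' \<Rightarrow> if b then - \<phi> bs' else a"
    show ?case
      by (intro exI[of _ ?\<Phi>])
        (use \<phi> b submod_uminus[OF assms(1)] in \<open>auto simp: koszul_d_uminus split: list.split\<close>)
  qed
  show "(\<And>bs. \<phi> bs \<in> N) \<Longrightarrow> koszul_d ys \<phi> (replicate (length ys) True) \<in> lin_combs N ys"
    using assms(2)
  proof (induction ys arbitrary: \<phi>)
    case (Cons y ys)
    have "- koszul_d ys (\<lambda>t. \<phi> (True # t)) (replicate (length ys) True) \<in> lin_combs N ys"
      using submod_uminus[OF submod_lin_combs[OF assms(1)]] Cons by simp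
    then show ?case using Cons.prems(1) by force
  qed simp
qed

text \<open>Vanishing one degree below the top makes \<open>y\<close> regular on N modulo
  \<open>U + (ys) N\<close>: by \<open>y * x = u + b\<close>, the element \<open>x\<close> and a
  cochain producing \<open>b\<close> form a cocycle in that degree, and a primitive of it places
  \<open>x\<close> in \<open>U + (ys) N\<close>.\<close>

lemma koszul_vanish_imp_regular:
  assumes "submod N" "submod U" "U \<subseteq> N" "y \<in> S" "set ys \<subseteq> S"
    and van: "koszul_vanish (y # ys) (Suc (length ys)) N U"
    and x: "x \<in> N" and yx: "y * x = u + b" and u: "u \<in> U" and b: "b \<in> lin_combs N ys"
  obtains u' b' where "x = u' + b'" "u' \<in> U" "b' \<in> lin_combs N ys"
proof -
  let ?T = "replicate (length ys) True"
  have idx: "bs \<in> koszul_idx n n \<longleftrightarrow> bs = replicate n True" for bs and n :: nat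
  proof
    assume "bs \<in> koszul_idx n n"
    then show "bs = replicate n True"
    proof (induction bs arbitrary: n)
      case (Cons b bs)
      have "count_list bs True \<le> length bs" by (rule count_le_length)
      then obtain n' where "n = Suc n'" "b" using Cons.prems by (cases n) (auto simp: koszul_idx_def split: if_splits)
      then show ?case using Cons by (cases b) auto
    qed (auto simp: koszul_idx_def)
  next
    assume "bs = replicate n True"
    then show "bs \<in> koszul_idx n n" by (induction n arbitrary: bs) (auto simp: koszul_idx_def)
  qed
  obtain \<phi> where \<phi>: "\<forall>bs. \<phi> bs \<in> N" "koszul_d ys \<phi> ?T = b"
    using koszul_d_top(1)[OF assms(1,5) b] by blast
  define \<Phi> where "\<Phi> bs = (case bs of [] \<Rightarrow> 0 | b # bs' \<Rightarrow> if b then \<phi> bs' else x)" for bs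
  have \<Phi>: "\<Phi> bs \<in> N" for bs using \<phi>(1) x submod_zero[OF assms(1)] by (auto simp: \<Phi>_def split: list.split)
  \<comment> \<open>At the single list of top degree the differential of \<open>\<Phi>\<close> is
    \<open>y * x - b\<close>, that is \<open>u\<close>.\<close>
  have "koszul_d (y # ys) \<Phi> bs \<in> U" if "bs \<in> koszul_idx (length (y # ys)) (Suc (length ys))" for bs
    using that \<phi>(2) yx u by (simp add: idx \<Phi>_def)
  then obtain \<Psi> where \<Psi>: "\<And>bs. \<Psi> bs \<in> N"
    "\<And>bs. bs \<in> koszul_idx (length (y # ys)) (length ys) \<Longrightarrow> \<Phi> bs - koszul_d (y # ys) \<Psi> bs \<in> U"
    using koszul_vanishE[OF van, of "length ys" \<Phi>] \<Phi> by blast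
  have "x - koszul_d ys (\<lambda>t. \<Psi> (False # t)) ?T \<in> U"
    using \<Psi>(2)[of "False # ?T"] by (simp add: \<Phi>_def idx)
  moreover have "koszul_d ys (\<lambda>t. \<Psi> (False # t)) ?T \<in> lin_combs N ys"
    by (rule koszul_d_top(2)[OF assms(1,5) \<Psi>(1)])
  ultimately show ?thesis
    using that[of "x - koszul_d ys (\<lambda>t. \<Psi> (False # t)) ?T" "koszul_d ys (\<lambda>t. \<Psi> (False # t)) ?T"]
    by (metis diff_add_cancel)
qed

lemma submod_submod_plus:
  assumes "submod N" "submod U" "set rs \<subseteq> S" shows "submod (submod_plus N U rs)"
proof -
  have C: "submod (lin_combs N rs)" using submod_lin_combs assms by blast
  show ?thesis
    unfolding submod_def submod_plus_def
  proof (intro conjI ballI)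
    show "0 \<in> {u + b | u b. u \<in> U \<and> b \<in> lin_combs N rs}"
      using submod_zero[OF assms(2)] submod_zero[OF C] by force
  next
    fix x y assume "x \<in> {u + b | u b. u \<in> U \<and> b \<in> lin_combs N rs}" "y \<in> {u + b | u b. u \<in> U \<and> b \<in> lin_combs N rs}"
    then obtain u b v c where *: "x = u + b" "y = v + c" "u \<in> U" "b \<in> lin_combs N rs" "v \<in> U" "c \<in> lin_combs N rs" by auto
    then have "x + y = (u + v) + (b + c)" by (simp add: algebra_simps)
    then show "x + y \<in> {u + b | u b. u \<in> U \<and> b \<in> lin_combs N rs}"
      using submod_add[OF assms(2) *(3,5)] submod_add[OF C *(4,6)] by blast
  next
    fix s x assume s: "s \<in> S" and "x \<in> {u + b | u b. u \<in> U \<and> b \<in> lin_combs N rs}"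
    then obtain u b where *: "x = u + b" "u \<in> U" "b \<in> lin_combs N rs" by auto
    then have "s * x = s * u + s * b" by (simp add: algebra_simps)
    then show "s * x \<in> {u + b | u b. u \<in> U \<and> b \<in> lin_combs N rs}"
      using submod_mult[OF assms(2) s *(2)] submod_mult[OF C s *(3)] by blast
  qed
qed

text \<open>The newest element of a sequence stands at the head, hence the reversed lists in what
  follows. The right-hand side is the submodule \<open>U + f N\<close> of
  \<open>koszul_vanish_regular\<close>, with the earlier elements absorbed into
  \<open>U\<close>.\<close>

lemma submod_plus_Cons: "submod_plus N U (f # rs) = {u + f * a | u a. u \<in> submod_plus N U rs \<and> a \<in> N}"
proof -
  have "x \<in> submod_plus N U (f # rs) \<longleftrightarrow> (\<exists>u a b. u \<in> U \<and> a \<in> N \<and> b \<in> lin_combs N rs \<and> x = u + f * a + b)" for x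
    unfolding submod_plus_def lin_combs.simps by (auto simp: algebra_simps; metis add.assoc add.commute)
  moreover have "x \<in> {u + f * a | u a. u \<in> submod_plus N U rs \<and> a \<in> N} \<longleftrightarrow>
      (\<exists>u a b. u \<in> U \<and> a \<in> N \<and> b \<in> lin_combs N rs \<and> x = u + f * a + b)" for x
    unfolding submod_plus_def by (auto simp: algebra_simps; metis add.assoc add.commute)
  ultimately show ?thesis by blast
qed

lemma submod_plus_Nil: "submod_plus N U [] = U"
  by (auto simp: submod_plus_def)

lemma submod_plus_subset:
  assumes "submod N" "U \<subseteq> N" "set rs \<subseteq> S" shows "submod_plus N U rs \<subseteq> N"
proof -
  have "lin_combs N rs \<subseteq> N" by (rule lin_combs_subset) (use assms submod_mult in blast)+
  then show ?thesis using assms submod_add by (fastforce simp: submod_plus_def)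
qed

text \<open>Starts at the quotient by the whole sequence, where vanishing below degree 0 is void,
  and takes elements back from the end; each adds a degree by
  \<open>koszul_vanish_regular\<close>.\<close>

lemma regular_imp_koszul_vanish:
  assumes "submod N" "submod U" "U \<subseteq> N" "set ys \<subseteq> S" "set rs \<subseteq> S"
    and pow: "\<And>f. f \<in> set rs \<Longrightarrow> \<exists>k. f ^ k \<in> lin_combs S ys"
    and reg: "\<And>i x. i < length rs \<Longrightarrow> x \<in> N \<Longrightarrow> rs ! i * x \<in> submod_plus N U (rev (take i rs)) \<Longrightarrow> x \<in> submod_plus N U (rev (take i rs))"
  shows "koszul_vanish ys (length rs) N U"
proof -
  have "koszul_vanish ys j N (submod_plus N U (rev (take (length rs - j) rs)))" if "j \<le> length rs" for j
    using that
  proof (induction j)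
    case 0
    show ?case by (simp add: koszul_vanish_def)
  next
    case (Suc j)
    let ?i = "length rs - Suc j"
    have i: "?i < length rs" "length rs - j = Suc ?i" using Suc.prems by auto
    have sub: "set (rev (take ?i rs)) \<subseteq> S" using assms(5) set_take_subset by fastforce
    have f: "rs ! ?i \<in> set rs" using i by simp
    then obtain k where k: "(rs ! ?i) ^ k \<in> lin_combs S ys" using pow by blast
    have van: "koszul_vanish ys j N {u + rs ! ?i * a | u a. u \<in> submod_plus N U (rev (take ?i rs)) \<and> a \<in> N}"
      using Suc i by (simp add: take_Suc_conv_app_nth submod_plus_Cons)
    show ?case
      by (rule koszul_vanish_regular[OF assms(1) submod_submod_plus[OF assms(1,2) sub]
            submod_plus_subset[OF assms(1,3) sub] assms(4) _ k reg[OF i(1)] van])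
        (use f assms(5) in auto)
  qed
  from this[of "length rs"] show ?thesis by (simp add: submod_plus_Nil)
qed

text \<open>H^0 consists of the classes annihilated by all of \<open>ys\<close>. The cochain is
  constantly \<open>z\<close> because only its value at the all-\<open>False\<close> list
  counts.\<close>

lemma koszul_vanish_0:
  assumes "submod U" "set ys \<subseteq> S" "koszul_vanish ys (Suc t) N U" "z \<in> N" "\<And>y. y \<in> set ys \<Longrightarrow> y * z \<in> U"
  shows "z \<in> U"
proof -
  have d: "koszul_d ys (\<lambda>_. z) bs \<in> U" if "bs \<in> koszul_idx (length ys) (Suc 0)" for bs
    using that assms(5)
  proof (induction ys arbitrary: bs)
    case (Cons y ys)
    then obtain b bs' where bs: "bs = b # bs'" by (cases bs) (auto simp: koszul_idx_def)
    show ?case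
    proof (cases b)
      case True
      then have "bs' \<in> koszul_idx (length ys) 0" using Cons.prems(1) by (simp add: bs)
      then show ?thesis using Cons.prems(2) koszul_d_idx_zero[of bs' "length ys" ys] by (simp add: bs True)
    next
      case False
      then show ?thesis using Cons by (simp add: bs)
    qed
  qed (simp add: submod_zero[OF assms(1)])
  obtain \<psi> where \<psi>: "\<And>bs. bs \<in> koszul_idx (length ys) 0 \<Longrightarrow> z - koszul_d ys \<psi> bs \<in> U"
    using koszul_vanishE[OF assms(3) zero_less_Suc assms(4) d] by blast
  have "replicate (length ys) False \<in> koszul_idx (length ys) 0"
    by (induction ys) (auto simp: koszul_idx_def)
  from \<psi>[OF this] koszul_d_idx_zero[OF this, of ys \<psi>] show ?thesis by simp
qed

end

section \<open>Monomial submodules and the grading\<close>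

text \<open>Subspaces spanned by monomials. The Stanley-Reisner ideals have this form, so they can
  be compared monomial by monomial, and truncation in degree preserves them.\<close>

definition mon_span :: "('v \<Rightarrow>\<^sub>0 nat) set \<Rightarrow> (('v \<Rightarrow>\<^sub>0 nat) \<Rightarrow>\<^sub>0 'k::field) set" where
  "mon_span A = {p. Poly_Mapping.keys p \<subseteq> A}"

definition exps :: "'v set \<Rightarrow> ('v \<Rightarrow>\<^sub>0 nat) set" where
  "exps V = {m. Poly_Mapping.keys m \<subseteq> V}"

lemma carrier_mpoly_ring: "carrier (mpoly_ring V) = mon_span (exps V)"
  by (auto simp: mpoly_ring_def mon_span_def exps_def)

lemma mpoly_ring_simps [simp]:
  "x \<otimes>\<^bsub>mpoly_ring V\<^esub> y = x * y" "x \<oplus>\<^bsub>mpoly_ring V\<^esub> y = x + y"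
  "\<zero>\<^bsub>mpoly_ring V\<^esub> = 0" "\<one>\<^bsub>mpoly_ring V\<^esub> = 1"
  by (simp_all add: mpoly_ring_def)

lemma keys_add_nat: "Poly_Mapping.keys (a + b) = Poly_Mapping.keys a \<union> Poly_Mapping.keys (b :: 'v \<Rightarrow>\<^sub>0 nat)"
  by (auto simp: in_keys_iff lookup_add)

lemma exps_zero: "0 \<in> exps V" and exps_add: "a \<in> exps V \<Longrightarrow> b \<in> exps V \<Longrightarrow> a + b \<in> exps V"
  by (auto simp: exps_def keys_add_nat)

interpretation mp: base_ring "mon_span (exps V) :: (('v \<Rightarrow>\<^sub>0 nat) \<Rightarrow>\<^sub>0 'k::field) set" for V
proof
  fix x y :: "('v \<Rightarrow>\<^sub>0 nat) \<Rightarrow>\<^sub>0 'k"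
  assume "x \<in> mon_span (exps V)" "y \<in> mon_span (exps V)"
  then show "x + y \<in> mon_span (exps V)" "x * y \<in> mon_span (exps V)"
    using keys_add[of x y] keys_mult[of x y] by (fastforce simp: mon_span_def exps_add)+
qed (auto simp: mon_span_def exps_zero)

lemma poly_mapping_sum_singles: "p = (\<Sum>m\<in>Poly_Mapping.keys p. Poly_Mapping.single m (Poly_Mapping.lookup p m))"
  by (rule poly_mapping_eqI) (auto simp: lookup_sum lookup_single when_def in_keys_iff)

lemma sum_singles_induct:
  fixes p :: "'a \<Rightarrow>\<^sub>0 'b::comm_monoid_add"
  assumes "J 0" "\<And>x y. J x \<Longrightarrow> J y \<Longrightarrow> J (x + y)"
    and "\<And>m. m \<in> Poly_Mapping.keys p \<Longrightarrow> J (Poly_Mapping.single m (Poly_Mapping.lookup p m))"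
  shows "J p"
proof -
  have "J (\<Sum>m\<in>A. Poly_Mapping.single m (Poly_Mapping.lookup p m))"
    if "finite A" "A \<subseteq> Poly_Mapping.keys p" for A
    using that by (induction A) (auto intro: assms)
  from this[OF finite_keys order_refl] show ?thesis by (simp flip: poly_mapping_sum_singles)
qed

lemma lookup_single_mult:
  "Poly_Mapping.lookup (Poly_Mapping.single (a :: 'v \<Rightarrow>\<^sub>0 nat) c * p) (a + m) = c * Poly_Mapping.lookup p (m :: 'v \<Rightarrow>\<^sub>0 nat)"
proof (rule sum_singles_induct[of _ p])
  show "Poly_Mapping.lookup (Poly_Mapping.single a c * Poly_Mapping.single n (Poly_Mapping.lookup p n)) (a + m) =
      c * Poly_Mapping.lookup (Poly_Mapping.single n (Poly_Mapping.lookup p n)) m" for n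
    by (simp add: mult_single lookup_single when_def)
qed (auto simp: distrib_left lookup_add)

lemma keys_single_mult:
  assumes "c \<noteq> (0::'k::field)"
  shows "Poly_Mapping.keys (Poly_Mapping.single a c * p) = (+) (a :: 'v \<Rightarrow>\<^sub>0 nat) ` Poly_Mapping.keys p"
  using assms keys_mult[of "Poly_Mapping.single a c" p]
  by (fastforce simp: in_keys_iff lookup_single_mult)

lemma mon_span_add: "p \<in> mon_span A \<Longrightarrow> q \<in> mon_span A \<Longrightarrow> p + q \<in> mon_span A"
  using keys_add[of p q] by (auto simp: mon_span_def)

lemma mon_span_mono: "A \<subseteq> B \<Longrightarrow> mon_span A \<subseteq> mon_span B"
  by (auto simp: mon_span_def)

lemma mon_span_times:
  assumes "\<And>a b. a \<in> A \<Longrightarrow> b \<in> B \<Longrightarrow> a + b \<in> C" "p \<in> mon_span A" "q \<in> mon_span B"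
  shows "p * q \<in> mon_span C"
  using assms keys_mult[of p q] by (fastforce simp: mon_span_def)

lemma submod_mon_span:
  assumes "\<And>a b. a \<in> exps V \<Longrightarrow> b \<in> B \<Longrightarrow> a + b \<in> B"
  shows "mp.submod V (mon_span B)"
  unfolding mp.submod_def
  by (intro conjI ballI mon_span_add mon_span_times[OF assms]) (auto simp: mon_span_def)

text \<open>Brings the submodule \<open>U + f N\<close> of \<open>koszul_vanish_regular\<close> back
  into monomial form when \<open>f\<close> is a monomial.\<close>

lemma mon_span_add_single_mult:
  "{u + Poly_Mapping.single a (1::'k::field) * x | u x. u \<in> mon_span A \<and> x \<in> mon_span B} =
    mon_span (A \<union> (+) (a :: 'v \<Rightarrow>\<^sub>0 nat) ` B)" (is "?L = ?R")
proof
  have "u + Poly_Mapping.single a 1 * x \<in> ?R" if "u \<in> mon_span A" "x \<in> mon_span B" for u x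
  proof (rule mon_span_add)
    show "u \<in> ?R" "Poly_Mapping.single a 1 * x \<in> ?R"
      using that by (auto simp: mon_span_def keys_single_mult)
  qed
  then show "?L \<subseteq> ?R" by blast
  show "?R \<subseteq> ?L"
  proof
    fix p :: "('v \<Rightarrow>\<^sub>0 nat) \<Rightarrow>\<^sub>0 'k" assume p: "p \<in> ?R"
    show "p \<in> ?L"
    proof (rule sum_singles_induct[of "\<lambda>p. p \<in> ?L"])
      show "0 \<in> ?L" by (intro CollectI exI[of _ 0]) (simp add: mon_span_def)
    next
      fix p q assume "p \<in> ?L" "q \<in> ?L"
      then obtain u x v y where *: "p = u + Poly_Mapping.single a 1 * x" "q = v + Poly_Mapping.single a 1 * y"
        "u \<in> mon_span A" "v \<in> mon_span A" "x \<in> mon_span B" "y \<in> mon_span B" by blast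
      then have "p + q = (u + v) + Poly_Mapping.single a 1 * (x + y)" by (simp add: algebra_simps)
      then show "p + q \<in> ?L" using mon_span_add *(3-6) by blast
    next
      fix m assume "m \<in> Poly_Mapping.keys p"
      then consider "m \<in> A" | b where "b \<in> B" "m = a + b" using p by (auto simp: mon_span_def)
      then show "Poly_Mapping.single m (Poly_Mapping.lookup p m) \<in> ?L"
      proof cases
        case 1
        then show ?thesis
          by (intro CollectI, rule_tac x = "Poly_Mapping.single m (Poly_Mapping.lookup p m)" in exI, rule_tac x = 0 in exI)
            (auto simp: mon_span_def)
      next
        case 2
        have "Poly_Mapping.single m (Poly_Mapping.lookup p m) =
            0 + Poly_Mapping.single a 1 * Poly_Mapping.single b (Poly_Mapping.lookup p m)"
          by (simp add: 2 mult_single)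
        moreover have "Poly_Mapping.single b (Poly_Mapping.lookup p m) \<in> mon_span B" using 2 by (auto simp: mon_span_def)
        moreover have "(0 :: ('v \<Rightarrow>\<^sub>0 nat) \<Rightarrow>\<^sub>0 'k) \<in> mon_span A" by (simp add: mon_span_def)
        ultimately show ?thesis by blast
      qed
    qed
  qed
qed

text \<open>The linear projection onto the monomials in \<open>A\<close>, used for truncation in
  degree and for setting variables to zero.\<close>

lift_definition restr_keys :: "'a set \<Rightarrow> ('a \<Rightarrow>\<^sub>0 'b::zero) \<Rightarrow> ('a \<Rightarrow>\<^sub>0 'b)" is
  "\<lambda>A f m. if m \<in> A then f m else 0"
  by (rule finite_subset) auto

lemma lookup_restr_keys: "Poly_Mapping.lookup (restr_keys A p) m = (if m \<in> A then Poly_Mapping.lookup p m else 0)"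
  by transfer simp

lemma keys_restr_keys: "Poly_Mapping.keys (restr_keys A p) = Poly_Mapping.keys p \<inter> A"
  by (auto simp: in_keys_iff lookup_restr_keys split: if_splits)

lemma restr_keys_id: "Poly_Mapping.keys p \<subseteq> A \<Longrightarrow> restr_keys A p = p"
  by (rule poly_mapping_eqI) (auto simp: lookup_restr_keys in_keys_iff)

lemma restr_keys_zero: "Poly_Mapping.keys p \<inter> A = {} \<Longrightarrow> restr_keys A p = 0"
  by (rule poly_mapping_eqI) (auto simp: lookup_restr_keys in_keys_iff)

lemma restr_keys_add: "restr_keys A (p + q) = restr_keys A p + restr_keys A q"
  by (rule poly_mapping_eqI) (auto simp: lookup_restr_keys lookup_add)

lemma restr_keys_diff: "restr_keys A (p - q) = restr_keys A p - restr_keys A (q :: 'a \<Rightarrow>\<^sub>0 'b::ab_group_add)"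
  by (rule poly_mapping_eqI) (auto simp: lookup_restr_keys lookup_minus)

section \<open>Degrees and truncation\<close>

definition total_deg :: "('v \<Rightarrow>\<^sub>0 nat) \<Rightarrow> nat" where
  "total_deg m = (\<Sum>v\<in>Poly_Mapping.keys m. Poly_Mapping.lookup m v)"

lemma total_deg_add: "total_deg (a + b) = total_deg a + total_deg b"
  unfolding total_deg_def by (rule setsum_keys_plus_distrib) auto

lemma total_deg_zero [simp]: "total_deg 0 = 0" and total_deg_single [simp]: "total_deg (Poly_Mapping.single v n) = n"
  by (simp_all add: total_deg_def)

definition homogeneous :: "nat \<Rightarrow> (('v \<Rightarrow>\<^sub>0 nat) \<Rightarrow>\<^sub>0 'k::field) \<Rightarrow> bool" where
  "homogeneous d p \<longleftrightarrow> (\<forall>m\<in>Poly_Mapping.keys p. total_deg m = d)"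

definition trunc_deg :: "nat \<Rightarrow> (('v \<Rightarrow>\<^sub>0 nat) \<Rightarrow>\<^sub>0 'k::field) \<Rightarrow> (('v \<Rightarrow>\<^sub>0 nat) \<Rightarrow>\<^sub>0 'k)" where
  "trunc_deg k p = restr_keys {m. total_deg m < k} p"

lemma trunc_deg_diff: "trunc_deg k (p - q) = trunc_deg k p - trunc_deg k q"
  by (simp add: trunc_deg_def restr_keys_diff)

text \<open>Multiplication by a form of degree \<open>a\<close> shifts degrees by \<open>a\<close>.
  The natural subtraction is harmless: for \<open>k < a\<close> both sides are 0.\<close>

lemma trunc_deg_mult:
  assumes "homogeneous a y" shows "trunc_deg k (y * x) = y * trunc_deg (k - a) x"
proof -
  define l where "l = trunc_deg (k - a) x"
  have x: "x = l + (x - l)" by simp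
  have keys: "\<exists>b\<in>Poly_Mapping.keys z. total_deg m = a + total_deg b" if "m \<in> Poly_Mapping.keys (y * z)" for m z
    using that keys_mult[of y z] assms by (fastforce simp: homogeneous_def total_deg_add)
  have "b \<in> Poly_Mapping.keys (x - l) \<Longrightarrow> k - a \<le> total_deg b" for b
    by (auto simp: l_def trunc_deg_def in_keys_iff lookup_minus lookup_restr_keys split: if_splits)
  then have "k \<le> total_deg m" if "m \<in> Poly_Mapping.keys (y * (x - l))" for m
    using keys[OF that] by (metis le_diff_conv add.commute)
  then have "trunc_deg k (y * (x - l)) = 0"
    unfolding trunc_deg_def by (intro restr_keys_zero) fastforce
  moreover have "b \<in> Poly_Mapping.keys l \<Longrightarrow> total_deg b < k - a" for b
    by (auto simp: l_def trunc_deg_def keys_restr_keys)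
  then have "total_deg m < k" if "m \<in> Poly_Mapping.keys (y * l)" for m
    using keys[OF that] by (metis less_diff_conv add.commute)
  then have "trunc_deg k (y * l) = y * l"
    unfolding trunc_deg_def by (intro restr_keys_id) auto
  moreover have "trunc_deg k (y * x) = trunc_deg k (y * l) + trunc_deg k (y * (x - l))"
    by (subst x) (simp only: distrib_left trunc_deg_def restr_keys_add)
  ultimately show ?thesis by (simp add: l_def)
qed

text \<open>All terms of \<open>y ^ j * x\<close> have degree at least \<open>j * a\<close>, hence
  at least \<open>k\<close>.\<close>

lemma trunc_deg_power_mult:
  assumes "homogeneous a y" "0 < a" "k \<le> j" shows "trunc_deg k (y ^ j * x) = 0"
proof -
  have "trunc_deg k (y ^ j * x) = y ^ j * trunc_deg (k - j * a) x" for k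
    by (induction j arbitrary: k) (simp_all add: trunc_deg_mult[OF assms(1)] mult.assoc)
  moreover have "k - j * a = 0" using assms(2,3) by (simp add: le_trans)
  moreover have "trunc_deg 0 x = 0" by (simp add: trunc_deg_def restr_keys_zero)
  ultimately show ?thesis by simp
qed

lemma trunc_deg_mon_span: "p \<in> mon_span A \<Longrightarrow> trunc_deg k p \<in> mon_span A"
  by (auto simp: mon_span_def trunc_deg_def keys_restr_keys)

text \<open>Shifts making the Koszul differential preserve degrees.\<close>

primrec koszul_wt :: "('a \<Rightarrow> nat) \<Rightarrow> 'a list \<Rightarrow> bool list \<Rightarrow> nat" where
  "koszul_wt g [] bs = 0"
| "koszul_wt g (y # ys) bs = (case bs of [] \<Rightarrow> 0 | b # bs' \<Rightarrow> (if b then g y else 0) + koszul_wt g ys bs')"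

lemma koszul_wt_le: "koszul_wt g ys bs \<le> sum_list (map g ys)"
  by (induction ys arbitrary: bs) (auto split: list.split simp: add_mono trans_le_add2)

text \<open>Passing from \<open>False\<close> to \<open>True\<close> multiplies by \<open>y\<close>
  and so raises degrees by \<open>g y\<close>; the weight raises the truncation bound by the same
  amount.\<close>

lemma koszul_d_trunc_deg:
  assumes "\<And>y. y \<in> set ys \<Longrightarrow> homogeneous (g y) y"
  shows "koszul_d ys (\<lambda>t. trunc_deg (k + koszul_wt g ys t) (\<phi> t)) bs = trunc_deg (k + koszul_wt g ys bs) (koszul_d ys \<phi> bs)"
  using assms
proof (induction ys arbitrary: k \<phi> bs)
  case (Cons y ys)
  have z: "trunc_deg i 0 = 0" for i by (simp add: trunc_deg_def restr_keys_zero)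
  show ?case
  proof (cases bs)
    case (Cons b cs)
    show ?thesis
      using Cons.IH[of "k + g y" "\<lambda>t. \<phi> (True # t)" cs] Cons.IH[of k "\<lambda>t. \<phi> (False # t)" cs] Cons.prems
      by (cases b) (simp_all add: Cons trunc_deg_diff trunc_deg_mult[of "g y"] ac_simps)
  qed (simp add: z)
qed (simp add: trunc_deg_def restr_keys_zero)

text \<open>A graded Nakayama argument: \<open>y\<close> acts surjectively on the cohomology for \<open>ys\<close>, and a class
  that is divisible by all powers of \<open>y\<close> vanishes, as truncation in high degree shows.\<close>

lemma koszul_vanish_drop:
  assumes N: "mp.submod V (mon_span A :: (('v \<Rightarrow>\<^sub>0 nat) \<Rightarrow>\<^sub>0 'k::field) set)"
    and U: "mp.submod V (mon_span B :: (('v \<Rightarrow>\<^sub>0 nat) \<Rightarrow>\<^sub>0 'k) set)" and "B \<subseteq> A"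
    and y: "y \<in> mon_span (exps V)" "homogeneous a y" "0 < a"
    and ys: "set ys \<subseteq> mon_span (exps V)" and hom: "\<And>y. y \<in> set ys \<Longrightarrow> \<exists>d. homogeneous d y"
    and van: "koszul_vanish (y # ys) (Suc t) (mon_span A) (mon_span B :: (('v \<Rightarrow>\<^sub>0 nat) \<Rightarrow>\<^sub>0 'k) set)"
  shows "koszul_vanish ys t (mon_span A) (mon_span B :: (('v \<Rightarrow>\<^sub>0 nat) \<Rightarrow>\<^sub>0 'k) set)"
proof (rule koszul_vanishI)
  fix j and \<phi> :: "bool list \<Rightarrow> ('v \<Rightarrow>\<^sub>0 nat) \<Rightarrow>\<^sub>0 'k"
  assume j: "j < t" and \<phi>: "\<And>bs. \<phi> bs \<in> mon_span A"
    and c: "\<And>bs. bs \<in> koszul_idx (length ys) (Suc j) \<Longrightarrow> koszul_d ys \<phi> bs \<in> mon_span B"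
  obtain g where g: "\<And>y. y \<in> set ys \<Longrightarrow> homogeneous (g y) y" using hom by metis
  let ?I = "koszul_idx (length ys) j"
  have "finite ?I"
    by (rule finite_subset[OF _ finite_lists_length_eq[of "UNIV :: bool set" "length ys"]]) (auto simp: koszul_idx_def)
  then have "finite (\<Union>bs\<in>?I. total_deg ` Poly_Mapping.keys (\<phi> bs))" by auto
  \<comment> \<open>A strict bound for the degrees of \<open>\<phi>\<close> on \<open>?I\<close>, so
    that truncation leaves \<open>\<phi>\<close> unchanged there.\<close>
  then obtain k where k: "\<And>bs m. bs \<in> ?I \<Longrightarrow> m \<in> Poly_Mapping.keys (\<phi> bs) \<Longrightarrow> total_deg m < k"
    unfolding finite_nat_iff_bounded by (metis UN_I image_eqI lessThan_iff subsetD)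
  define T :: "bool list \<Rightarrow> (('v \<Rightarrow>\<^sub>0 nat) \<Rightarrow>\<^sub>0 'k) \<Rightarrow> (('v \<Rightarrow>\<^sub>0 nat) \<Rightarrow>\<^sub>0 'k)"
    where "T t = trunc_deg (k + koszul_wt g ys t)" for t
  \<comment> \<open>Large enough for this power of \<open>y\<close> to reach every truncation bound
    \<open>k + koszul_wt g ys t\<close>, so that the divisible part is truncated to 0.\<close>
  let ?e = "k + sum_list (map g ys)"
  obtain \<phi>' \<psi> where *: "\<forall>bs. \<psi> bs \<in> mon_span A"
    "\<forall>bs\<in>?I. \<phi> bs - y ^ ?e * \<phi>' bs - koszul_d ys \<psi> bs \<in> mon_span B"
    using mp.koszul_vanish_divisible[OF N U mon_span_mono[OF \<open>B \<subseteq> A\<close>] y(1) ys van j \<phi> c, of ?e] by blast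
  have "\<phi> bs - koszul_d ys (\<lambda>t. T t (\<psi> t)) bs \<in> mon_span B" if bs: "bs \<in> ?I" for bs
  proof -
    have "T bs (\<phi> bs - y ^ ?e * \<phi>' bs - koszul_d ys \<psi> bs) \<in> mon_span B"
      unfolding T_def using *(2) bs trunc_deg_mon_span by blast
    moreover have "T bs (\<phi> bs) = \<phi> bs"
      unfolding T_def trunc_deg_def by (rule restr_keys_id) (use k[OF bs] in force)
    moreover have "T bs (y ^ ?e * \<phi>' bs) = 0"
      unfolding T_def by (rule trunc_deg_power_mult[OF y(2,3)]) (simp add: koszul_wt_le)
    moreover have "T bs (koszul_d ys \<psi> bs) = koszul_d ys (\<lambda>t. T t (\<psi> t)) bs"
      unfolding T_def using koszul_d_trunc_deg[OF g] by simp
    ultimately show ?thesis by (simp add: T_def trunc_deg_diff)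
  qed
  then show "\<exists>\<psi>. (\<forall>bs. \<psi> bs \<in> mon_span A) \<and> (\<forall>bs\<in>?I. \<phi> bs - koszul_d ys \<psi> bs \<in> mon_span B)"
    using *(1) by (intro exI[of _ "\<lambda>t. T t (\<psi> t)"]) (simp add: T_def trunc_deg_mon_span)
qed

section \<open>Elementary symmetric polynomials\<close>

definition ind_exp :: "'v set \<Rightarrow> ('v \<Rightarrow>\<^sub>0 nat)" where
  "ind_exp F = (\<Sum>v\<in>F. Poly_Mapping.single v 1)"

lemma lookup_ind_exp: "finite F \<Longrightarrow> Poly_Mapping.lookup (ind_exp F) v = (if v \<in> F then 1 else 0)"
  by (auto simp: ind_exp_def lookup_sum lookup_single when_def)

lemma keys_ind_exp: "finite F \<Longrightarrow> Poly_Mapping.keys (ind_exp F) = F"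
  by (auto simp: in_keys_iff lookup_ind_exp split: if_splits)

lemma total_deg_ind_exp: "finite F \<Longrightarrow> total_deg (ind_exp F) = card F"
  by (simp add: total_deg_def keys_ind_exp lookup_ind_exp)

lemma prod_mpoly_var: "(\<Prod>v\<in>F. mpoly_var v) = Poly_Mapping.single (ind_exp F) (1::'k::field)"
  by (induction F rule: infinite_finite_induct) (auto simp: ind_exp_def mpoly_var_def mult_single)

definition esym :: "'v set \<Rightarrow> nat \<Rightarrow> (('v \<Rightarrow>\<^sub>0 nat) \<Rightarrow>\<^sub>0 'k::field)" where
  "esym V k = (\<Sum>F | F \<subseteq> V \<and> card F = k. \<Prod>v\<in>F. mpoly_var v)"

lemma keys_esym: "Poly_Mapping.keys (esym V k :: ('v \<Rightarrow>\<^sub>0 nat) \<Rightarrow>\<^sub>0 'k::field) \<subseteq> ind_exp ` {F. F \<subseteq> V \<and> card F = k}"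
  unfolding esym_def prod_mpoly_var by (rule order_trans[OF keys_sum]) auto

lemma keys_esymE:
  assumes "m \<in> Poly_Mapping.keys (esym V k :: ('v \<Rightarrow>\<^sub>0 nat) \<Rightarrow>\<^sub>0 'k::field)" "finite V"
  obtains F where "m = ind_exp F" "F \<subseteq> V" "finite F" "card F = k"
  using subsetD[OF keys_esym assms(1)] assms(2) that by (blast intro: finite_subset)

lemma esym_mem: "finite V \<Longrightarrow> esym V k \<in> mon_span (exps V)"
  unfolding mon_span_def exps_def by (auto simp: keys_ind_exp elim!: keys_esymE)

lemma homogeneous_esym: "finite V \<Longrightarrow> homogeneous k (esym V k)"
  unfolding homogeneous_def by (auto simp: total_deg_ind_exp elim!: keys_esymE)

lemma esym_0: "finite V \<Longrightarrow> esym V 0 = 1"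
proof -
  assume "finite V"
  then have "{F. F \<subseteq> V \<and> card F = 0} = {{}}" by (auto dest: finite_subset)
  then show ?thesis by (simp add: esym_def)
qed

text \<open>The product of all x_u - x_v has a zero factor at u = v. Expanded over subsets and
  collected by their size, it is the equation of integral dependence of x_v on the e_k.\<close>

lemma esym_vieta:
  assumes "finite V" "v \<in> V"
  shows "(\<Sum>k\<le>card V. esym V k * (- mpoly_var v) ^ (card V - k)) = (0 :: ('v \<Rightarrow>\<^sub>0 nat) \<Rightarrow>\<^sub>0 'k::field)"
proof -
  let ?x = "mpoly_var :: 'v \<Rightarrow> ('v \<Rightarrow>\<^sub>0 nat) \<Rightarrow>\<^sub>0 'k"
  have "(0 :: ('v \<Rightarrow>\<^sub>0 nat) \<Rightarrow>\<^sub>0 'k) = (\<Prod>u\<in>V. ?x u + - ?x v)"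
    by (subst prod.remove[OF assms]) simp
  also have "\<dots> = (\<Sum>X\<in>Pow V. (\<Prod>u\<in>X. ?x u) * (- ?x v) ^ card (V - X))"
    by (subst prod_add[OF assms(1)]) simp
  also have "\<dots> = (\<Sum>k\<le>card V. \<Sum>X\<in>{X\<in>Pow V. card X = k}. (\<Prod>u\<in>X. ?x u) * (- ?x v) ^ card (V - X))"
    by (rule sum.group[symmetric]) (use assms in \<open>auto intro: card_mono\<close>)
  also have "\<dots> = (\<Sum>k\<le>card V. esym V k * (- ?x v) ^ (card V - k))"
  proof (rule sum.cong[OF refl])
    fix k
    have "(\<Sum>X\<in>{X\<in>Pow V. card X = k}. (\<Prod>u\<in>X. ?x u) * (- ?x v) ^ card (V - X)) =
        (\<Sum>X\<in>{X\<in>Pow V. card X = k}. (\<Prod>u\<in>X. ?x u) * (- ?x v) ^ (card V - k))"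
      by (rule sum.cong) (auto simp: card_Diff_subset finite_subset[OF _ assms(1)])
    then show "(\<Sum>X\<in>{X\<in>Pow V. card X = k}. (\<Prod>u\<in>X. ?x u) * (- ?x v) ^ card (V - X)) =
        esym V k * (- ?x v) ^ (card V - k)"
      by (simp add: esym_def sum_distrib_right Pow_def)
  qed
  finally show ?thesis by simp
qed

lemma mpoly_var_mem: "v \<in> V \<Longrightarrow> mpoly_var v \<in> mon_span (exps V)"
  by (auto simp: mpoly_var_def mon_span_def exps_def)

lemma mpoly_var_power: "mpoly_var v ^ k = Poly_Mapping.single (Poly_Mapping.single v k) 1"
  by (induction k) (auto simp: mpoly_var_def mult_single simp flip: single_add)

text \<open>In Vieta's relation every term except the one for k = 0, a power of the negated
  variable, visibly lies in the ideal. The list is arbitrary because both orders of the e_k occur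
  later.\<close>

lemma var_power_lin_combs:
  assumes "finite V" "v \<in> V" and ys: "esym V ` {1..card V} \<subseteq> set ys" "set ys \<subseteq> mon_span (exps V)"
  shows "mpoly_var v ^ card V \<in> lin_combs (mon_span (exps V)) (ys :: (('v \<Rightarrow>\<^sub>0 nat) \<Rightarrow>\<^sub>0 'k::field) list)"
proof -
  let ?S = "mon_span (exps V) :: (('v \<Rightarrow>\<^sub>0 nat) \<Rightarrow>\<^sub>0 'k) set" and ?n = "card V"
  let ?x = "- mpoly_var v :: ('v \<Rightarrow>\<^sub>0 nat) \<Rightarrow>\<^sub>0 'k"
  have C: "mp.submod V (lin_combs ?S ys)" by (rule mp.submod_lin_combs[OF mp.submod_S ys(2)])
  have x: "?x \<in> ?S" using mpoly_var_mem[OF assms(2)] mp.S_uminus by blast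
  have "(\<Sum>k\<in>{1..?n}. esym V k * ?x ^ (?n - k)) \<in> lin_combs ?S ys"
  proof (rule mp.submod_sum[OF C])
    fix k assume "k \<in> {1..?n}"
    then show "esym V k * ?x ^ (?n - k) \<in> lin_combs ?S ys"
      by (intro mp.lin_combs_member[OF mp.submod_S ys(2)] mp.S_power[OF x]) (use ys(1) in blast)
  qed
  moreover have "?x ^ ?n = - (\<Sum>k\<in>{1..?n}. esym V k * ?x ^ (?n - k))"
  proof -
    have "{..?n} = insert 0 {1..?n}" by auto
    then show ?thesis
      using esym_vieta[OF assms(1,2), where 'k='k] by (simp add: esym_0[OF assms(1)] eq_neg_iff_add_eq_0)
  qed
  ultimately have "?x ^ ?n \<in> lin_combs ?S ys" using mp.submod_uminus[OF C] by simp
  \<comment> \<open>Removes the sign of the negated variable.\<close>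
  then have "(-1) ^ ?n * ?x ^ ?n \<in> lin_combs ?S ys"
    by (intro mp.submod_mult[OF C] mp.S_power mp.S_uminus mp.S_one)
  then show ?thesis by (simp flip: power_mult_distrib)
qed

text \<open>Each factor lacks a constant term and contributes at least 1 to the degree.\<close>

lemma keys_power_total_deg:
  assumes "0 \<notin> Poly_Mapping.keys (f :: ('v \<Rightarrow>\<^sub>0 nat) \<Rightarrow>\<^sub>0 'k::field)" "m \<in> Poly_Mapping.keys (f ^ k)"
  shows "k \<le> total_deg m"
  using assms(2)
proof (induction k arbitrary: m)
  case (Suc k)
  then obtain a b where m: "m = a + b" "a \<in> Poly_Mapping.keys f" "b \<in> Poly_Mapping.keys (f ^ k)"
    using keys_mult[of f "f ^ k"] by auto
  then have "a \<noteq> 0" using assms(1) by auto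
  then obtain v where v: "v \<in> Poly_Mapping.keys a" by (metis equals0I keys_eq_empty)
  then have "Poly_Mapping.lookup a v \<le> total_deg a" unfolding total_deg_def by (intro member_le_sum) auto
  moreover have "Poly_Mapping.lookup a v \<noteq> 0" using v by (simp add: in_keys_iff)
  ultimately show ?case using Suc.IH[OF m(3)] by (simp add: m(1) total_deg_add)
qed simp

text \<open>Pigeonhole: a monomial of degree above n^2 in n variables contains the n-th power of
  some variable, and this power lies in the ideal by \<open>var_power_lin_combs\<close>.\<close>

lemma power_lin_combs_esym:
  assumes "finite V" and ys: "esym V ` {1..card V} \<subseteq> set ys" "set ys \<subseteq> mon_span (exps V)"
    and f: "f \<in> mon_span (exps V - {0})"
  shows "\<exists>k. f ^ k \<in> lin_combs (mon_span (exps V)) (ys :: (('v \<Rightarrow>\<^sub>0 nat) \<Rightarrow>\<^sub>0 'k::field) list)"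
proof -
  let ?S = "mon_span (exps V) :: (('v \<Rightarrow>\<^sub>0 nat) \<Rightarrow>\<^sub>0 'k) set" and ?n = "card V"
  let ?g = "f ^ (?n * ?n + 1)"
  have C: "mp.submod V (lin_combs ?S ys)" by (rule mp.submod_lin_combs[OF mp.submod_S ys(2)])
  have "f \<in> ?S" using f by (auto simp: mon_span_def)
  have g: "?g \<in> ?S" by (rule mp.S_power[OF \<open>f \<in> ?S\<close>])
  have "?g \<in> lin_combs ?S ys"
  proof (rule sum_singles_induct)
    fix m assume m: "m \<in> Poly_Mapping.keys ?g"
    let ?c = "Poly_Mapping.lookup ?g m"
    have mV: "Poly_Mapping.keys m \<subseteq> V" using g m by (auto simp: mon_span_def exps_def)
    have "?n * ?n + 1 \<le> total_deg m"
      using keys_power_total_deg[OF _ m] f by (auto simp: mon_span_def)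
    have "\<exists>v\<in>Poly_Mapping.keys m. ?n \<le> Poly_Mapping.lookup m v"
    proof (rule ccontr)
      assume "\<not> ?thesis"
      then have "total_deg m \<le> card (Poly_Mapping.keys m) * ?n"
        unfolding total_deg_def by (intro sum_bounded_above[where K = ?n, simplified]) (auto simp: not_le)
      also have "\<dots> \<le> ?n * ?n" using card_mono[OF assms(1) mV] by simp
      finally show False using \<open>?n * ?n + 1 \<le> total_deg m\<close> by simp
    qed
    then obtain v where v: "v \<in> V" "?n \<le> Poly_Mapping.lookup m v" using mV by blast
    let ?r = "m - Poly_Mapping.single v ?n"
    have m': "m = Poly_Mapping.single v ?n + ?r"
      by (rule poly_mapping_eqI) (use v in \<open>auto simp: lookup_add lookup_minus lookup_single when_def\<close>)
    have "Poly_Mapping.keys ?r \<subseteq> Poly_Mapping.keys m"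
      by (auto simp: in_keys_iff lookup_minus)
    then have r: "Poly_Mapping.single ?r ?c \<in> ?S" using mV by (auto simp: mon_span_def exps_def)
    have "Poly_Mapping.single m ?c = Poly_Mapping.single ?r ?c * mpoly_var v ^ ?n"
      unfolding mpoly_var_power mult_single using m' by (metis add.commute mult.right_neutral)
    then show "Poly_Mapping.single m ?c \<in> lin_combs ?S ys"
      using mp.submod_mult[OF C r var_power_lin_combs[OF assms(1) v(1) ys]] by simp
  qed (use mp.submod_zero[OF C] mp.submod_add[OF C] in auto)
  then show ?thesis by blast
qed

text \<open>The monomials of the Stanley-Reisner ideal; \<open>SR_ideal_eq\<close> identifies their
  span with it.\<close>

definition nf_exps :: "'v set \<Rightarrow> 'v set set \<Rightarrow> ('v \<Rightarrow>\<^sub>0 nat) set" where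
  "nf_exps V \<Delta> = {m \<in> exps V. Poly_Mapping.keys m \<notin> \<Delta>}"

lemma simplicial_subset: "simplicial_complex_on V \<Delta> \<Longrightarrow> F \<in> \<Delta> \<Longrightarrow> G \<subseteq> F \<Longrightarrow> G \<in> \<Delta>"
  and simplicial_vertices: "simplicial_complex_on V \<Delta> \<Longrightarrow> F \<in> \<Delta> \<Longrightarrow> F \<subseteq> V"
  by (auto simp: simplicial_complex_on_def)

lemma submod_nf:
  assumes "simplicial_complex_on V \<Delta>" shows "mp.submod V (mon_span (nf_exps V \<Delta>))"
proof (rule submod_mon_span)
  fix a b assume "a \<in> exps V" "b \<in> nf_exps V \<Delta>"
  then show "a + b \<in> nf_exps V \<Delta>"
    using simplicial_subset[OF assms, of "Poly_Mapping.keys (a + b)" "Poly_Mapping.keys b"]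
    by (auto simp: nf_exps_def exps_add keys_add_nat)
qed

text \<open>For a maximal face \<open>F\<close>, the quotient of the two ideals is the ideal of \<open>K[x\<^sub>F]\<close>
  generated by \<open>x\<^sub>F\<close>, on which the variables in \<open>F\<close> form a regular sequence.\<close>

lemma koszul_vanish_face:
  assumes V: "finite V" and \<Delta>: "simplicial_complex_on V \<Delta>" and \<Delta>': "simplicial_complex_on V (\<Delta> - {F})"
    and F: "F \<in> \<Delta>"
    and ys: "esym V ` {1..card V} \<subseteq> set ys" "set ys \<subseteq> mon_span (exps V)"
  shows "koszul_vanish ys (card F) (mon_span (nf_exps V (\<Delta> - {F})))
      (mon_span (nf_exps V \<Delta>) :: (('v \<Rightarrow>\<^sub>0 nat) \<Rightarrow>\<^sub>0 'k::field) set)"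
proof -
  define A where "A = nf_exps V (\<Delta> - {F})"
  \<comment> \<open>The monomials of the quotient have support exactly \<open>F\<close>, and
    multiplying one by x_w makes the exponent of \<open>w\<close> at least 2. So \<open>B W\<close>
    spans the smaller ideal enlarged by the multiples of x_w for \<open>w\<close> in
    \<open>W\<close>.\<close>
  define B where "B W = {m \<in> A. Poly_Mapping.keys m \<in> \<Delta> \<longrightarrow> (\<exists>w\<in>W. 2 \<le> Poly_Mapping.lookup m w)}" for W
  have finF: "finite F" "F \<subseteq> V" using simplicial_vertices[OF \<Delta> F] V finite_subset by auto
  have A_F: "Poly_Mapping.keys m = F" if "m \<in> A" "Poly_Mapping.keys m \<in> \<Delta>" for m
    using that by (auto simp: A_def nf_exps_def)
  have A_add: "a + m \<in> A" if "a \<in> exps V" "m \<in> A" for a m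
    using that simplicial_subset[OF \<Delta>', of "Poly_Mapping.keys (a + m)" "Poly_Mapping.keys m"]
    by (auto simp: A_def nf_exps_def exps_add keys_add_nat)
  have smA: "mp.submod V (mon_span A :: (('v \<Rightarrow>\<^sub>0 nat) \<Rightarrow>\<^sub>0 'k) set)"
    unfolding A_def by (rule submod_nf[OF \<Delta>'])
  have B_add: "a + m \<in> B W" if "a \<in> exps V" "m \<in> B W" for a m W
  proof -
    have "Poly_Mapping.keys m \<in> \<Delta>" if "Poly_Mapping.keys (a + m) \<in> \<Delta>"
      using simplicial_subset[OF \<Delta> that] by (simp add: keys_add_nat)
    moreover have "Poly_Mapping.lookup m w \<le> Poly_Mapping.lookup (a + m) w" for w by (simp add: lookup_add)
    ultimately show ?thesis using that A_add unfolding B_def by (blast intro: le_trans)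
  qed
  have smB: "mp.submod V (mon_span (B W) :: (('v \<Rightarrow>\<^sub>0 nat) \<Rightarrow>\<^sub>0 'k) set)" for W
    by (rule submod_mon_span[OF B_add])
  \<comment> \<open>Starts at \<open>W = F\<close>, where nothing is claimed, and takes variables
    out of \<open>W\<close>; each adds a degree by \<open>koszul_vanish_regular\<close>.\<close>
  have "koszul_vanish ys (card (F - W)) (mon_span A) (mon_span (B W) :: (('v \<Rightarrow>\<^sub>0 nat) \<Rightarrow>\<^sub>0 'k) set)" if "W \<subseteq> F" for W
    using that
  proof (induction "card (F - W)" arbitrary: W)
    case 0
    then show ?case by (simp add: koszul_vanish_def)
  next
    case (Suc j)
    have "F - W \<noteq> {}" using Suc.hyps(2) by (metis card.empty nat.distinct(1))
    then obtain v where v: "v \<in> F" "v \<notin> W" by blast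
    have j: "j = card (F - insert v W)"
    proof -
      have "F - insert v W = (F - W) - {v}" "v \<in> F - W" using v by auto
      then show ?thesis by (metis Suc.hyps(2) card_Diff_singleton diff_Suc_1)
    qed
    have sv: "Poly_Mapping.single v 1 \<in> exps V" using v finF by (auto simp: exps_def)
    have "mpoly_var v \<in> (mon_span (exps V - {0}) :: (('v \<Rightarrow>\<^sub>0 nat) \<Rightarrow>\<^sub>0 'k) set)"
    proof -
      have "Poly_Mapping.single v (1::nat) \<noteq> 0" by (metis lookup_single_eq lookup_zero one_neq_zero)
      then show ?thesis using sv by (simp add: mon_span_def mpoly_var_def)
    qed
    then obtain k where k: "mpoly_var v ^ k \<in> lin_combs (mon_span (exps V)) ys"
      using power_lin_combs_esym[OF V ys] by blast
    have "B W \<union> (+) (Poly_Mapping.single v 1) ` A = B (insert v W)"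
    proof (intro equalityI subsetI)
      fix m assume "m \<in> B W \<union> (+) (Poly_Mapping.single v 1) ` A"
      then show "m \<in> B (insert v W)"
      proof
        assume "m \<in> (+) (Poly_Mapping.single v 1) ` A"
        then obtain a where a: "m = Poly_Mapping.single v 1 + a" "a \<in> A" by auto
        have "2 \<le> Poly_Mapping.lookup m v" if "Poly_Mapping.keys m \<in> \<Delta>"
        proof -
          have "Poly_Mapping.keys a = F"
            by (rule A_F[OF a(2) simplicial_subset[OF \<Delta> that]]) (auto simp: a(1) keys_add_nat)
          then have "Poly_Mapping.lookup a v \<noteq> 0" using v by (metis in_keys_iff)
          then show ?thesis by (simp add: a(1) lookup_add)
        qed
        then show ?thesis using A_add[OF sv a(2)] by (auto simp: B_def a(1))
      qed (auto simp: B_def)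
    next
      fix m assume m: "m \<in> B (insert v W)"
      show "m \<in> B W \<union> (+) (Poly_Mapping.single v 1) ` A"
      proof (cases "m \<in> B W")
        case False
        then have m': "Poly_Mapping.keys m \<in> \<Delta>" "2 \<le> Poly_Mapping.lookup m v" "m \<in> A"
          using m by (auto simp: B_def)
        let ?a = "m - Poly_Mapping.single v 1"
        have "m = Poly_Mapping.single v 1 + ?a"
          by (rule poly_mapping_eqI) (use m'(2) in \<open>auto simp: lookup_add lookup_minus lookup_single when_def\<close>)
        moreover have "Poly_Mapping.keys ?a = Poly_Mapping.keys m"
          using m'(2) by (auto simp: in_keys_iff lookup_minus lookup_single when_def split: if_splits)
        then have "?a \<in> A" using m'(3) by (auto simp: A_def nf_exps_def exps_def)
        ultimately show ?thesis by blast
      qed auto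
    qed
    then have eq: "{u + mpoly_var v * a | u a. u \<in> mon_span (B W) \<and> a \<in> mon_span A} =
        (mon_span (B (insert v W)) :: (('v \<Rightarrow>\<^sub>0 nat) \<Rightarrow>\<^sub>0 'k) set)"
      unfolding mpoly_var_def mon_span_add_single_mult by simp
    \<comment> \<open>For support \<open>F\<close>, multiplication by x_v changes only the exponent
      of \<open>v\<close>, which is not in \<open>W\<close>, so it cannot create membership in
      \<open>B W\<close>.\<close>
    have reg: "x \<in> mon_span (B W)"
      if x: "x \<in> mon_span A" "mpoly_var v * x \<in> mon_span (B W)" for x :: "('v \<Rightarrow>\<^sub>0 nat) \<Rightarrow>\<^sub>0 'k"
    proof -
      have "m \<in> B W" if m: "m \<in> Poly_Mapping.keys x" for m
      proof -
        have mA: "m \<in> A" using x(1) m by (auto simp: mon_span_def)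
        have mB: "Poly_Mapping.single v 1 + m \<in> B W"
          using x(2) m by (auto simp: mon_span_def mpoly_var_def keys_single_mult)
        have "\<exists>w\<in>W. 2 \<le> Poly_Mapping.lookup m w" if "Poly_Mapping.keys m \<in> \<Delta>"
        proof -
          have "Poly_Mapping.keys m = F" by (rule A_F[OF mA that])
          then have "Poly_Mapping.keys (Poly_Mapping.single v 1 + m) = Poly_Mapping.keys m"
            using v by (auto simp: keys_add_nat)
          then obtain w where "w \<in> W" "2 \<le> Poly_Mapping.lookup (Poly_Mapping.single v 1 + m) w"
            using mB \<open>Poly_Mapping.keys m \<in> \<Delta>\<close> by (auto simp: B_def)
          moreover have "w \<noteq> v" using v \<open>w \<in> W\<close> by auto
          ultimately show ?thesis by (auto simp: lookup_add lookup_single)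
        qed
        then show ?thesis using mA by (simp add: B_def)
      qed
      then show ?thesis by (auto simp: mon_span_def)
    qed
    show ?case
      unfolding Suc.hyps(2)[symmetric]
    proof (rule mp.koszul_vanish_regular[OF smA smB _ ys(2) _ k reg])
      show "koszul_vanish ys j (mon_span A) {u + mpoly_var v * a | u a. u \<in> mon_span (B W) \<and> a \<in> mon_span A}"
        unfolding eq j by (rule Suc.hyps(1)[OF j]) (use Suc.prems v in auto)
      show "mpoly_var v \<in> mon_span (exps V)" using v finF by (intro mpoly_var_mem) auto
    qed (auto simp: mon_span_def B_def)
  qed
  from this[of "{}"] have "koszul_vanish ys (card F) (mon_span A) (mon_span (B {}) :: (('v \<Rightarrow>\<^sub>0 nat) \<Rightarrow>\<^sub>0 'k) set)" by simp
  moreover have "B {} = nf_exps V \<Delta>" by (auto simp: B_def A_def nf_exps_def)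
  ultimately show ?thesis by (simp add: A_def)
qed

section \<open>Passing to a skeleton\<close>

text \<open>Removes the faces outside \<open>\<Delta>'\<close> one at a time and assembles the
  pieces by \<open>koszul_vanish_ext\<close>. List and bound stay open because the two directions of
  the theorem use different ones.\<close>

lemma koszul_vanish_faces:
  assumes V: "finite V" and \<Delta>': "simplicial_complex_on V \<Delta>'" and ys: "set ys \<subseteq> mon_span (exps V)"
    and face: "\<And>\<Delta> F. simplicial_complex_on V \<Delta> \<Longrightarrow> simplicial_complex_on V (\<Delta> - {F}) \<Longrightarrow> F \<in> \<Delta> \<Longrightarrow> P F \<Longrightarrow>
      koszul_vanish ys t (mon_span (nf_exps V (\<Delta> - {F}))) (mon_span (nf_exps V \<Delta>))"
    and "simplicial_complex_on V \<Delta>" "\<Delta>' \<subseteq> \<Delta>" "\<And>F. F \<in> \<Delta> - \<Delta>' \<Longrightarrow> P F"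
  shows "koszul_vanish ys t (mon_span (nf_exps V \<Delta>'))
      (mon_span (nf_exps V \<Delta>) :: (('v \<Rightarrow>\<^sub>0 nat) \<Rightarrow>\<^sub>0 'k::field) set)"
  using assms(5-7)
proof (induction "card (\<Delta> - \<Delta>')" arbitrary: \<Delta>)
  case 0
  have "finite \<Delta>"
    using 0 V unfolding simplicial_complex_on_def by (meson finite_Pow_iff finite_subset)
  then have "\<Delta> = \<Delta>'" using 0 by auto
  then show ?case using mp.koszul_vanish_self[OF submod_nf[OF \<Delta>']] by simp
next
  case (Suc k)
  have fin: "finite \<Delta>"
    using Suc V unfolding simplicial_complex_on_def by (meson finite_Pow_iff finite_subset)
  have ne: "\<Delta> - \<Delta>' \<noteq> {}" using Suc.hyps(2) by (metis card.empty nat.distinct(1))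
  \<comment> \<open>A largest face outside \<open>\<Delta>'\<close> is maximal in
    \<open>\<Delta>\<close>: a strictly larger face would lie in \<open>\<Delta>'\<close>, and then
    so would \<open>F\<close>. Hence its removal leaves a complex.\<close>
  obtain F where F: "F \<in> \<Delta> - \<Delta>'" and max: "\<And>G. G \<in> \<Delta> - \<Delta>' \<Longrightarrow> card G \<le> card F"
    using Max_in[of "card ` (\<Delta> - \<Delta>')"] Max_ge[of "card ` (\<Delta> - \<Delta>')"] fin ne
    by (metis (no_types, lifting) finite_Diff finite_imageI imageE image_eqI image_is_empty)
  have sc: "simplicial_complex_on V (\<Delta> - {F})"
    unfolding simplicial_complex_on_def
  proof (intro conjI ballI allI impI)
    show "\<Delta> - {F} \<subseteq> Pow V" using Suc.prems(1) by (auto simp: simplicial_complex_on_def)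
    fix G H assume G: "G \<in> \<Delta> - {F}" and HG: "H \<subseteq> G"
    have "H \<noteq> F"
    proof
      assume "H = F"
      then have "F \<subset> G" using G HG by auto
      moreover have "finite G" using G simplicial_vertices[OF Suc.prems(1)] V finite_subset by blast
      ultimately have "card F < card G" by (simp add: psubset_card_mono)
      then have "G \<in> \<Delta>'" using max[of G] G by auto
      then show False using F simplicial_subset[OF \<Delta>', of G F] \<open>F \<subset> G\<close> by auto
    qed
    then show "H \<in> \<Delta> - {F}" using simplicial_subset[OF Suc.prems(1), of G H] G HG by auto
  qed
  have "\<Delta> - {F} - \<Delta>' = (\<Delta> - \<Delta>') - {F}" by auto
  then have k: "k = card (\<Delta> - {F} - \<Delta>')"
    using F Suc.hyps(2) by (metis card_Diff_singleton diff_Suc_1)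
  have 1: "koszul_vanish ys t (mon_span (nf_exps V \<Delta>'))
      (mon_span (nf_exps V (\<Delta> - {F})) :: (('v \<Rightarrow>\<^sub>0 nat) \<Rightarrow>\<^sub>0 'k) set)"
    by (rule Suc.hyps(1)[OF k sc]) (use Suc.prems F in auto)
  have 2: "koszul_vanish ys t (mon_span (nf_exps V (\<Delta> - {F})))
      (mon_span (nf_exps V \<Delta>) :: (('v \<Rightarrow>\<^sub>0 nat) \<Rightarrow>\<^sub>0 'k) set)"
    by (rule face[OF Suc.prems(1) sc]) (use Suc.prems(3) F in auto)
  show ?case
  proof (rule mp.koszul_vanish_ext[OF submod_nf[OF \<Delta>'] submod_nf[OF sc] submod_nf[OF Suc.prems(1)] _ _ ys 1 2])
    show "mon_span (nf_exps V (\<Delta> - {F})) \<subseteq> (mon_span (nf_exps V \<Delta>') :: (('v \<Rightarrow>\<^sub>0 nat) \<Rightarrow>\<^sub>0 'k) set)"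
      using Suc.prems(2) F by (intro mon_span_mono) (auto simp: nf_exps_def)
    show "mon_span (nf_exps V \<Delta>) \<subseteq> (mon_span (nf_exps V (\<Delta> - {F})) :: (('v \<Rightarrow>\<^sub>0 nat) \<Rightarrow>\<^sub>0 'k) set)"
      by (intro mon_span_mono) (auto simp: nf_exps_def)
  qed
qed

text \<open>Mostly used reversed, so that the element of highest index is at the head, where it can
  be removed.\<close>

definition esyms :: "'v set \<Rightarrow> nat \<Rightarrow> (('v \<Rightarrow>\<^sub>0 nat) \<Rightarrow>\<^sub>0 'k::field) list" where
  "esyms V m = map (esym V) [1..<Suc m]"

lemma length_esyms [simp]: "length (esyms V m) = m"
  and nth_esyms: "i < m \<Longrightarrow> esyms V m ! i = esym V (Suc i)"
  and take_esyms: "i \<le> m \<Longrightarrow> take i (esyms V m) = esyms V i"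
  and esyms_Suc: "esyms V (Suc m) = esyms V m @ [esym V (Suc m)]"
  and set_esyms: "set (esyms V m) = esym V ` {1..m}"
  by (simp_all add: esyms_def take_map take_upt atLeastLessThanSuc_atLeastAtMost del: upt_Suc)
    (simp add: upt_Suc_append)

lemma esyms_mem: "finite V \<Longrightarrow> set (esyms V m) \<subseteq> mon_span (exps V)"
  by (auto simp: set_esyms esym_mem)

lemma esym_mult_mem:
  assumes "finite V" "\<And>G a. G \<subseteq> V \<Longrightarrow> finite G \<Longrightarrow> card G = j \<Longrightarrow> a \<in> A \<Longrightarrow> ind_exp G + a \<in> B" "x \<in> mon_span A"
  shows "esym V j * x \<in> (mon_span B :: (('v \<Rightarrow>\<^sub>0 nat) \<Rightarrow>\<^sub>0 'k::field) set)"
proof (rule mon_span_times[of "ind_exp ` {G. G \<subseteq> V \<and> card G = j}"])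
  show "esym V j \<in> mon_span (ind_exp ` {G. G \<subseteq> V \<and> card G = j})"
    using keys_esym by (auto simp: mon_span_def)
qed (use assms finite_subset in auto)

text \<open>Each removal by the graded Nakayama argument costs one degree of vanishing.\<close>

lemma koszul_vanish_esyms_drop:
  assumes V: "finite V" and N: "mp.submod V (mon_span A :: (('v \<Rightarrow>\<^sub>0 nat) \<Rightarrow>\<^sub>0 'k::field) set)"
    and U: "mp.submod V (mon_span B :: (('v \<Rightarrow>\<^sub>0 nat) \<Rightarrow>\<^sub>0 'k) set)" and "B \<subseteq> A"
    and "koszul_vanish (rev (esyms V (i + d))) (t + d) (mon_span A) (mon_span B :: (('v \<Rightarrow>\<^sub>0 nat) \<Rightarrow>\<^sub>0 'k) set)"
  shows "koszul_vanish (rev (esyms V i)) t (mon_span A) (mon_span B :: (('v \<Rightarrow>\<^sub>0 nat) \<Rightarrow>\<^sub>0 'k) set)"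
  using assms(5)
proof (induction d)
  case (Suc d)
  show ?case
  proof (rule Suc.IH, rule koszul_vanish_drop[OF N U \<open>B \<subseteq> A\<close> esym_mem[OF V] homogeneous_esym[OF V]])
    show "koszul_vanish (esym V (Suc (i + d)) # rev (esyms V (i + d))) (Suc (t + d))
        (mon_span A) (mon_span B :: (('v \<Rightarrow>\<^sub>0 nat) \<Rightarrow>\<^sub>0 'k) set)"
      using Suc.prems by (simp add: esyms_Suc)
  qed (use homogeneous_esym[OF V] esyms_mem[OF V] in \<open>auto simp: set_esyms\<close>)
qed simp

text \<open>An e_j that acts as zero is removed without loss; \<open>zero\<close> expresses this on
  monomials.\<close>

lemma koszul_vanish_esyms_zero:
  assumes V: "finite V" and N: "mp.submod V (mon_span A :: (('v \<Rightarrow>\<^sub>0 nat) \<Rightarrow>\<^sub>0 'k::field) set)"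
    and U: "mp.submod V (mon_span B :: (('v \<Rightarrow>\<^sub>0 nat) \<Rightarrow>\<^sub>0 'k) set)" and "B \<subseteq> A"
    and zero: "\<And>G a. G \<subseteq> V \<Longrightarrow> finite G \<Longrightarrow> i < card G \<Longrightarrow> a \<in> A \<Longrightarrow> ind_exp G + a \<in> B"
    and "koszul_vanish (rev (esyms V (i + d))) t (mon_span A) (mon_span B :: (('v \<Rightarrow>\<^sub>0 nat) \<Rightarrow>\<^sub>0 'k) set)"
  shows "koszul_vanish (rev (esyms V i)) t (mon_span A) (mon_span B :: (('v \<Rightarrow>\<^sub>0 nat) \<Rightarrow>\<^sub>0 'k) set)"
  using assms(6)
proof (induction d)
  case (Suc d)
  show ?case
  proof (rule Suc.IH, rule mp.koszul_vanish_drop_zero[OF N U mon_span_mono[OF \<open>B \<subseteq> A\<close>] esym_mem[OF V]])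
    show "koszul_vanish (esym V (Suc (i + d)) # rev (esyms V (i + d))) t
        (mon_span A) (mon_span B :: (('v \<Rightarrow>\<^sub>0 nat) \<Rightarrow>\<^sub>0 'k) set)"
      using Suc.prems by (simp add: esyms_Suc)
  next
    fix x :: "('v \<Rightarrow>\<^sub>0 nat) \<Rightarrow>\<^sub>0 'k" assume "x \<in> mon_span A"
    then show "esym V (Suc (i + d)) * x \<in> mon_span B" by (intro esym_mult_mem[OF V zero]) auto
  qed (use esyms_mem[OF V] in auto)
qed simp

text \<open>Paying \<open>m - Suc i\<close> degrees for as many removals leaves \<open>Suc i\<close>
  elements with vanishing below \<open>Suc i\<close>, the situation of
  \<open>koszul_vanish_imp_regular\<close>.\<close>

lemma koszul_vanish_esyms_regular:
  assumes V: "finite V" and N: "mp.submod V (mon_span A :: (('v \<Rightarrow>\<^sub>0 nat) \<Rightarrow>\<^sub>0 'k::field) set)"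
    and U: "mp.submod V (mon_span B :: (('v \<Rightarrow>\<^sub>0 nat) \<Rightarrow>\<^sub>0 'k) set)" and "B \<subseteq> A"
    and van: "koszul_vanish (rev (esyms V m)) m (mon_span A) (mon_span B :: (('v \<Rightarrow>\<^sub>0 nat) \<Rightarrow>\<^sub>0 'k) set)"
    and "i < m" and x: "x \<in> mon_span A" and ex: "esym V (Suc i) * x \<in> submod_plus (mon_span A) (mon_span B) (rev (esyms V i))"
  shows "x \<in> submod_plus (mon_span A) (mon_span B :: (('v \<Rightarrow>\<^sub>0 nat) \<Rightarrow>\<^sub>0 'k) set) (rev (esyms V i))"
proof -
  have "koszul_vanish (rev (esyms V (Suc i))) (Suc i) (mon_span A) (mon_span B :: (('v \<Rightarrow>\<^sub>0 nat) \<Rightarrow>\<^sub>0 'k) set)"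
    using koszul_vanish_esyms_drop[OF V N U \<open>B \<subseteq> A\<close>, of "Suc i" "m - Suc i" "Suc i"] van \<open>i < m\<close> by simp
  then have *: "koszul_vanish (esym V (Suc i) # rev (esyms V i)) (Suc (length (rev (esyms V i))))
      (mon_span A) (mon_span B :: (('v \<Rightarrow>\<^sub>0 nat) \<Rightarrow>\<^sub>0 'k) set)"
    by (simp add: esyms_Suc)
  obtain u b where ub: "esym V (Suc i) * x = u + b" "u \<in> mon_span B" "b \<in> lin_combs (mon_span A) (rev (esyms V i))"
    using ex by (auto simp: submod_plus_def)
  have "set (rev (esyms V i)) \<subseteq> mon_span (exps V)" using esyms_mem[OF V] by simp
  from mp.koszul_vanish_imp_regular[OF N U mon_span_mono[OF \<open>B \<subseteq> A\<close>] esym_mem[OF V] this * x ub]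
  show ?thesis unfolding submod_plus_def by blast
qed

lemma nf_exps_subset: "nf_exps V \<Delta> \<subseteq> exps V" and nf_exps_antimono: "\<Delta>' \<subseteq> \<Delta> \<Longrightarrow> nf_exps V \<Delta> \<subseteq> nf_exps V \<Delta>'"
  by (auto simp: nf_exps_def)

lemma simplicial_skeleton:
  assumes "finite V" "simplicial_complex_on V \<Delta>"
  shows "simplicial_complex_on V {F\<in>\<Delta>. card F \<le> m}"
  unfolding simplicial_complex_on_def
proof (intro conjI ballI allI impI)
  show "{F\<in>\<Delta>. card F \<le> m} \<subseteq> Pow V" using assms(2) by (auto simp: simplicial_complex_on_def)
  fix G H assume G: "G \<in> {F\<in>\<Delta>. card F \<le> m}" and H: "H \<subseteq> G"
  then have "card H \<le> card G"
    using simplicial_vertices[OF assms(2), of G] assms(1) by (intro card_mono) (auto intro: finite_subset)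
  then show "H \<in> {F\<in>\<Delta>. card F \<le> m}" using G H simplicial_subset[OF assms(2)] by auto
qed

lemma ind_exp_add_nf:
  assumes \<Delta>: "simplicial_complex_on V \<Delta>" and "finite G" "G \<subseteq> V" "a \<in> exps V" "G \<union> Poly_Mapping.keys a \<notin> \<Delta>"
  shows "ind_exp G + a \<in> nf_exps V \<Delta>"
  using assms by (auto simp: nf_exps_def exps_def keys_add_nat keys_ind_exp)

text \<open>No face of the skeleton contains more than \<open>m\<close> vertices, so the removal of
  every e_j with j > m is free.\<close>

lemma koszul_vanish_skeleton:
  fixes V :: "'v set"
  assumes V: "finite V" and \<Delta>: "simplicial_complex_on V \<Delta>" and m: "m \<le> card V"
    and van: "koszul_vanish (rev (esyms V (card V))) m (mon_span (exps V))
      (mon_span (nf_exps V {F\<in>\<Delta>. card F \<le> m}) :: (('v \<Rightarrow>\<^sub>0 nat) \<Rightarrow>\<^sub>0 'k::field) set)"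
  shows "koszul_vanish (rev (esyms V m)) m (mon_span (exps V))
      (mon_span (nf_exps V {F\<in>\<Delta>. card F \<le> m}) :: (('v \<Rightarrow>\<^sub>0 nat) \<Rightarrow>\<^sub>0 'k) set)"
proof (rule koszul_vanish_esyms_zero[where d = "card V - m", OF V mp.submod_S submod_nf[OF simplicial_skeleton[OF V \<Delta>]] nf_exps_subset])
  fix G a assume G: "G \<subseteq> V" "finite G" "m < card G" "a \<in> exps V"
  show "ind_exp G + a \<in> nf_exps V {F\<in>\<Delta>. card F \<le> m}"
  proof (rule ind_exp_add_nf[OF simplicial_skeleton[OF V \<Delta>] G(2,1,4)])
    have "card G \<le> card (G \<union> Poly_Mapping.keys a)" using G by (intro card_mono) auto
    then show "G \<union> Poly_Mapping.keys a \<notin> {F\<in>\<Delta>. card F \<le> m}" using G(3) by auto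
  qed
qed (use van m in simp)

text \<open>The full list is kept until the skeleton is reached: there shortening is free, whereas
  on \<open>\<Delta>\<close> it could cost degrees.\<close>

lemma koszul_vanish_to_skeleton:
  fixes V :: "'v set"
  assumes V: "finite V" and \<Delta>: "simplicial_complex_on V \<Delta>" and m: "m \<le> card V"
    and van: "koszul_vanish (rev (esyms V (card V))) m (mon_span (exps V))
      (mon_span (nf_exps V \<Delta>) :: (('v \<Rightarrow>\<^sub>0 nat) \<Rightarrow>\<^sub>0 'k::field) set)"
  shows "koszul_vanish (rev (esyms V m)) m (mon_span (exps V))
      (mon_span (nf_exps V {F\<in>\<Delta>. card F \<le> m}) :: (('v \<Rightarrow>\<^sub>0 nat) \<Rightarrow>\<^sub>0 'k) set)"
proof -
  let ?\<Gamma> = "{F\<in>\<Delta>. card F \<le> m}" and ?ys = "rev (esyms V (card V)) :: (('v \<Rightarrow>\<^sub>0 nat) \<Rightarrow>\<^sub>0 'k) list"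
  have \<Gamma>: "simplicial_complex_on V ?\<Gamma>" by (rule simplicial_skeleton[OF V \<Delta>])
  have ys: "set ?ys \<subseteq> mon_span (exps V)" using esyms_mem[OF V] by simp
  \<comment> \<open>The extra degree pays for the connecting map in
    \<open>koszul_vanish_quotient\<close>; it is available because the removed faces have at least
    \<open>Suc m\<close> vertices.\<close>
  have J: "koszul_vanish ?ys (Suc m) (mon_span (nf_exps V ?\<Gamma>)) (mon_span (nf_exps V \<Delta>))"
  proof (rule koszul_vanish_faces[where P = "\<lambda>F. m < card F", OF V \<Gamma> ys _ \<Delta>])
    fix \<Delta> F assume "simplicial_complex_on V \<Delta>" "simplicial_complex_on V (\<Delta> - {F})" "F \<in> \<Delta>" "m < card F"
    then show "koszul_vanish ?ys (Suc m) (mon_span (nf_exps V (\<Delta> - {F}))) (mon_span (nf_exps V \<Delta>))"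
      by (intro koszul_vanish_mono[OF koszul_vanish_face[OF V _ _ _ _ ys]]) (auto simp: set_esyms)
  qed auto
  show ?thesis
  proof (rule koszul_vanish_skeleton[OF V \<Delta> m], rule mp.koszul_vanish_quotient[OF mp.submod_S submod_nf[OF \<Gamma>] submod_nf[OF \<Delta>] _ _ ys J van])
    show "mon_span (nf_exps V ?\<Gamma>) \<subseteq> (mon_span (exps V) :: (('v \<Rightarrow>\<^sub>0 nat) \<Rightarrow>\<^sub>0 'k) set)"
      by (rule mon_span_mono[OF nf_exps_subset])
    show "mon_span (nf_exps V \<Delta>) \<subseteq> (mon_span (nf_exps V ?\<Gamma>) :: (('v \<Rightarrow>\<^sub>0 nat) \<Rightarrow>\<^sub>0 'k) set)"
      by (rule mon_span_mono[OF nf_exps_antimono]) auto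
  qed
qed

text \<open>Here the list is shortened on each piece before the pieces are assembled, since on
  \<open>\<Delta>\<close> itself the removal of e_j with j > m could use up the vanishing.\<close>

lemma koszul_vanish_from_skeleton:
  fixes V :: "'v set"
  assumes V: "finite V" and \<Delta>: "simplicial_complex_on V \<Delta>" and m: "m \<le> card V"
    and van: "koszul_vanish (rev (esyms V (card V))) m (mon_span (exps V))
      (mon_span (nf_exps V {F\<in>\<Delta>. card F \<le> m}) :: (('v \<Rightarrow>\<^sub>0 nat) \<Rightarrow>\<^sub>0 'k::field) set)"
  shows "koszul_vanish (rev (esyms V m)) m (mon_span (exps V))
      (mon_span (nf_exps V \<Delta>) :: (('v \<Rightarrow>\<^sub>0 nat) \<Rightarrow>\<^sub>0 'k) set)"
proof -
  let ?\<Gamma> = "{F\<in>\<Delta>. card F \<le> m}" and ?ys = "rev (esyms V m) :: (('v \<Rightarrow>\<^sub>0 nat) \<Rightarrow>\<^sub>0 'k) list"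
  have \<Gamma>: "simplicial_complex_on V ?\<Gamma>" by (rule simplicial_skeleton[OF V \<Delta>])
  have ys: "set ?ys \<subseteq> mon_span (exps V)" using esyms_mem[OF V] by simp
  have J: "koszul_vanish ?ys m (mon_span (nf_exps V ?\<Gamma>)) (mon_span (nf_exps V \<Delta>))"
  proof (rule koszul_vanish_faces[where P = "\<lambda>F. m < card F", OF V \<Gamma> ys _ \<Delta>])
    fix \<Delta> F assume \<Delta>: "simplicial_complex_on V \<Delta>" and \<Delta>': "simplicial_complex_on V (\<Delta> - {F})"
      and F: "F \<in> \<Delta>" "m < card F"
    let ?N = "mon_span (nf_exps V (\<Delta> - {F})) :: (('v \<Rightarrow>\<^sub>0 nat) \<Rightarrow>\<^sub>0 'k) set"
    let ?U = "mon_span (nf_exps V \<Delta>) :: (('v \<Rightarrow>\<^sub>0 nat) \<Rightarrow>\<^sub>0 'k) set"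
    have sub: "nf_exps V \<Delta> \<subseteq> nf_exps V (\<Delta> - {F})" by (rule nf_exps_antimono) auto
    have c: "card F \<le> card V" using F simplicial_vertices[OF \<Delta>] V card_mono by blast
    have 1: "koszul_vanish (rev (esyms V (card V))) (card F) ?N ?U"
      by (rule koszul_vanish_face[OF V \<Delta> \<Delta>' F(1)]) (use esyms_mem[OF V] in \<open>auto simp: set_esyms\<close>)
    \<comment> \<open>These removals are free: a product of more than |F| distinct variables takes a
      monomial with support \<open>F\<close> to one whose support is too large to be
      \<open>F\<close>.\<close>
    have 2: "koszul_vanish (rev (esyms V (card F))) (card F) ?N ?U"
    proof (rule koszul_vanish_esyms_zero[OF V submod_nf[OF \<Delta>'] submod_nf[OF \<Delta>] sub, of _ "card V - card F"])
      fix G a assume G: "G \<subseteq> V" "finite G" "card F < card G" "a \<in> nf_exps V (\<Delta> - {F})"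
      show "ind_exp G + a \<in> nf_exps V \<Delta>"
      proof (rule ind_exp_add_nf[OF \<Delta> G(2,1)])
        have "card G \<le> card (G \<union> Poly_Mapping.keys a)" using G by (intro card_mono) auto
        then have "G \<union> Poly_Mapping.keys a \<noteq> F" using G(3) by auto
        moreover have "G \<union> Poly_Mapping.keys a \<notin> \<Delta> - {F}"
          using G(4) simplicial_subset[OF \<Delta>', of _ "Poly_Mapping.keys a"] by (auto simp: nf_exps_def)
        ultimately show "G \<union> Poly_Mapping.keys a \<notin> \<Delta>" by auto
      qed (use G in \<open>auto simp: nf_exps_def\<close>)
    qed (use 1 c in simp)
    \<comment> \<open>The other \<open>card F - m\<close> removals cost as many degrees and leave
      exactly \<open>m\<close>.\<close>
    show "koszul_vanish ?ys m ?N ?U"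
      using koszul_vanish_esyms_drop[OF V submod_nf[OF \<Delta>'] submod_nf[OF \<Delta>] sub, of m "card F - m" m] 2 F(2) by simp
  qed auto
  show ?thesis
  proof (rule mp.koszul_vanish_ext[OF mp.submod_S submod_nf[OF \<Gamma>] submod_nf[OF \<Delta>] _ _ ys koszul_vanish_skeleton[OF V \<Delta> m van] J])
    show "mon_span (nf_exps V ?\<Gamma>) \<subseteq> (mon_span (exps V) :: (('v \<Rightarrow>\<^sub>0 nat) \<Rightarrow>\<^sub>0 'k) set)"
      by (rule mon_span_mono[OF nf_exps_subset])
    show "mon_span (nf_exps V \<Delta>) \<subseteq> (mon_span (nf_exps V ?\<Gamma>) :: (('v \<Rightarrow>\<^sub>0 nat) \<Rightarrow>\<^sub>0 'k) set)"
      by (rule mon_span_mono[OF nf_exps_antimono]) auto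
  qed
qed

text \<open>If vanishing went beyond |F|, removing e_1, ..., e_|F| would still leave it in degree 0,
  against the class of x_F. The list is not reversed because this time the low indices go
  first.\<close>

lemma koszul_vanish_facet_bound:
  fixes V :: "'v set"
  assumes V: "finite V" and \<Delta>: "simplicial_complex_on V \<Delta>" and F: "F \<in> \<Delta>"
    and facet: "\<And>G. G \<in> \<Delta> \<Longrightarrow> F \<subseteq> G \<Longrightarrow> G = F"
    and van: "koszul_vanish (esyms V (card V)) t (mon_span (exps V))
      (mon_span (nf_exps V \<Delta>) :: (('v \<Rightarrow>\<^sub>0 nat) \<Rightarrow>\<^sub>0 'k::field) set)"
  shows "t \<le> card F"
proof (rule ccontr)
  assume t: "\<not> t \<le> card F"
  let ?S = "mon_span (exps V) :: (('v \<Rightarrow>\<^sub>0 nat) \<Rightarrow>\<^sub>0 'k) set"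
  let ?I = "mon_span (nf_exps V \<Delta>) :: (('v \<Rightarrow>\<^sub>0 nat) \<Rightarrow>\<^sub>0 'k) set"
  have FV: "F \<subseteq> V" using simplicial_vertices[OF \<Delta> F] .
  then have c: "card F \<le> card V" using V card_mono by blast
  have finF: "finite F" using FV V finite_subset by blast
  have "koszul_vanish (map (esym V) [Suc i..<Suc (card V)]) (Suc (card F - i)) ?S ?I" if "i \<le> card F" for i
    using that
  proof (induction i)
    case 0
    then show ?case using koszul_vanish_mono[OF van] t by (simp add: esyms_def)
  next
    case (Suc i)
    show ?case
    proof (rule koszul_vanish_drop[OF mp.submod_S submod_nf[OF \<Delta>] nf_exps_subset esym_mem[OF V] homogeneous_esym[OF V]])
      have "[Suc i..<Suc (card V)] = Suc i # [Suc (Suc i)..<Suc (card V)]"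
        using Suc.prems c by (intro upt_conv_Cons) simp
      then show "koszul_vanish (esym V (Suc i) # map (esym V) [Suc (Suc i)..<Suc (card V)]) (Suc (Suc (card F - Suc i))) ?S ?I"
        using Suc by (simp add: Suc_diff_Suc)
    qed (use homogeneous_esym[OF V] esym_mem[OF V] in auto)
  qed
  from this[of "card F"]
  have 1: "koszul_vanish (map (esym V) [Suc (card F)..<Suc (card V)]) (Suc 0) ?S ?I" by simp
  let ?z = "Poly_Mapping.single (ind_exp F) 1 :: ('v \<Rightarrow>\<^sub>0 nat) \<Rightarrow>\<^sub>0 'k"
  have "?z \<in> ?I"
  proof (rule mp.koszul_vanish_0[OF submod_nf[OF \<Delta>] _ 1])
    show "?z \<in> ?S" using FV finF by (auto simp: mon_span_def exps_def keys_ind_exp)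
  next
    fix y assume "y \<in> set (map (esym V) [Suc (card F)..<Suc (card V)] :: (('v \<Rightarrow>\<^sub>0 nat) \<Rightarrow>\<^sub>0 'k) list)"
    then obtain j where j: "y = esym V j" "card F < j" by auto
    show "y * ?z \<in> ?I"
      unfolding j(1)
    proof (rule esym_mult_mem[OF V, of _ "{ind_exp F}"])
      fix G a assume G: "G \<subseteq> V" "finite G" "card G = j" "a \<in> {ind_exp F}"
      \<comment> \<open>A face containing \<open>G\<close> and the facet \<open>F\<close> would be
        \<open>F\<close> itself, which is too small for \<open>G\<close>.\<close>
      have "G \<union> F \<noteq> F"
        using card_mono[OF finF, of G] G(3) j(2) by auto
      then have "G \<union> F \<notin> \<Delta>" using facet[of "G \<union> F"] by auto
      then show "ind_exp G + a \<in> nf_exps V \<Delta>"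
        using G FV finF by (intro ind_exp_add_nf[OF \<Delta>]) (auto simp: exps_def keys_ind_exp)
    qed (simp add: mon_span_def)
  qed (use esym_mem[OF V] in auto)
  then show False using F finF by (simp add: mon_span_def nf_exps_def keys_ind_exp)
qed

section \<open>Stanley-Reisner modules as quotients\<close>

abbreviation mp_coset :: "'v set \<Rightarrow> (('v \<Rightarrow>\<^sub>0 nat) \<Rightarrow>\<^sub>0 'k::field) set \<Rightarrow> (('v \<Rightarrow>\<^sub>0 nat) \<Rightarrow>\<^sub>0 'k) \<Rightarrow> (('v \<Rightarrow>\<^sub>0 nat) \<Rightarrow>\<^sub>0 'k) set" where
  "mp_coset V I p \<equiv> I +>\<^bsub>mpoly_ring V\<^esub> p"

lemma ring_mpoly_ring: "ring (mpoly_ring V :: (('v \<Rightarrow>\<^sub>0 nat) \<Rightarrow>\<^sub>0 'k::field) ring)"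
  using cring_mpoly_ring by (rule cring.axioms(1))

lemma mpoly_ring_uminus:
  assumes "x \<in> mon_span (exps V)" shows "\<ominus>\<^bsub>mpoly_ring V\<^esub> x = - (x :: ('v \<Rightarrow>\<^sub>0 nat) \<Rightarrow>\<^sub>0 'k::field)"
proof -
  interpret ring "mpoly_ring V :: (('v \<Rightarrow>\<^sub>0 nat) \<Rightarrow>\<^sub>0 'k) ring" by (rule ring_mpoly_ring)
  show ?thesis
    by (rule minus_equality) (use assms mp.S_uminus in \<open>auto simp: carrier_mpoly_ring\<close>)
qed

text \<open>Bridge between ideals of the structure \<open>mpoly_ring V\<close> and submodules inside
  the ambient type.\<close>

lemma ideal_mpoly_ring_iff:
  "ideal I (mpoly_ring V) \<longleftrightarrow> mp.submod V I \<and> I \<subseteq> (mon_span (exps V) :: (('v \<Rightarrow>\<^sub>0 nat) \<Rightarrow>\<^sub>0 'k::field) set)"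
proof
  assume "ideal I (mpoly_ring V)"
  then interpret ideal I "mpoly_ring V" .
  show "mp.submod V I \<and> I \<subseteq> mon_span (exps V)"
    unfolding mp.submod_def
    using additive_subgroup.zero_closed[OF is_additive_subgroup] additive_subgroup.a_closed[OF is_additive_subgroup]
      I_l_closed a_subset by (auto simp: carrier_mpoly_ring)
next
  assume I: "mp.submod V I \<and> I \<subseteq> mon_span (exps V)"
  have mult: "x * a \<in> I" "a * x \<in> I" if "a \<in> I" "x \<in> mon_span (exps V)" for a x
    using mp.submod_mult[of V I x a] I that by (simp_all add: mult.commute)
  show "ideal I (mpoly_ring V)"
  proof (rule idealI[OF ring_mpoly_ring])
    show "subgroup I (add_monoid (mpoly_ring V))"
    proof
      fix x assume "x \<in> I"
      then show "inv\<^bsub>add_monoid (mpoly_ring V)\<^esub> x \<in> I"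
        using mpoly_ring_uminus[of x V] I mp.submod_uminus[of V I x] by (auto simp: a_inv_def)
    qed (use I mp.submod_add[of V I] mp.submod_zero[of V I] in \<open>auto simp: carrier_mpoly_ring\<close>)
  qed (simp_all add: carrier_mpoly_ring mult)
qed

lemma ideal_mon_span:
  assumes "\<And>a b. a \<in> exps V \<Longrightarrow> b \<in> B \<Longrightarrow> a + b \<in> B" "B \<subseteq> exps V"
  shows "ideal (mon_span B) (mpoly_ring V)"
  unfolding ideal_mpoly_ring_iff using submod_mon_span[OF assms(1)] mon_span_mono[OF assms(2)] by blast

lemma genideal_monomials:
  fixes V :: "'v set"
  assumes "A \<subseteq> exps V"
  shows "Idl\<^bsub>mpoly_ring V\<^esub> ((\<lambda>a. Poly_Mapping.single a (1::'k::field)) ` A) =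
    mon_span {m\<in>exps V. \<exists>a\<in>A. \<exists>b. m = a + b}" (is "Idl\<^bsub>_\<^esub> ?G = mon_span ?B")
proof -
  interpret ring "mpoly_ring V :: (('v \<Rightarrow>\<^sub>0 nat) \<Rightarrow>\<^sub>0 'k) ring" by (rule ring_mpoly_ring)
  have G: "?G \<subseteq> carrier (mpoly_ring V)"
    using assms by (auto simp: carrier_mpoly_ring mon_span_def)
  show ?thesis
  proof
    have "ideal (mon_span ?B :: (('v \<Rightarrow>\<^sub>0 nat) \<Rightarrow>\<^sub>0 'k) set) (mpoly_ring V)"
    proof (rule ideal_mon_span)
      fix c m assume c: "c \<in> exps V" and "m \<in> ?B"
      then obtain a b where "m \<in> exps V" "a \<in> A" "m = a + b" by auto
      moreover from this have "c + m = a + (c + b)" by (simp add: ac_simps)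
      ultimately show "c + m \<in> ?B" using c exps_add by blast
    qed auto
    moreover have "a \<in> ?B" if "a \<in> A" for a
      using that assms by (auto intro!: bexI[of _ a] exI[of _ 0])
    then have "?G \<subseteq> mon_span ?B" by (auto simp: mon_span_def)
    ultimately show "Idl\<^bsub>mpoly_ring V\<^esub> ?G \<subseteq> mon_span ?B" by (rule genideal_minimal)
  next
    have I: "ideal (Idl\<^bsub>mpoly_ring V\<^esub> ?G) (mpoly_ring V)" by (rule genideal_ideal[OF G])
    then have sm: "mp.submod V (Idl\<^bsub>mpoly_ring V\<^esub> ?G)" by (simp add: ideal_mpoly_ring_iff)
    show "mon_span ?B \<subseteq> Idl\<^bsub>mpoly_ring V\<^esub> ?G"
    proof
      fix p :: "('v \<Rightarrow>\<^sub>0 nat) \<Rightarrow>\<^sub>0 'k" assume p: "p \<in> mon_span ?B"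
      show "p \<in> Idl\<^bsub>mpoly_ring V\<^esub> ?G"
      proof (rule sum_singles_induct)
        fix m assume "m \<in> Poly_Mapping.keys p"
        then obtain a b where m: "m \<in> exps V" "a \<in> A" "m = a + b" using p by (auto simp: mon_span_def)
        then have "b \<in> exps V" by (auto simp: exps_def keys_add_nat)
        then have "Poly_Mapping.single b (Poly_Mapping.lookup p m) * Poly_Mapping.single a 1 \<in> Idl\<^bsub>mpoly_ring V\<^esub> ?G"
          using m(2) genideal_self[OF G] by (intro mp.submod_mult[OF sm]) (auto simp: mon_span_def)
        then show "Poly_Mapping.single m (Poly_Mapping.lookup p m) \<in> Idl\<^bsub>mpoly_ring V\<^esub> ?G"
          by (simp add: mult_single m(3) add.commute)
      qed (use mp.submod_zero[OF sm] mp.submod_add[OF sm] in auto)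
    qed
  qed
qed

text \<open>The support of a monomial is a non-face exactly if the squarefree monomial of some
  minimal non-face divides it.\<close>

lemma SR_ideal_eq:
  assumes "finite V" "simplicial_complex_on V \<Delta>"
  shows "SR_ideal V \<Delta> = (mon_span (nf_exps V \<Delta>) :: (('v \<Rightarrow>\<^sub>0 nat) \<Rightarrow>\<^sub>0 'k::field) set)"
proof -
  have fin: "finite F" if "F \<in> minimal_nonfaces V \<Delta>" for F
    using that assms(1) finite_subset by (auto simp: minimal_nonfaces_def)
  have "SR_ideal V \<Delta> = Idl\<^bsub>mpoly_ring V\<^esub> ((\<lambda>a. Poly_Mapping.single a (1::'k)) ` ind_exp ` minimal_nonfaces V \<Delta>)"
    by (simp add: SR_ideal_def prod_mpoly_var image_image)
  also have "\<dots> = mon_span {m\<in>exps V. \<exists>a\<in>ind_exp ` minimal_nonfaces V \<Delta>. \<exists>b. m = a + b}"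
    by (rule genideal_monomials) (use fin in \<open>auto simp: exps_def keys_ind_exp minimal_nonfaces_def\<close>)
  also have "{m\<in>exps V. \<exists>a\<in>ind_exp ` minimal_nonfaces V \<Delta>. \<exists>b. m = a + b} = nf_exps V \<Delta>"
  proof (intro equalityI subsetI)
    fix m assume "m \<in> {m\<in>exps V. \<exists>a\<in>ind_exp ` minimal_nonfaces V \<Delta>. \<exists>b. m = a + b}"
    then obtain F b where F: "m \<in> exps V" "F \<in> minimal_nonfaces V \<Delta>" "m = ind_exp F + b" by auto
    then have "F \<subseteq> Poly_Mapping.keys m" "F \<notin> \<Delta>"
      by (auto simp: keys_add_nat keys_ind_exp fin minimal_nonfaces_def)
    then show "m \<in> nf_exps V \<Delta>" using F(1) simplicial_subset[OF assms(2)] by (auto simp: nf_exps_def)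
  next
    fix m assume m: "m \<in> nf_exps V \<Delta>"
    obtain F where F: "F \<subseteq> Poly_Mapping.keys m" "F \<notin> \<Delta>" and min: "\<And>G. G \<subset> F \<Longrightarrow> G \<in> \<Delta>"
    proof -
      \<comment> \<open>A non-face of least size inside the support is minimal for
        inclusion.\<close>
      have "\<exists>F. (F \<subseteq> Poly_Mapping.keys m \<and> F \<notin> \<Delta>) \<and> (\<forall>G. (G \<subseteq> Poly_Mapping.keys m \<and> G \<notin> \<Delta>) \<longrightarrow> card F \<le> card G)"
        by (rule ex_has_least_nat[of _ "Poly_Mapping.keys m"]) (use m in \<open>auto simp: nf_exps_def\<close>)
      then obtain F where F: "F \<subseteq> Poly_Mapping.keys m" "F \<notin> \<Delta>"
        and least: "\<And>G. G \<subseteq> Poly_Mapping.keys m \<Longrightarrow> G \<notin> \<Delta> \<Longrightarrow> card F \<le> card G" by blast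
      have "G \<in> \<Delta>" if "G \<subset> F" for G
        using least[of G] psubset_card_mono[OF finite_subset[OF F(1)] that] F(1) that by force
      then show ?thesis using that F by blast
    qed
    have "F \<in> minimal_nonfaces V \<Delta>"
      using F min m by (auto simp: minimal_nonfaces_def nf_exps_def exps_def)
    \<comment> \<open>The truncated subtraction of exponents is exact because \<open>F\<close> lies
      in the support of \<open>m\<close>.\<close>
    moreover have "m = ind_exp F + (m - ind_exp F)"
    proof (rule poly_mapping_eqI)
      fix v
      have "v \<in> F \<Longrightarrow> Poly_Mapping.lookup m v \<noteq> 0" using F(1) by (auto simp: in_keys_iff)
      then show "Poly_Mapping.lookup m v = Poly_Mapping.lookup (ind_exp F + (m - ind_exp F)) v"
        using finite_subset[OF F(1)] by (auto simp: lookup_add lookup_minus lookup_ind_exp)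
    qed
    ultimately show "m \<in> {m\<in>exps V. \<exists>a\<in>ind_exp ` minimal_nonfaces V \<Delta>. \<exists>b. m = a + b}"
      using m by (auto simp: nf_exps_def)
  qed
  finally show ?thesis .
qed

lemma irrelevant_ideal_eq: "irrelevant_ideal V = (mon_span (exps V - {0}) :: (('v \<Rightarrow>\<^sub>0 nat) \<Rightarrow>\<^sub>0 'k::field) set)"
proof -
  let ?s = "\<lambda>v. Poly_Mapping.single v (1::nat)"
  have "irrelevant_ideal V = Idl\<^bsub>mpoly_ring V\<^esub> ((\<lambda>a. Poly_Mapping.single a (1::'k)) ` ?s ` V)"
    by (simp add: irrelevant_ideal_def mpoly_var_def image_image cong: image_cong)
  also have "\<dots> = mon_span {m\<in>exps V. \<exists>a\<in>?s ` V. \<exists>b. m = a + b}"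
    by (rule genideal_monomials) (auto simp: exps_def)
  also have "{m\<in>exps V. \<exists>a\<in>?s ` V. \<exists>b. m = a + b} = exps V - {0}"
  proof (intro equalityI subsetI)
    fix m assume "m \<in> {m\<in>exps V. \<exists>a\<in>?s ` V. \<exists>b. m = a + b}"
    then obtain v b where "m \<in> exps V" "m = ?s v + b" by auto
    moreover from this have "Poly_Mapping.lookup m v \<noteq> 0" by (simp add: lookup_add)
    ultimately show "m \<in> exps V - {0}" by auto
  next
    fix m assume m: "m \<in> exps V - {0}"
    then obtain v where v: "v \<in> Poly_Mapping.keys m" by (metis DiffD2 equals0I keys_eq_empty singletonI)
    have "m = ?s v + (m - ?s v)"
      by (rule poly_mapping_eqI) (use v in \<open>auto simp: lookup_add lookup_minus lookup_single when_def in_keys_iff\<close>)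
    then show "m \<in> {m\<in>exps V. \<exists>a\<in>?s ` V. \<exists>b. m = a + b}" using m v by (auto simp: exps_def)
  qed
  finally show ?thesis .
qed

context
  fixes V :: "'v set" and I :: "(('v \<Rightarrow>\<^sub>0 nat) \<Rightarrow>\<^sub>0 'k::field) set"
  assumes I: "ideal I (mpoly_ring V)"
begin

interpretation R: cring "mpoly_ring V :: (('v \<Rightarrow>\<^sub>0 nat) \<Rightarrow>\<^sub>0 'k) ring" by (rule cring_mpoly_ring)
interpretation I: ideal I "mpoly_ring V" by (rule I)

lemma mp_coset_eq_iff:
  assumes "p \<in> mon_span (exps V)" "q \<in> mon_span (exps V)"
  shows "mp_coset V I p = mp_coset V I q \<longleftrightarrow> p - q \<in> I"
  using R.quotient_eq_iff_same_a_r_cos[OF I, of p q] assms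
  by (simp add: a_minus_def mpoly_ring_uminus carrier_mpoly_ring)

lemma quot_carrier: "carrier (mpoly_ring V Quot I) = mp_coset V I ` mon_span (exps V)"
  by (auto simp: FactRing_def A_RCOSETS_def' carrier_mpoly_ring)

lemma quot_zero: "\<zero>\<^bsub>mpoly_ring V Quot I\<^esub> = mp_coset V I 0"
  using ring_hom_zero[OF I.rcos_ring_hom R.ring_axioms I.quotient_is_ring] by simp

lemma mp_coset_eq_zero_iff: "p \<in> mon_span (exps V) \<Longrightarrow> mp_coset V I p = mp_coset V I 0 \<longleftrightarrow> p \<in> I"
  using mp_coset_eq_iff[OF _ mp.submod_zero[OF mp.submod_S]] by simp

lemma quot_mult:
  assumes "p \<in> mon_span (exps V)" "q \<in> mon_span (exps V)"
  shows "mp_coset V I p \<otimes>\<^bsub>mpoly_ring V Quot I\<^esub> mp_coset V I q = mp_coset V I (p * q)"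
  using ring_hom_mult[OF I.rcos_ring_hom, of p q] assms by (simp add: carrier_mpoly_ring)

lemma quot_add:
  assumes "p \<in> mon_span (exps V)" "q \<in> mon_span (exps V)"
  shows "mp_coset V I p \<oplus>\<^bsub>mpoly_ring V Quot I\<^esub> mp_coset V I q = mp_coset V I (p + q)"
  using ring_hom_add[OF I.rcos_ring_hom, of p q] assms by (simp add: carrier_mpoly_ring)

lemma elem_annihilator_quotient:
  assumes "p \<in> mon_span (exps V)"
  shows "elem_annihilator (mpoly_ring V) (quotient_module (mpoly_ring V) I) (mp_coset V I p) =
    {r \<in> mon_span (exps V). r * p \<in> I}"
  unfolding elem_annihilator_def
  by (rule Collect_cong)
    (auto simp: assms quotient_module_simps quot_zero quot_mult carrier_mpoly_ring
      mp_coset_eq_zero_iff[OF mp.S_mult[OF _ assms]] simp del: set_eq_subset cong: conj_cong)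

text \<open>Testing an annihilating element on the coset of 1 shows that it lies in
  \<open>I\<close>.\<close>

lemma annihilator_quotient: "annihilator (mpoly_ring V) (quotient_module (mpoly_ring V) I) = I"
proof -
  have "annihilator (mpoly_ring V) (quotient_module (mpoly_ring V) I) =
      {r \<in> mon_span (exps V). \<forall>p\<in>mon_span (exps V). r * p \<in> I}"
    unfolding annihilator_def
    by (rule Collect_cong)
      (simp add: quotient_module_simps quot_zero quot_mult carrier_mpoly_ring quot_carrier
        mp_coset_eq_zero_iff[OF mp.S_mult] cong: conj_cong)
  also have "\<dots> = I"
  proof (intro equalityI subsetI)
    fix r assume "r \<in> {r \<in> mon_span (exps V). \<forall>p\<in>mon_span (exps V). r * p \<in> I}"
    then show "r \<in> I" using mp.S_one by force
  next
    fix r assume "r \<in> I"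
    then show "r \<in> {r \<in> mon_span (exps V). \<forall>p\<in>mon_span (exps V). r * p \<in> I}"
      using I mp.submod_mult[of V I _ r] by (auto simp: ideal_mpoly_ring_iff mult.commute)
  qed
  finally show ?thesis .
qed

lemma quotient_module_trivial_iff: "carrier (quotient_module (mpoly_ring V) I) = {\<zero>\<^bsub>quotient_module (mpoly_ring V) I\<^esub>} \<longleftrightarrow> 1 \<in> I"
proof
  assume "carrier (quotient_module (mpoly_ring V) I) = {\<zero>\<^bsub>quotient_module (mpoly_ring V) I\<^esub>}"
  then have "mp_coset V I 1 = mp_coset V I 0"
    using mp.S_one[of V] by (auto simp: quotient_module_simps quot_carrier quot_zero)
  then show "1 \<in> I" using mp_coset_eq_iff[OF mp.S_one mp.submod_zero[OF mp.submod_S]] by simp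
next
  assume 1: "1 \<in> I"
  have "mp_coset V I p = mp_coset V I 0" if p: "p \<in> mon_span (exps V)" for p
  proof -
    have "p * 1 \<in> I" using I 1 p mp.submod_mult[of V I p 1] by (simp add: ideal_mpoly_ring_iff)
    then show ?thesis using mp_coset_eq_iff[OF p mp.submod_zero[OF mp.submod_S]] by simp
  qed
  then show "carrier (quotient_module (mpoly_ring V) I) = {\<zero>\<^bsub>quotient_module (mpoly_ring V) I\<^esub>}"
    using mp.S_one[of V] by (auto simp: quotient_module_simps quot_carrier quot_zero)
qed

text \<open>The list is reversed because a sum over an initial segment grows by its last term,
  whereas \<open>lin_combs\<close> grows at the head.\<close>

lemma list_smult_module_quotient:
  assumes "set rs \<subseteq> mon_span (exps V)"
  shows "list_smult_module (quotient_module (mpoly_ring V) I) rs = mp_coset V I ` lin_combs (mon_span (exps V)) (rev rs)"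
proof -
  let ?S = "mon_span (exps V) :: (('v \<Rightarrow>\<^sub>0 nat) \<Rightarrow>\<^sub>0 'k) set" and ?M = "quotient_module (mpoly_ring V) I"
  interpret M: module "mpoly_ring V" ?M by (rule module_quotient_module[OF cring_mpoly_ring I])
  have rs: "rs ! j \<in> ?S" if "j < length rs" for j using assms that by auto
  \<comment> \<open>Value and membership are followed together, since adding the next coset needs a
    representative in the ring.\<close>
  have sum: "(\<Oplus>\<^bsub>?M\<^esub>j\<in>{..<k}. (rs ! j) \<odot>\<^bsub>?M\<^esub> mp_coset V I (q j)) = mp_coset V I (\<Sum>j<k. rs ! j * q j) \<and>
      (\<Sum>j<k. rs ! j * q j) \<in> lin_combs ?S (rev (take k rs))"
    if "k \<le> length rs" "\<And>j. j < length rs \<Longrightarrow> q j \<in> ?S" for k q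
    using that(1)
  proof (induction k)
    case 0
    then show ?case by (simp add: M.finsum_empty quotient_module_simps quot_zero)
  next
    case (Suc k)
    then have k: "k < length rs" "rs ! k \<in> ?S" "q k \<in> ?S" using rs that(2) by auto
    have s: "(rs ! j) \<odot>\<^bsub>?M\<^esub> mp_coset V I (q j) = mp_coset V I (rs ! j * q j)" if "j < length rs" for j
      using that rs \<open>\<And>j. j < length rs \<Longrightarrow> q j \<in> ?S\<close> by (simp add: quotient_module_simps quot_mult)
    have c: "mp_coset V I (rs ! j * q j) \<in> carrier ?M" if "j < length rs" for j
      unfolding quotient_module_simps quot_carrier
      by (intro imageI mp.S_mult) (use that rs \<open>\<And>j. j < length rs \<Longrightarrow> q j \<in> ?S\<close> in simp_all)
    have "lin_combs ?S (rev (take k rs)) \<subseteq> ?S"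
      by (rule mp.lin_combs_subset[OF mp.submod_S]) (use assms set_take_subset mp.S_mult in \<open>fastforce\<close>)
    then have S: "(\<Sum>j<k. rs ! j * q j) \<in> ?S" using Suc k by auto
    have "(\<Oplus>\<^bsub>?M\<^esub>j\<in>{..<Suc k}. (rs ! j) \<odot>\<^bsub>?M\<^esub> mp_coset V I (q j)) =
        (rs ! k) \<odot>\<^bsub>?M\<^esub> mp_coset V I (q k) \<oplus>\<^bsub>?M\<^esub> (\<Oplus>\<^bsub>?M\<^esub>j\<in>{..<k}. (rs ! j) \<odot>\<^bsub>?M\<^esub> mp_coset V I (q j))"
      unfolding lessThan_Suc by (rule M.finsum_insert) (use k c s in auto)
    also have "\<dots> = mp_coset V I (rs ! k * q k) \<oplus>\<^bsub>?M\<^esub> mp_coset V I (\<Sum>j<k. rs ! j * q j)"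
      using Suc k s by simp
    also have "\<dots> = mp_coset V I (\<Sum>j<Suc k. rs ! j * q j)"
      using quot_add[OF mp.S_mult[OF k(2,3)] S] by (simp add: quotient_module_simps add.commute)
    finally have 1: "(\<Oplus>\<^bsub>?M\<^esub>j\<in>{..<Suc k}. (rs ! j) \<odot>\<^bsub>?M\<^esub> mp_coset V I (q j)) = mp_coset V I (\<Sum>j<Suc k. rs ! j * q j)" .
    have "(\<Sum>j<Suc k. rs ! j * q j) = rs ! k * q k + (\<Sum>j<k. rs ! j * q j)" by simp
    moreover have "rev (take (Suc k) rs) = rs ! k # rev (take k rs)"
      by (simp add: take_Suc_conv_app_nth[OF k(1)])
    moreover have "(\<Sum>j<k. rs ! j * q j) \<in> lin_combs ?S (rev (take k rs))" using Suc k by simp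
    ultimately have "(\<Sum>j<Suc k. rs ! j * q j) \<in> lin_combs ?S (rev (take (Suc k) rs))"
      using k(3) unfolding lin_combs.simps by (metis (mono_tags, lifting) lin_combs.simps(2) mem_Collect_eq)
    with 1 show ?case by blast
  qed
  have ex: "\<exists>q. (\<forall>j. q j \<in> ?S) \<and> (\<Sum>j<k. rs ! j * q j) = b" if "b \<in> lin_combs ?S (rev (take k rs))" "k \<le> length rs" for b k
    using that
  proof (induction k arbitrary: b)
    case 0
    then show ?case using mp.S_one by (auto intro!: exI[of _ "\<lambda>_. 1"])
  next
    case (Suc k)
    then obtain a c where b: "b = rs ! k * a + c" "a \<in> ?S" "c \<in> lin_combs ?S (rev (take k rs))"
      by (auto simp: take_Suc_conv_app_nth)
    then obtain q where q: "\<forall>j. q j \<in> ?S" "(\<Sum>j<k. rs ! j * q j) = c" using Suc by force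
    have "(\<Sum>j<k. rs ! j * (q(k := a)) j) = c"
      unfolding q(2)[symmetric] by (rule sum.cong) auto
    then have "(\<Sum>j<Suc k. rs ! j * (q(k := a)) j) = b" by (simp add: b(1) add.commute)
    moreover have "\<forall>j. (q(k := a)) j \<in> ?S" using q b by simp
    ultimately show ?case by blast
  qed
  show ?thesis
  proof (intro equalityI subsetI)
    fix x assume "x \<in> list_smult_module ?M rs"
    then obtain y where x: "x = (\<Oplus>\<^bsub>?M\<^esub>j\<in>{..<length rs}. (rs ! j) \<odot>\<^bsub>?M\<^esub> y j)" and y: "y \<in> {..<length rs} \<rightarrow> carrier ?M"
      by (auto simp: list_smult_module_def)
    have "\<forall>j. \<exists>q. j < length rs \<longrightarrow> q \<in> ?S \<and> y j = mp_coset V I q"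
      using y by (auto simp: quotient_module_simps quot_carrier Pi_iff)
    then obtain q where q: "\<And>j. j < length rs \<Longrightarrow> q j \<in> ?S" "\<And>j. j < length rs \<Longrightarrow> y j = mp_coset V I (q j)"
      by metis
    have "x = (\<Oplus>\<^bsub>?M\<^esub>j\<in>{..<length rs}. (rs ! j) \<odot>\<^bsub>?M\<^esub> mp_coset V I (q j))"
      unfolding x
    proof (rule M.finsum_cong')
      show "(\<lambda>j. (rs ! j) \<odot>\<^bsub>?M\<^esub> mp_coset V I (q j)) \<in> {..<length rs} \<rightarrow> carrier ?M"
        using rs q(1) by (auto simp: carrier_mpoly_ring quotient_module_simps quot_carrier quot_mult mp.S_mult)
    qed (use q in auto)
    then show "x \<in> mp_coset V I ` lin_combs ?S (rev rs)" using sum[OF order_refl q(1)] by auto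
  next
    fix x assume "x \<in> mp_coset V I ` lin_combs ?S (rev rs)"
    then obtain b where b: "b \<in> lin_combs ?S (rev rs)" "x = mp_coset V I b" by auto
    then obtain q where q: "\<forall>j. q j \<in> ?S" "(\<Sum>j<length rs. rs ! j * q j) = b" using ex[of b "length rs"] by auto
    then have "x = (\<Oplus>\<^bsub>?M\<^esub>j\<in>{..<length rs}. (rs ! j) \<odot>\<^bsub>?M\<^esub> mp_coset V I (q j))"
      using sum[OF order_refl, of q] b by simp
    then show "x \<in> list_smult_module ?M rs"
      unfolding list_smult_module_def using q(1) 
      by (intro CollectI exI[of _ "\<lambda>j. mp_coset V I (q j)"]) (auto simp: quotient_module_simps quot_carrier)
  qed
qed

lemma mp_coset_mem_list_smult_iff:
  assumes "set rs \<subseteq> mon_span (exps V)" "p \<in> mon_span (exps V)"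
  shows "mp_coset V I p \<in> list_smult_module (quotient_module (mpoly_ring V) I) rs \<longleftrightarrow>
    p \<in> submod_plus (mon_span (exps V)) I (rev rs)"
proof -
  have "lin_combs (mon_span (exps V)) (rev rs) \<subseteq> mon_span (exps V)"
    by (rule mp.lin_combs_subset[OF mp.submod_S]) (use assms mp.S_mult in auto)
  then have "mp_coset V I p \<in> mp_coset V I ` lin_combs (mon_span (exps V)) (rev rs) \<longleftrightarrow>
      (\<exists>b\<in>lin_combs (mon_span (exps V)) (rev rs). p - b \<in> I)"
    using mp_coset_eq_iff[OF assms(2)] by blast
  also have "\<dots> \<longleftrightarrow> p \<in> submod_plus (mon_span (exps V)) I (rev rs)"
    unfolding submod_plus_def by (auto intro: exI[of _ "p - _"]) (metis add_diff_cancel_right')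
  finally show ?thesis by (simp add: list_smult_module_quotient[OF assms(1)])
qed

text \<open>Eliminates cosets, so that regular sequences become statements about submodules of the
  polynomial ring.\<close>

lemma regular_sequence_quotient_iff:
  "regular_sequence (mpoly_ring V) (quotient_module (mpoly_ring V) I) rs \<longleftrightarrow>
    set rs \<subseteq> mon_span (exps V) \<and>
    (\<forall>i<length rs. \<forall>p\<in>mon_span (exps V). rs ! i * p \<in> submod_plus (mon_span (exps V)) I (rev (take i rs)) \<longrightarrow>
      p \<in> submod_plus (mon_span (exps V)) I (rev (take i rs))) \<and>
    \<not> mon_span (exps V) \<subseteq> submod_plus (mon_span (exps V)) I (rev rs)"
proof (cases "set rs \<subseteq> mon_span (exps V)")
  case True
  let ?M = "quotient_module (mpoly_ring V) I"
  have take: "set (take i rs) \<subseteq> mon_span (exps V)" for i using True set_take_subset by fast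
  have nth: "i < length rs \<Longrightarrow> rs ! i \<in> mon_span (exps V)" for i using True by auto
  have "lin_combs (mon_span (exps V)) (rev rs) \<subseteq> mon_span (exps V)"
    by (rule mp.lin_combs_subset[OF mp.submod_S]) (use True mp.S_mult in auto)
  then have "list_smult_module ?M rs \<subseteq> carrier ?M"
    unfolding list_smult_module_quotient[OF True] by (auto simp: quotient_module_simps quot_carrier)
  then have "list_smult_module ?M rs \<noteq> carrier ?M \<longleftrightarrow> \<not> (\<forall>p\<in>mon_span (exps V). mp_coset V I p \<in> list_smult_module ?M rs)"
    by (auto simp: quotient_module_simps quot_carrier)
  moreover have "(\<forall>x\<in>carrier ?M. (rs ! i) \<odot>\<^bsub>?M\<^esub> x \<in> list_smult_module ?M (take i rs) \<longrightarrow> x \<in> list_smult_module ?M (take i rs))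
      \<longleftrightarrow> (\<forall>p\<in>mon_span (exps V). rs ! i * p \<in> submod_plus (mon_span (exps V)) I (rev (take i rs)) \<longrightarrow>
        p \<in> submod_plus (mon_span (exps V)) I (rev (take i rs)))" if "i < length rs" for i
    using mp_coset_mem_list_smult_iff[OF take] mp.S_mult[OF nth[OF that]] nth[OF that]
    by (auto simp: quotient_module_simps quot_carrier quot_mult)
  ultimately show ?thesis
    unfolding regular_sequence_def using True mp_coset_mem_list_smult_iff[OF True]
    by (simp add: carrier_mpoly_ring subset_eq)
qed (simp add: regular_sequence_def carrier_mpoly_ring)

end

section \<open>Krull dimension\<close>

text \<open>Gaussian elimination: a pivot \<open>a0\<close> removes the equation \<open>b\<close>
  together with one unknown.\<close>

lemma homogeneous_system_nontrivial:
  fixes M :: "'a \<Rightarrow> 'b \<Rightarrow> 'k::field"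
  assumes "finite B" "finite A" "card B < card A"
  shows "\<exists>c. (\<exists>a\<in>A. c a \<noteq> 0) \<and> (\<forall>b\<in>B. (\<Sum>a\<in>A. c a * M a b) = 0)"
  using assms
proof (induction B arbitrary: A M rule: finite_induct)
  case empty
  then show ?case by (intro exI[of _ "\<lambda>_. 1"]) (auto simp: card_gt_0_iff)
next
  case (insert b B)
  show ?case
  proof (cases "\<forall>a\<in>A. M a b = 0")
    case True
    have "card B < card A" using insert by simp
    then obtain c where "\<exists>a\<in>A. c a \<noteq> 0" "\<forall>b\<in>B. (\<Sum>a\<in>A. c a * M a b) = 0"
      using insert.IH[OF \<open>finite A\<close>] by blast
    then show ?thesis using True by (intro exI[of _ c]) auto
  next
    case False
    then obtain a0 where a0: "a0 \<in> A" "M a0 b \<noteq> 0" by auto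
    let ?A = "A - {a0}"
    have "finite ?A" "card B < card ?A" using insert a0 by auto
    then obtain c where c: "\<exists>a\<in>?A. c a \<noteq> 0"
      "\<forall>b'\<in>B. (\<Sum>a\<in>?A. c a * (M a b' - M a b / M a0 b * M a0 b')) = 0"
      using insert.IH[of ?A "\<lambda>a b'. M a b' - M a b / M a0 b * M a0 b'"] by blast
    \<comment> \<open>The value of the unknown \<open>a0\<close> that solves equation
      \<open>b\<close>.\<close>
    let ?s = "- (\<Sum>a\<in>?A. c a * M a b) / M a0 b"
    have sum: "(\<Sum>a\<in>A. (c(a0 := ?s)) a * M a b') = ?s * M a0 b' + (\<Sum>a\<in>?A. c a * M a b')" for b'
      by (subst sum.remove[OF \<open>finite A\<close> a0(1)]) (auto intro!: sum.cong)
    have "(\<Sum>a\<in>A. (c(a0 := ?s)) a * M a b') = 0" if b': "b' \<in> insert b B" for b'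
    proof (cases "b' = b")
      case True
      show ?thesis unfolding True sum using a0(2) by simp
    next
      case False
      then have "(\<Sum>a\<in>?A. c a * (M a b' - M a b / M a0 b * M a0 b')) = 0" using c(2) b' by blast
      then show ?thesis
        unfolding sum by (simp add: right_diff_distrib sum_subtractf sum_divide_distrib sum_distrib_left mult_ac)
    qed
    moreover have "\<exists>a\<in>A. (c(a0 := ?s)) a \<noteq> 0" using c(1) by auto
    ultimately show ?thesis by blast
  qed
qed

section \<open>Algebraic dependence by counting monomials\<close>

primrec pow_list :: "'a::comm_monoid_mult list \<Rightarrow> nat list \<Rightarrow> 'a" where
  "pow_list [] as = 1"
| "pow_list (y # ys) as = y ^ hd as * pow_list ys (tl as)"

definition exp_box :: "nat \<Rightarrow> nat \<Rightarrow> nat list set" where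
  "exp_box s r = {as. set as \<subseteq> {..s} \<and> length as = r}"

lemma finite_exp_box: "finite (exp_box s r)" and card_exp_box: "card (exp_box s r) = Suc s ^ r"
  by (simp_all add: exp_box_def finite_lists_length_eq card_lists_length_eq)

lemma exp_box_Suc: "exp_box s (Suc r) = (\<lambda>(a, as). a # as) ` ({..s} \<times> exp_box s r)"
  by (auto simp: exp_box_def length_Suc_conv)

lemma sum_exp_box_Suc: "(\<Sum>as\<in>exp_box s (Suc r). f as) = (\<Sum>a\<le>s. \<Sum>as\<in>exp_box s r. f (a # as))"
  unfolding exp_box_Suc by (subst sum.reindex) (auto simp: inj_on_def sum.cartesian_product case_prod_unfold)

lemma pow_list_mem: "set ys \<subseteq> mon_span (exps V) \<Longrightarrow> pow_list ys as \<in> mon_span (exps V)"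
  by (induction ys arbitrary: as) (auto intro!: mp.S_one mp.S_mult mp.S_power)

lemma total_deg_pow_list:
  assumes "\<And>y m. y \<in> set ys \<Longrightarrow> m \<in> Poly_Mapping.keys y \<Longrightarrow> total_deg m \<le> D"
    and "as \<in> exp_box s (length ys)"
    and "m \<in> Poly_Mapping.keys (pow_list ys as :: ('v \<Rightarrow>\<^sub>0 nat) \<Rightarrow>\<^sub>0 'k::field)"
  shows "total_deg m \<le> D * s * length ys"
  using assms
proof (induction ys arbitrary: as m)
  case (Cons y ys)
  then obtain a bs where as: "as = a # bs" "a \<le> s" "bs \<in> exp_box s (length ys)" by (auto simp: exp_box_Suc)
  have pow: "total_deg m \<le> D * k" if "m \<in> Poly_Mapping.keys (y ^ k)" for k m
    using that
  proof (induction k arbitrary: m)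
    case (Suc k)
    then obtain p q where m: "m = p + q" "p \<in> Poly_Mapping.keys y" "q \<in> Poly_Mapping.keys (y ^ k)"
      using keys_mult[of y "y ^ k"] by auto
    then have "total_deg p \<le> D" using Cons.prems(1)[of y p] by simp
    then show ?case using Suc.IH[OF m(3)] by (simp add: m(1) total_deg_add)
  qed simp
  obtain p q where m: "m = p + q" "p \<in> Poly_Mapping.keys (y ^ a)" "q \<in> Poly_Mapping.keys (pow_list ys bs)"
    using Cons.prems(3) keys_mult[of "y ^ a" "pow_list ys bs"] by (auto simp: as)
  have "total_deg p \<le> D * s" using pow[OF m(2)] as(2) by (meson le_trans mult_le_mono2)
  moreover have "total_deg q \<le> D * s * length ys" by (rule Cons.IH[OF _ as(3) m(3)], rule Cons.prems(1)) simp_all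
  ultimately show ?case by (simp add: m(1) total_deg_add)
qed simp

text \<open>A crude bound: every single exponent is at most the total degree.\<close>

lemma card_bounded_exps:
  assumes "finite F"
  shows "finite {m \<in> exps F. total_deg m \<le> E}" "card {m \<in> exps F. total_deg m \<le> E} \<le> Suc E ^ card F"
proof -
  let ?f = "\<lambda>m. restrict (Poly_Mapping.lookup m) F"
  have inj: "inj_on ?f {m \<in> exps F. total_deg m \<le> E}"
  proof
    fix m m' assume m: "m \<in> {m \<in> exps F. total_deg m \<le> E}" "m' \<in> {m \<in> exps F. total_deg m \<le> E}" "?f m = ?f m'"
    show "m = m'"
    proof (rule poly_mapping_eqI)
      fix v
      show "Poly_Mapping.lookup m v = Poly_Mapping.lookup m' v"
      proof (cases "v \<in> F")
        case True
        then show ?thesis using fun_cong[OF m(3), of v] by simp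
      next
        case False
        then have "v \<notin> Poly_Mapping.keys m" "v \<notin> Poly_Mapping.keys m'" using m by (auto simp: exps_def)
        then show ?thesis by (simp add: in_keys_iff)
      qed
    qed
  qed
  have sub: "?f ` {m \<in> exps F. total_deg m \<le> E} \<subseteq> PiE F (\<lambda>_. {..E})"
  proof (rule image_subsetI)
    fix m assume m: "m \<in> {m \<in> exps F. total_deg m \<le> E}"
    have "Poly_Mapping.lookup m v \<le> E" for v
    proof (cases "v \<in> Poly_Mapping.keys m")
      case True
      then have "Poly_Mapping.lookup m v \<le> total_deg m" unfolding total_deg_def by (intro member_le_sum) auto
      then show ?thesis using m by simp
    qed (simp add: in_keys_iff)
    then show "?f m \<in> PiE F (\<lambda>_. {..E})" by auto
  qed
  have fin: "finite (PiE F (\<lambda>_. {..E}))" using assms by (simp add: finite_PiE)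
  show "finite {m \<in> exps F. total_deg m \<le> E}" by (rule inj_on_finite[OF inj sub fin])
  show "card {m \<in> exps F. total_deg m \<le> E} \<le> Suc E ^ card F"
    using card_inj_on_le[OF inj sub fin] assms by (simp add: card_PiE)
qed

text \<open>With r elements of degree at most D there are (s + 1)^r products of powers with
  exponents up to s. They lie in a space of dimension at most (D s r + 1)^|F|, so for r > |F| and
  suitable s they are linearly dependent.\<close>

lemma algebraically_dependent:
  fixes ys :: "(('v \<Rightarrow>\<^sub>0 nat) \<Rightarrow>\<^sub>0 'k::field) list"
  assumes F: "finite F" and ys: "set ys \<subseteq> mon_span (exps F)" and len: "card F < length ys"
  obtains s c where "\<exists>as\<in>exp_box s (length ys). c as \<noteq> 0"
    "(\<Sum>as\<in>exp_box s (length ys). Poly_Mapping.single 0 (c as) * pow_list ys as) = 0"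
proof -
  let ?r = "length ys"
  have "finite (\<Union>y\<in>set ys. total_deg ` Poly_Mapping.keys y)" by auto
  then obtain D where "\<And>x. x \<in> (\<Union>y\<in>set ys. total_deg ` Poly_Mapping.keys y) \<Longrightarrow> x < D"
    unfolding finite_nat_iff_bounded by blast
  then have D: "\<And>y m. y \<in> set ys \<Longrightarrow> m \<in> Poly_Mapping.keys y \<Longrightarrow> total_deg m \<le> D"
    by (meson UN_I imageI less_imp_le)
  \<comment> \<open>With this \<open>s\<close> the dimension is at most ((D r + 1)(s + 1))^|F| = s
    (s + 1)^|F|, less than (s + 1)^(|F| + 1).\<close>
  define s where "s = (D * ?r + 1) ^ card F"
  define T where "T = {m \<in> exps F. total_deg m \<le> D * s * ?r}"
  have keys: "Poly_Mapping.keys (pow_list ys as) \<subseteq> T" if "as \<in> exp_box s ?r" for as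
    using total_deg_pow_list[OF D that] pow_list_mem[OF ys] by (auto simp: T_def mon_span_def)
  have "card T \<le> Suc (D * s * ?r) ^ card F"
    unfolding T_def by (rule card_bounded_exps[OF F])
  also have "\<dots> \<le> ((D * ?r + 1) * Suc s) ^ card F"
    by (rule power_mono) (auto simp: algebra_simps)
  also have "\<dots> = s * Suc s ^ card F" unfolding power_mult_distrib s_def ..
  also have "\<dots> < Suc s ^ Suc (card F)" by simp
  also have "\<dots> \<le> Suc s ^ ?r" using len by (intro power_increasing) auto
  finally have "card T < card (exp_box s ?r)" by (simp add: card_exp_box)
  moreover have "finite T" unfolding T_def by (rule card_bounded_exps[OF F])
  ultimately obtain c where c: "\<exists>as\<in>exp_box s ?r. c as \<noteq> 0"
    "\<forall>m\<in>T. (\<Sum>as\<in>exp_box s ?r. c as * Poly_Mapping.lookup (pow_list ys as) m) = 0"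
    using homogeneous_system_nontrivial[OF _ finite_exp_box, of T s ?r "\<lambda>as. Poly_Mapping.lookup (pow_list ys as)"] by blast
  have "(\<Sum>as\<in>exp_box s ?r. Poly_Mapping.single 0 (c as) * pow_list ys as) = 0"
  proof (rule poly_mapping_eqI)
    fix m
    have "Poly_Mapping.lookup (\<Sum>as\<in>exp_box s ?r. Poly_Mapping.single 0 (c as) * pow_list ys as) m =
        (\<Sum>as\<in>exp_box s ?r. c as * Poly_Mapping.lookup (pow_list ys as) m)"
      using lookup_single_mult[of 0 _ "_ :: ('v \<Rightarrow>\<^sub>0 nat) \<Rightarrow>\<^sub>0 'k" m] by (simp add: lookup_sum)
    also have "\<dots> = 0"
    proof (cases "m \<in> T")
      case False
      then have "Poly_Mapping.lookup (pow_list ys as) m = 0" if "as \<in> exp_box s ?r" for as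
        using keys[OF that] by (auto simp: in_keys_iff)
      then show ?thesis by simp
    qed (use c in blast)
    finally show "Poly_Mapping.lookup (\<Sum>as\<in>exp_box s ?r. Poly_Mapping.single 0 (c as) * pow_list ys as) m =
        Poly_Mapping.lookup 0 m" by simp
  qed
  with c(1) show ?thesis using that by blast
qed

section \<open>Prime ideals and the length of their chains\<close>

lemma primeideal_submod:
  assumes "primeideal P (mpoly_ring V :: (('v \<Rightarrow>\<^sub>0 nat) \<Rightarrow>\<^sub>0 'k::field) ring)"
  shows "mp.submod V P" "P \<subseteq> mon_span (exps V)" "1 \<notin> P"
    and "\<And>a b. a \<in> mon_span (exps V) \<Longrightarrow> b \<in> mon_span (exps V) \<Longrightarrow> a * b \<in> P \<Longrightarrow> a \<in> P \<or> b \<in> P"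
proof -
  interpret primeideal P "mpoly_ring V" by fact
  show *: "mp.submod V P" "P \<subseteq> mon_span (exps V)" using is_ideal ideal_mpoly_ring_iff by blast+
  show "1 \<notin> P"
  proof
    assume "1 \<in> P"
    then have "p \<in> P" if "p \<in> mon_span (exps V)" for p
      using mp.submod_mult[OF *(1) that, of 1] by simp
    then show False using I_notcarr * by (auto simp: carrier_mpoly_ring)
  qed
  show "a \<in> P \<or> b \<in> P" if "a \<in> mon_span (exps V)" "b \<in> mon_span (exps V)" "a * b \<in> P" for a b
    using I_prime[of a b] that by (simp add: carrier_mpoly_ring)
qed

lemma primeideal_mpolyI:
  assumes "mp.submod V P" "P \<subseteq> mon_span (exps V)" "1 \<notin> P"
    and "\<And>a b. a \<in> mon_span (exps V) \<Longrightarrow> b \<in> mon_span (exps V) \<Longrightarrow> a * b \<in> P \<Longrightarrow> a \<in> P \<or> b \<in> P"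
  shows "primeideal P (mpoly_ring V :: (('v \<Rightarrow>\<^sub>0 nat) \<Rightarrow>\<^sub>0 'k::field) ring)"
proof (rule primeidealI)
  show "ideal P (mpoly_ring V)" using assms by (simp add: ideal_mpoly_ring_iff)
  show "carrier (mpoly_ring V) \<noteq> P" using assms(3) mp.S_one by (auto simp: carrier_mpoly_ring)
qed (use assms(4) cring_mpoly_ring in \<open>auto simp: carrier_mpoly_ring\<close>)

text \<open>Elements \<open>y\<^sub>i \<in> P\<^sub>i\<^sub>+\<^sub>1 - P\<^sub>i\<close> along a chain of primes are algebraically independent:
  reducing a relation modulo \<open>P\<^sub>1\<close> kills all terms involving \<open>y\<^sub>0\<close>, and powers of \<open>y\<^sub>0\<close> can be
  cancelled modulo \<open>P\<^sub>0\<close>.\<close>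

lemma prime_chain_independent:
  fixes ys :: "(('v \<Rightarrow>\<^sub>0 nat) \<Rightarrow>\<^sub>0 'k::field) list"
  assumes "\<And>i. i \<le> length ys \<Longrightarrow> primeideal (P i) (mpoly_ring V)"
    and "\<And>i. i < length ys \<Longrightarrow> P i \<subseteq> P (Suc i)"
    and "\<And>i. i < length ys \<Longrightarrow> ys ! i \<in> P (Suc i) - P i"
    and "(\<Sum>as\<in>exp_box s (length ys). Poly_Mapping.single 0 (c as) * pow_list ys as) \<in> P 0"
    and "as \<in> exp_box s (length ys)"
  shows "c as = 0"
  using assms
proof (induction ys arbitrary: c P as)
  case Nil
  then have as: "as = []" and exp_box: "exp_box s 0 = {[]}" by (auto simp: exp_box_def)
  note P = primeideal_submod[OF Nil.prems(1)[of 0, simplified]]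
  show ?case
  proof (rule ccontr)
    assume c: "c as \<noteq> 0"
    \<comment> \<open>A nonzero constant in the prime would bring 1 into it.\<close>
    have "Poly_Mapping.single 0 (inverse (c as)) * Poly_Mapping.single 0 (c as) \<in> P 0"
      by (rule mp.submod_mult[OF P(1)]) (use Nil.prems(4) in \<open>auto simp: exp_box as mon_span_def exps_zero\<close>)
    then show False using c P(3) by (simp add: mult_single)
  qed
next
  case (Cons y ys)
  note P0 = primeideal_submod[OF Cons.prems(1)[of 0, simplified]]
  note P1 = primeideal_submod[OF Cons.prems(1)[of "Suc 0", simplified]]
  have y: "y \<in> P (Suc 0)" "y \<notin> P 0" using Cons.prems(3)[of 0] by auto
  have sub: "P 0 \<subseteq> P (Suc 0)" using Cons.prems(2)[of 0] by simp
  have yS: "y \<in> mon_span (exps V)" using y(1) P1(2) by blast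
  have ysS: "set ys \<subseteq> mon_span (exps V)"
  proof
    fix z assume "z \<in> set ys"
    then obtain i where "i < length ys" "z = ys ! i" by (metis in_set_conv_nth)
    then show "z \<in> mon_span (exps V)"
      using Cons.prems(3)[of "Suc i"] primeideal_submod(2)[OF Cons.prems(1)[of "Suc (Suc i)"]] by auto
  qed
  \<comment> \<open>The coefficient of \<open>y ^ a\<close> in the relation. By the induction
    hypothesis for the chain without its first prime, it is zero as soon as it lies in
    \<open>P (Suc 0)\<close>.\<close>
  define Q where "Q a = (\<Sum>as\<in>exp_box s (length ys). Poly_Mapping.single 0 (c (a # as)) * pow_list ys as)" for a
  have QS: "Q a \<in> mon_span (exps V)" for a
    unfolding Q_def
    by (intro mp.submod_sum[OF mp.submod_S] mp.S_mult pow_list_mem[OF ysS]) (auto simp: mon_span_def exps_zero)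
  have IH: "c (a # bs) = 0" if "Q a \<in> P (Suc 0)" "bs \<in> exp_box s (length ys)" for a bs
    by (rule Cons.IH[of "\<lambda>i. P (Suc i)" "\<lambda>bs. c (a # bs)"])
      (use Cons.prems(1-3)[of "Suc _"] that in \<open>auto simp: Q_def\<close>)
  have Q0: "Q a = 0" if "Q a \<in> P (Suc 0)" for a
    unfolding Q_def by (rule sum.neutral) (use IH[OF that] in simp)
  have "(\<Sum>a\<le>s. y ^ a * Q a) \<in> P 0"
    using Cons.prems(4) by (simp add: sum_exp_box_Suc Q_def sum_distrib_left mult_ac)
  \<comment> \<open>Lowest power first: modulo \<open>P (Suc 0)\<close> only \<open>R 0\<close> is
    left, so it is zero, and then \<open>y\<close> is cancelled modulo \<open>P 0\<close>. The third
    premise carries the outer induction hypothesis to the shifted coefficients.\<close>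
  moreover have "\<forall>a\<le>t. R a \<in> P (Suc 0)"
    if "(\<Sum>a\<le>t. y ^ a * R a) \<in> P 0" "\<forall>a. R a \<in> mon_span (exps V)" "\<forall>a. R a \<in> P (Suc 0) \<longrightarrow> R a = 0" for t R
    using that
  proof (induction t arbitrary: R)
    case 0
    then show ?case using sub by auto
  next
    case (Suc t)
    let ?s = "\<Sum>a\<le>t. y ^ a * R (Suc a)"
    have eq: "(\<Sum>a\<le>Suc t. y ^ a * R a) = R 0 + ?s * y"
      by (subst sum.atMost_Suc_shift) (simp add: sum_distrib_left sum_distrib_right mult_ac)
    have sS: "?s \<in> mon_span (exps V)"
      by (intro mp.submod_sum[OF mp.submod_S] mp.S_mult mp.S_power yS) (use Suc.prems(2) in auto)
    have "R 0 + ?s * y \<in> P (Suc 0)" using Suc.prems(1) sub unfolding eq by blast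
    from mp.submod_diff[OF P1(1) this mp.submod_mult[OF P1(1) sS y(1)]]
    have "R 0 \<in> P (Suc 0)" by simp
    then have R0: "R 0 = 0" using Suc.prems(3) by blast
    then have "?s * y \<in> P 0" using Suc.prems(1) unfolding eq by simp
    then have "?s \<in> P 0" using P0(4)[OF sS yS] y(2) by blast
    then have "\<forall>a\<le>t. R (Suc a) \<in> P (Suc 0)"
      by (intro Suc.IH) (use Suc.prems in auto)
    then show ?case using \<open>R 0 \<in> P (Suc 0)\<close> by (metis Suc_le_mono not0_implies_Suc)
  qed
  ultimately have "\<forall>a\<le>s. Q a \<in> P (Suc 0)" using QS Q0 by blast
  moreover obtain a bs where "as = a # bs" "a \<le> s" "bs \<in> exp_box s (length ys)"
    using Cons.prems(5) by (auto simp: exp_box_Suc)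
  ultimately show ?case using IH by blast
qed

text \<open>Variables in the first prime lie in all of them, so witnesses for the strict inclusions
  can be chosen in the other variables. A longer chain would give more independent witnesses than
  \<open>algebraically_dependent\<close> allows.\<close>

lemma prime_chain_length:
  fixes Ps :: "(('v \<Rightarrow>\<^sub>0 nat) \<Rightarrow>\<^sub>0 'k::field) set list"
  assumes V: "finite V" and Ps: "\<And>P. P \<in> set Ps \<Longrightarrow> primeideal P (mpoly_ring V)" "sorted_wrt (\<subset>) Ps" "Ps \<noteq> []"
  shows "length Ps - 1 \<le> card {v\<in>V. mpoly_var v \<notin> hd Ps}"
proof (rule ccontr)
  let ?F = "{v\<in>V. mpoly_var v \<notin> hd Ps}"
  assume "\<not> ?thesis"
  then have long: "Suc (card ?F) < length Ps" by simp
  let ?r = "Suc (card ?F)"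
  have F: "finite ?F" using V by simp
  note P0 = primeideal_submod[OF Ps(1)[OF hd_in_set[OF Ps(3)]]]
  have out: "mon_span {m \<in> exps V. \<not> Poly_Mapping.keys m \<subseteq> ?F} \<subseteq> hd Ps"
  proof
    fix p :: "('v \<Rightarrow>\<^sub>0 nat) \<Rightarrow>\<^sub>0 'k" assume p: "p \<in> mon_span {m \<in> exps V. \<not> Poly_Mapping.keys m \<subseteq> ?F}"
    show "p \<in> hd Ps"
    proof (rule sum_singles_induct)
      fix m assume "m \<in> Poly_Mapping.keys p"
      then obtain v where m: "m \<in> exps V" "v \<in> Poly_Mapping.keys m" "v \<notin> ?F" using p by (fastforce simp: mon_span_def)
      then have v: "mpoly_var v \<in> hd Ps" by (auto simp: exps_def)
      let ?b = "m - Poly_Mapping.single v 1"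
      have "m = ?b + Poly_Mapping.single v 1"
        by (rule poly_mapping_eqI) (use m in \<open>auto simp: lookup_add lookup_minus lookup_single when_def in_keys_iff\<close>)
      then have "Poly_Mapping.single m (Poly_Mapping.lookup p m) = Poly_Mapping.single ?b (Poly_Mapping.lookup p m) * mpoly_var v"
        by (simp add: mpoly_var_def mult_single)
      moreover have "Poly_Mapping.keys ?b \<subseteq> Poly_Mapping.keys m"
        by (auto simp: in_keys_iff lookup_minus)
      then have "Poly_Mapping.single ?b (Poly_Mapping.lookup p m) \<in> mon_span (exps V)"
        using m(1) by (auto simp: mon_span_def exps_def)
      ultimately show "Poly_Mapping.single m (Poly_Mapping.lookup p m) \<in> hd Ps"
        using mp.submod_mult[OF P0(1) _ v] by simp
    qed (use mp.submod_zero[OF P0(1)] mp.submod_add[OF P0(1)] in auto)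
  qed
  have mono: "Ps ! i \<subset> Ps ! j" if "i < j" "j < length Ps" for i j
    using sorted_wrt_nth_less[OF Ps(2) that] .
  have hd: "hd Ps \<subseteq> Ps ! i" if "i < length Ps" for i
    using mono[of 0 i] that Ps(3) by (cases i) (auto simp: hd_conv_nth)
  have ex: "\<exists>y. y \<in> mon_span (exps ?F) \<and> y \<in> Ps ! Suc i - Ps ! i" if i: "i < ?r" for i
  proof -
    have i': "i < length Ps" "Suc i < length Ps" using i long by auto
    obtain y where y: "y \<in> Ps ! Suc i" "y \<notin> Ps ! i" using mono[of i "Suc i"] i' by blast
    note Pi = primeideal_submod[OF Ps(1)[OF nth_mem[OF i'(1)]]]
    note Ps' = primeideal_submod[OF Ps(1)[OF nth_mem[OF i'(2)]]]
    let ?y = "restr_keys (exps ?F) y"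
    have yS: "y \<in> mon_span (exps V)" using y(1) Ps'(2) by blast
    have "y - ?y \<in> mon_span {m \<in> exps V. \<not> Poly_Mapping.keys m \<subseteq> ?F}"
      using yS by (auto simp: mon_span_def in_keys_iff lookup_minus lookup_restr_keys exps_def split: if_splits)
    then have d: "y - ?y \<in> hd Ps" using out by blast
    then have "y - ?y \<in> Ps ! Suc i" "y - ?y \<in> Ps ! i" using hd i' by blast+
    then have "?y \<in> Ps ! Suc i" "?y \<notin> Ps ! i"
      using mp.submod_diff[OF Ps'(1) y(1), of "y - ?y"] mp.submod_add[OF Pi(1), of "y - ?y" ?y] y(2) by auto
    then show ?thesis by (intro exI[of _ ?y]) (simp add: mon_span_def keys_restr_keys)
  qed
  have "\<forall>i. \<exists>y. i < ?r \<longrightarrow> y \<in> mon_span (exps ?F) \<and> y \<in> Ps ! Suc i - Ps ! i" using ex by blast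
  from choice[OF this] obtain y
    where y: "\<And>i. i < ?r \<Longrightarrow> y i \<in> mon_span (exps ?F) \<and> y i \<in> Ps ! Suc i - Ps ! i" by blast
  let ?ys = "map y [0..<?r]"
  have ys: "set ?ys \<subseteq> mon_span (exps ?F)" using y by auto
  have len: "card ?F < length ?ys" by simp
  obtain s c where c: "\<exists>as\<in>exp_box s (length ?ys). c as \<noteq> 0"
    "(\<Sum>as\<in>exp_box s (length ?ys). Poly_Mapping.single 0 (c as) * pow_list ?ys as) = 0"
    by (rule algebraically_dependent[OF F ys len])
  have "c as = 0" if "as \<in> exp_box s (length ?ys)" for as
  proof (rule prime_chain_independent[where P = "\<lambda>i. Ps ! i", OF _ _ _ _ that])
    show "primeideal (Ps ! i) (mpoly_ring V)" if "i \<le> length ?ys" for i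
      using that long by (intro Ps(1) nth_mem) simp
    show "Ps ! i \<subseteq> Ps ! Suc i" if "i < length ?ys" for i
      using mono[of i "Suc i"] that long by auto
    show "?ys ! i \<in> Ps ! Suc i - Ps ! i" if "i < length ?ys" for i
      using y that by (simp del: upt_Suc)
    show "(\<Sum>as\<in>exp_box s (length ?ys). Poly_Mapping.single 0 (c as) * pow_list ?ys as) \<in> Ps ! 0"
      using c(2) mp.submod_zero[OF P0(1)] Ps(3) by (simp add: hd_conv_nth del: upt_Suc)
  qed
  then show False using c(1) by blast
qed

text \<open>A chain in the quotient pulls back to a chain of primes above \<open>J\<close>, strict
  because the coset map is surjective; the first prime bounds its length.\<close>

lemma krull_dim_quotient_le:
  fixes J :: "(('v \<Rightarrow>\<^sub>0 nat) \<Rightarrow>\<^sub>0 'k::field) set"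
  assumes V: "finite V" and J: "ideal J (mpoly_ring V)"
    and le: "\<And>P. primeideal P (mpoly_ring V) \<Longrightarrow> J \<subseteq> P \<Longrightarrow> card {v\<in>V. mpoly_var v \<notin> P} \<le> k"
  shows "krull_dim (mpoly_ring V Quot J) \<le> ereal (real k)"
  unfolding krull_dim_def
proof (rule SUP_least)
  fix Qs assume "Qs \<in> {Ps. Ps \<noteq> [] \<and> (\<forall>P\<in>set Ps. primeideal P (mpoly_ring V Quot J)) \<and> sorted_wrt (\<subset>) Ps}"
  then have Qs: "Qs \<noteq> []" "\<And>Q. Q \<in> set Qs \<Longrightarrow> primeideal Q (mpoly_ring V Quot J)" "sorted_wrt (\<subset>) Qs" by auto
  interpret J: ideal J "mpoly_ring V" by (rule J)
  define pre where "pre Q = {r \<in> carrier (mpoly_ring V). mp_coset V J r \<in> Q}" for Q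
  have prime: "primeideal (pre Q) (mpoly_ring V)" if "Q \<in> set Qs" for Q
    unfolding pre_def
    using ring_hom_ring.primeideal_vimage[OF J.rcos_ring_hom_ring cring_mpoly_ring Qs(2)[OF that]] .
  have Jpre: "J \<subseteq> pre Q" if "Q \<in> set Qs" for Q
  proof
    fix r assume r: "r \<in> J"
    interpret Q: primeideal Q "mpoly_ring V Quot J" by (rule Qs(2)[OF that])
    have "r \<in> mon_span (exps V)" using r J by (auto simp: ideal_mpoly_ring_iff)
    then have "mp_coset V J r = \<zero>\<^bsub>mpoly_ring V Quot J\<^esub>"
      using mp_coset_eq_zero_iff[OF J] r by (simp add: quot_zero[OF J])
    then show "r \<in> pre Q"
      using \<open>r \<in> mon_span (exps V)\<close> additive_subgroup.zero_closed[OF Q.is_additive_subgroup]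
      by (simp add: pre_def carrier_mpoly_ring)
  qed
  have strict: "pre Q \<subset> pre Q'" if "Q \<in> set Qs" "Q' \<in> set Qs" "Q \<subset> Q'" for Q Q'
  proof -
    interpret Q': primeideal Q' "mpoly_ring V Quot J" by (rule Qs(2)[OF that(2)])
    obtain x where x: "x \<in> Q'" "x \<notin> Q" using \<open>Q \<subset> Q'\<close> by blast
    then obtain p where "p \<in> mon_span (exps V)" "x = mp_coset V J p"
      using Q'.a_subset quot_carrier[OF J] by blast
    then have "p \<in> pre Q'" "p \<notin> pre Q" using x by (auto simp: pre_def carrier_mpoly_ring)
    moreover have "pre Q \<subseteq> pre Q'" using that(3) by (auto simp: pre_def)
    ultimately show ?thesis by blast
  qed
  have "length (map pre Qs) - 1 \<le> card {v\<in>V. mpoly_var v \<notin> hd (map pre Qs)}"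
  proof (rule prime_chain_length[OF V])
    show "sorted_wrt (\<subset>) (map pre Qs)"
      unfolding sorted_wrt_map using Qs(3) strict by (rule_tac sorted_wrt_mono_rel) auto
  qed (use Qs(1) prime in auto)
  also have "\<dots> \<le> k"
    using le[of "pre (hd Qs)"] prime Jpre Qs(1) by (simp add: hd_map)
  finally show "ereal (real (length Qs - 1)) \<le> ereal (real k)" by simp
qed

text \<open>\<open>J \<subseteq> P\<close> makes \<open>P\<close> a union of cosets, so membership
  in the image can be decided on any representative.\<close>

lemma primeideal_image_quotient:
  fixes J :: "(('v \<Rightarrow>\<^sub>0 nat) \<Rightarrow>\<^sub>0 'k::field) set"
  assumes J: "ideal J (mpoly_ring V)" and P: "primeideal P (mpoly_ring V)" and JP: "J \<subseteq> P"
  shows "primeideal (mp_coset V J ` P) (mpoly_ring V Quot J)"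
    and "p \<in> mon_span (exps V) \<Longrightarrow> mp_coset V J p \<in> mp_coset V J ` P \<longleftrightarrow> p \<in> P"
proof -
  interpret R: cring "mpoly_ring V :: (('v \<Rightarrow>\<^sub>0 nat) \<Rightarrow>\<^sub>0 'k) ring" by (rule cring_mpoly_ring)
  interpret J: ideal J "mpoly_ring V" by (rule J)
  note P' = primeideal_submod[OF P]
  have mem: "mp_coset V J p \<in> mp_coset V J ` P \<longleftrightarrow> p \<in> P" if p: "p \<in> mon_span (exps V)" for p
  proof
    assume "mp_coset V J p \<in> mp_coset V J ` P"
    then obtain q where q: "q \<in> P" "mp_coset V J p = mp_coset V J q" by auto
    then have "p - q \<in> J" using mp_coset_eq_iff[OF J p] P'(2) by blast
    then have "p - q \<in> P" using JP by blast
    from mp.submod_add[OF P'(1) this q(1)] show "p \<in> P" by simp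
  qed auto
  then show "p \<in> mon_span (exps V) \<Longrightarrow> mp_coset V J p \<in> mp_coset V J ` P \<longleftrightarrow> p \<in> P" .
  show "primeideal (mp_coset V J ` P) (mpoly_ring V Quot J)"
  proof (rule primeidealI)
    show "ideal (mp_coset V J ` P) (mpoly_ring V Quot J)"
      using R.ring_ideal_imp_quot_ideal[OF J] P primeideal.axioms(1) by blast
    show "cring (mpoly_ring V Quot J)" by (rule J.quotient_is_cring[OF R.is_cring])
    show "carrier (mpoly_ring V Quot J) \<noteq> mp_coset V J ` P"
      using mem[OF mp.S_one] P'(3) mp.S_one[of V] by (auto simp: quot_carrier[OF J])
  next
    fix a b assume "a \<in> carrier (mpoly_ring V Quot J)" "b \<in> carrier (mpoly_ring V Quot J)"
      and ab: "a \<otimes>\<^bsub>mpoly_ring V Quot J\<^esub> b \<in> mp_coset V J ` P"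
    then obtain p q where pq: "p \<in> mon_span (exps V)" "q \<in> mon_span (exps V)" "a = mp_coset V J p" "b = mp_coset V J q"
      by (auto simp: quot_carrier[OF J])
    then have "p * q \<in> P" using ab mem[OF mp.S_mult[OF pq(1,2)]] by (simp add: quot_mult[OF J])
    then show "a \<in> mp_coset V J ` P \<or> b \<in> mp_coset V J ` P" using P'(4)[OF pq(1,2)] pq by blast
  qed
qed

text \<open>The ideal generated by the variables outside \<open>F\<close>, the kernel of the map
  that sets them to zero.\<close>

definition face_prime :: "'v set \<Rightarrow> 'v set \<Rightarrow> (('v \<Rightarrow>\<^sub>0 nat) \<Rightarrow>\<^sub>0 'k::field) set" where
  "face_prime V F = mon_span {m \<in> exps V. \<not> Poly_Mapping.keys m \<subseteq> F}"

text \<open>Restriction to the monomials in \<open>F\<close> is multiplicative modulo this ideal,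
  and the polynomials form a domain. The latter comes from the linear order on the variables, which
  orders the monomials.\<close>

lemma primeideal_face_prime:
  fixes V F :: "'v::linorder set"
  shows "primeideal (face_prime V F) (mpoly_ring V :: (('v \<Rightarrow>\<^sub>0 nat) \<Rightarrow>\<^sub>0 'k::field) ring)"
proof (rule primeideal_mpolyI)
  let ?P = "face_prime V F :: (('v \<Rightarrow>\<^sub>0 nat) \<Rightarrow>\<^sub>0 'k) set"
  show sm: "mp.submod V ?P"
    unfolding face_prime_def by (rule submod_mon_span) (auto simp: exps_add keys_add_nat)
  show "?P \<subseteq> mon_span (exps V)" unfolding face_prime_def by (rule mon_span_mono) auto
  show "1 \<notin> ?P" by (simp add: face_prime_def mon_span_def)
  fix a b :: "('v \<Rightarrow>\<^sub>0 nat) \<Rightarrow>\<^sub>0 'k"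
  assume ab: "a \<in> mon_span (exps V)" "b \<in> mon_span (exps V)" "a * b \<in> ?P"
  let ?r = "restr_keys (exps F) :: (('v \<Rightarrow>\<^sub>0 nat) \<Rightarrow>\<^sub>0 'k) \<Rightarrow> _"
  have d: "p - ?r p \<in> ?P" if "p \<in> mon_span (exps V)" for p
    using that by (auto simp: face_prime_def mon_span_def in_keys_iff lookup_minus lookup_restr_keys exps_def split: if_splits)
  have r: "?r p \<in> mon_span (exps V)" if "p \<in> mon_span (exps V)" for p
    using that by (auto simp: mon_span_def keys_restr_keys)
  have "a * b - ?r a * ?r b = b * (a - ?r a) + ?r a * (b - ?r b)" by (simp add: algebra_simps)
  also have "\<dots> \<in> ?P"
    using d r ab by (intro mp.submod_add[OF sm] mp.submod_mult[OF sm])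
  finally have "?r a * ?r b \<in> ?P" using mp.submod_diff[OF sm ab(3)] by fastforce
  moreover have "?r a * ?r b \<in> mon_span (exps F)"
    by (rule mp.S_mult) (auto simp: mon_span_def keys_restr_keys)
  ultimately have "?r a * ?r b = 0"
    by (fastforce simp: face_prime_def mon_span_def exps_def simp flip: keys_eq_empty)
  then have "?r a = 0 \<or> ?r b = 0" by simp
  then show "a \<in> ?P \<or> b \<in> ?P" using d[OF ab(1)] d[OF ab(2)] by auto
qed

text \<open>Deleting the vertices of \<open>G\<close> one after another gives a strict chain of
  \<open>card G + 1\<close> primes \<open>face_prime\<close> above \<open>J\<close>.\<close>

lemma krull_dim_quotient_ge:
  fixes V G :: "'v::linorder set" and J :: "(('v \<Rightarrow>\<^sub>0 nat) \<Rightarrow>\<^sub>0 'k::field) set"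
  assumes V: "finite V" and G: "G \<subseteq> V" and J: "ideal J (mpoly_ring V)" and JG: "J \<subseteq> face_prime V G"
  shows "ereal (real (card G)) \<le> krull_dim (mpoly_ring V Quot J)"
proof -
  obtain vs where vs: "set vs = G" "distinct vs" using finite_distinct_list[OF finite_subset[OF G V]] by blast
  define Q where "Q i = mp_coset V J ` face_prime V (set (drop i vs))" for i
  have mono: "face_prime V A \<subseteq> (face_prime V B :: (('v \<Rightarrow>\<^sub>0 nat) \<Rightarrow>\<^sub>0 'k) set)" if "B \<subseteq> A" for A B
    unfolding face_prime_def by (rule mon_span_mono) (use that in auto)
  have JQ: "J \<subseteq> face_prime V (set (drop i vs))" for i
    using JG mono[of "set (drop i vs)" G] set_drop_subset[of i vs] vs(1) by blast
  have "Q i \<subset> Q j" if "i < j" "j \<le> length vs" for i j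
  proof -
    have sub: "Q i \<subseteq> Q j"
      unfolding Q_def using set_drop_subset_set_drop[of i j vs] that by (intro image_mono mono) simp
    have v: "vs ! i \<in> V" using that vs(1) G nth_mem[of i vs] by auto
    have "i < length vs" using that by simp
    then have i: "vs ! i \<in> set (drop i vs)" by (metis Cons_nth_drop_Suc list.set_intros(1))
    have nj: "vs ! i \<notin> set (drop j vs)"
    proof
      assume "vs ! i \<in> set (drop j vs)"
      then have "vs ! i \<in> set (drop (Suc i) vs)" using set_drop_subset_set_drop[of "Suc i" j vs] that by auto
      then show False
        using \<open>i < length vs\<close> vs(2) by (metis Cons_nth_drop_Suc distinct.simps(2) distinct_drop)
    qed
    have "(mpoly_var (vs ! i) :: ('v \<Rightarrow>\<^sub>0 nat) \<Rightarrow>\<^sub>0 'k) \<in> face_prime V (set (drop j vs))"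
      "(mpoly_var (vs ! i) :: ('v \<Rightarrow>\<^sub>0 nat) \<Rightarrow>\<^sub>0 'k) \<notin> face_prime V (set (drop i vs))"
      using v i nj by (auto simp: face_prime_def mon_span_def mpoly_var_def exps_def)
    then have "mp_coset V J (mpoly_var (vs ! i)) \<in> Q j" "mp_coset V J (mpoly_var (vs ! i)) \<notin> Q i"
      unfolding Q_def using primeideal_image_quotient(2)[OF J primeideal_face_prime JQ mpoly_var_mem[OF v]] by auto
    then show ?thesis using sub by blast
  qed
  then have "sorted_wrt (\<subset>) (map Q [0..<Suc (length vs)])"
    unfolding sorted_wrt_iff_nth_less by (simp del: upt_Suc)
  moreover have "primeideal (Q i) (mpoly_ring V Quot J)" for i
    unfolding Q_def by (rule primeideal_image_quotient(1)[OF J primeideal_face_prime JQ])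
  ultimately have "map Q [0..<Suc (length vs)] \<in>
      {Ps. Ps \<noteq> [] \<and> (\<forall>P\<in>set Ps. primeideal P (mpoly_ring V Quot J)) \<and> sorted_wrt (\<subset>) Ps}"
    by (simp del: upt_Suc)
  then have "ereal (real (length (map Q [0..<Suc (length vs)]) - 1)) \<le> krull_dim (mpoly_ring V Quot J)"
    unfolding krull_dim_def by (rule SUP_upper)
  then show ?thesis using distinct_card[OF vs(2)] vs(1) by simp
qed

section \<open>Depth and initial dimension\<close>

lemma ideal_nf:
  assumes "simplicial_complex_on V \<Delta>"
  shows "ideal (mon_span (nf_exps V \<Delta>) :: (('v \<Rightarrow>\<^sub>0 nat) \<Rightarrow>\<^sub>0 'k::field) set) (mpoly_ring V)"
  unfolding ideal_mpoly_ring_iff using submod_nf[OF assms] mon_span_mono[OF nf_exps_subset] by blast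

lemma SR_module_eq:
  assumes "finite V" "simplicial_complex_on V \<Delta>"
  shows "SR_module V \<Delta> = quotient_module (mpoly_ring V) (mon_span (nf_exps V \<Delta>) :: (('v \<Rightarrow>\<^sub>0 nat) \<Rightarrow>\<^sub>0 'k::field) set)"
  by (simp add: SR_module_def SR_ideal_eq[OF assms])

lemma simplicial_empty_mem: "simplicial_complex_on V \<Delta> \<Longrightarrow> \<Delta> \<noteq> {} \<Longrightarrow> {} \<in> \<Delta>"
  using simplicial_subset by (metis all_not_in_conv empty_subsetI)

lemma SR_module_trivial_iff:
  assumes "finite V" "simplicial_complex_on V \<Delta>"
  shows "carrier (SR_module V \<Delta> :: (('v \<Rightarrow>\<^sub>0 nat) \<Rightarrow>\<^sub>0 'k::field, _) module) = {\<zero>\<^bsub>SR_module V \<Delta> :: (('v \<Rightarrow>\<^sub>0 nat) \<Rightarrow>\<^sub>0 'k, _) module\<^esub>}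
    \<longleftrightarrow> \<Delta> = {}"
proof -
  have "(1 :: ('v \<Rightarrow>\<^sub>0 nat) \<Rightarrow>\<^sub>0 'k) \<in> mon_span (nf_exps V \<Delta>) \<longleftrightarrow> {} \<notin> \<Delta>"
    by (simp add: mon_span_def nf_exps_def exps_zero)
  then show ?thesis
    unfolding SR_module_eq[OF assms] quotient_module_trivial_iff[OF ideal_nf[OF assms(2)]]
    using simplicial_empty_mem[OF assms(2)] by auto
qed

text \<open>If \<open>m\<close> is not attained, all lengths are at most \<open>m - 1\<close>.
  Subtraction in the reals also covers \<open>m = 0\<close>, where \<open>A\<close> is then
  empty.\<close>

lemma SUP_length_eq_iff:
  assumes "\<And>rs. rs \<in> A \<Longrightarrow> length rs \<le> m"
  shows "(SUP rs\<in>A. ereal (real (length rs))) = ereal (real m) \<longleftrightarrow> (\<exists>rs\<in>A. length rs = m)"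
proof
  assume sup: "(SUP rs\<in>A. ereal (real (length rs))) = ereal (real m)"
  show "\<exists>rs\<in>A. length rs = m"
  proof (rule ccontr)
    assume "\<not> ?thesis"
    then have "Suc (length rs) \<le> m" if "rs \<in> A" for rs
      using assms[OF that] that by (metis Suc_leI le_neq_implies_less)
    then have "(SUP rs\<in>A. ereal (real (length rs))) \<le> ereal (real m - 1)"
      by (intro SUP_least) fastforce
    then show False unfolding sup by simp
  qed
next
  assume "\<exists>rs\<in>A. length rs = m"
  then obtain rs where "rs \<in> A" "length rs = m" by blast
  then have "ereal (real m) \<le> (SUP rs\<in>A. ereal (real (length rs)))" by (metis (mono_tags, lifting) SUP_upper)
  moreover have "(SUP rs\<in>A. ereal (real (length rs))) \<le> ereal (real m)" using assms by (intro SUP_least) simp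
  ultimately show "(SUP rs\<in>A. ereal (real (length rs))) = ereal (real m)" by (rule antisym[rotated])
qed

lemma regular_sequence_koszul_vanish:
  fixes rs ys :: "(('v \<Rightarrow>\<^sub>0 nat) \<Rightarrow>\<^sub>0 'k::field) list"
  assumes V: "finite V" and \<Delta>: "simplicial_complex_on V \<Delta>"
    and reg: "regular_sequence (mpoly_ring V) (SR_module V \<Delta>) rs" and rs: "set rs \<subseteq> irrelevant_ideal V"
    and ys: "esym V ` {1..card V} \<subseteq> set ys" "set ys \<subseteq> mon_span (exps V)"
  shows "koszul_vanish ys (length rs) (mon_span (exps V)) (mon_span (nf_exps V \<Delta>))"
proof -
  note reg' = reg[unfolded SR_module_eq[OF V \<Delta>] regular_sequence_quotient_iff[OF ideal_nf[OF \<Delta>]]]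
  show ?thesis
  proof (rule mp.regular_imp_koszul_vanish[OF mp.submod_S submod_nf[OF \<Delta>] mon_span_mono[OF nf_exps_subset] ys(2)])
    show "set rs \<subseteq> mon_span (exps V)" using reg' by blast
    show "\<exists>k. f ^ k \<in> lin_combs (mon_span (exps V)) ys" if "f \<in> set rs" for f
      using power_lin_combs_esym[OF V ys] rs that unfolding irrelevant_ideal_eq by blast
  qed (use reg' in blast)
qed

text \<open>Besides regularity the quotient has to be nonzero: \<open>\<Delta>\<close> is not void,
  so I_\<Delta> and all e_j with j > 0 lie in the irrelevant ideal, which does not contain
  1.\<close>

lemma koszul_vanish_regular_sequence:
  fixes V :: "'v set"
  assumes V: "finite V" and \<Delta>: "simplicial_complex_on V \<Delta>" "\<Delta> \<noteq> {}"
    and van: "koszul_vanish (rev (esyms V m)) m (mon_span (exps V))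
      (mon_span (nf_exps V \<Delta>) :: (('v \<Rightarrow>\<^sub>0 nat) \<Rightarrow>\<^sub>0 'k::field) set)"
  shows "regular_sequence (mpoly_ring V) (SR_module V \<Delta>) (esyms V m :: (('v \<Rightarrow>\<^sub>0 nat) \<Rightarrow>\<^sub>0 'k) list)"
    and "set (esyms V m :: (('v \<Rightarrow>\<^sub>0 nat) \<Rightarrow>\<^sub>0 'k) list) \<subseteq> irrelevant_ideal V"
proof -
  let ?S = "mon_span (exps V) :: (('v \<Rightarrow>\<^sub>0 nat) \<Rightarrow>\<^sub>0 'k) set" and ?I = "mon_span (nf_exps V \<Delta>) :: (('v \<Rightarrow>\<^sub>0 nat) \<Rightarrow>\<^sub>0 'k) set"
  let ?M = "mon_span (exps V - {0}) :: (('v \<Rightarrow>\<^sub>0 nat) \<Rightarrow>\<^sub>0 'k) set"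
  have sM: "mp.submod V ?M"
    by (rule submod_mon_span) (auto simp: exps_add poly_mapping_eq_iff fun_eq_iff lookup_add)
  have es: "esym V j \<in> ?M" if "1 \<le> j" for j
  proof -
    have "homogeneous j (esym V j :: ('v \<Rightarrow>\<^sub>0 nat) \<Rightarrow>\<^sub>0 'k)" by (rule homogeneous_esym[OF V])
    then have "0 \<notin> Poly_Mapping.keys (esym V j :: ('v \<Rightarrow>\<^sub>0 nat) \<Rightarrow>\<^sub>0 'k)"
      using that by (force simp: homogeneous_def)
    moreover have "(esym V j :: ('v \<Rightarrow>\<^sub>0 nat) \<Rightarrow>\<^sub>0 'k) \<in> mon_span (exps V)" by (rule esym_mem[OF V])
    ultimately show ?thesis by (auto simp: mon_span_def)
  qed
  then show M: "set (esyms V m :: (('v \<Rightarrow>\<^sub>0 nat) \<Rightarrow>\<^sub>0 'k) list) \<subseteq> irrelevant_ideal V"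
    by (auto simp: set_esyms irrelevant_ideal_eq)
  have "lin_combs ?S (rev (esyms V m)) \<subseteq> ?M"
  proof (rule mp.lin_combs_subset[OF sM])
    fix y a :: "('v \<Rightarrow>\<^sub>0 nat) \<Rightarrow>\<^sub>0 'k" assume "y \<in> set (rev (esyms V m))" "a \<in> ?S"
    then show "y * a \<in> ?M"
      using mp.submod_mult[OF sM, of a y] M by (auto simp: irrelevant_ideal_eq mult.commute)
  qed
  moreover have "?I \<subseteq> ?M"
    using simplicial_empty_mem[OF \<Delta>] by (intro mon_span_mono) (auto simp: nf_exps_def)
  ultimately have "submod_plus ?S ?I (rev (esyms V m)) \<subseteq> ?M"
    unfolding submod_plus_def using mp.submod_add[OF sM] by blast
  moreover have "1 \<notin> ?M" by (simp add: mon_span_def)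
  ultimately have proper: "\<not> ?S \<subseteq> submod_plus ?S ?I (rev (esyms V m))" using mp.S_one by blast
  have "x \<in> submod_plus ?S ?I (rev (take i (esyms V m)))"
    if "i < m" "x \<in> ?S" "esyms V m ! i * x \<in> submod_plus ?S ?I (rev (take i (esyms V m)))" for i x
  proof -
    have "take i (esyms V m) = (esyms V i :: (('v \<Rightarrow>\<^sub>0 nat) \<Rightarrow>\<^sub>0 'k) list)" using that(1) by (simp add: take_esyms)
    then show ?thesis
      using koszul_vanish_esyms_regular[OF V mp.submod_S submod_nf[OF \<Delta>(1)] nf_exps_subset van that(1,2)] that
      by (simp add: nth_esyms)
  qed
  then show "regular_sequence (mpoly_ring V) (SR_module V \<Delta>) (esyms V m :: (('v \<Rightarrow>\<^sub>0 nat) \<Rightarrow>\<^sub>0 'k) list)"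
    unfolding SR_module_eq[OF V \<Delta>(1)] regular_sequence_quotient_iff[OF ideal_nf[OF \<Delta>(1)]]
    using esyms_mem[OF V] proper by simp
qed

text \<open>A facet bounds the depth, so depth \<open>card F\<close> means that a regular sequence
  of this length exists. The two parts are not converse to each other: one yields vanishing for all
  e_j, the other asks for it for e_1, ..., e_|F|. Passing to or from the skeleton closes this
  gap.\<close>

lemma depth_SR_module:
  fixes V :: "'v set" and \<Delta> :: "'v set set"
  assumes V: "finite V" and \<Delta>: "simplicial_complex_on V \<Delta>" and F: "F \<in> \<Delta>"
    and facet: "\<And>G. G \<in> \<Delta> \<Longrightarrow> F \<subseteq> G \<Longrightarrow> G = F"
  defines "d \<equiv> depth (mpoly_ring V) (irrelevant_ideal V) (SR_module V \<Delta> :: (('v \<Rightarrow>\<^sub>0 nat) \<Rightarrow>\<^sub>0 'k::field, _) module)"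
  shows "d = ereal (real (card F)) \<Longrightarrow> koszul_vanish (rev (esyms V (card V))) (card F) (mon_span (exps V))
      (mon_span (nf_exps V \<Delta>) :: (('v \<Rightarrow>\<^sub>0 nat) \<Rightarrow>\<^sub>0 'k) set)"
    and "koszul_vanish (rev (esyms V (card F))) (card F) (mon_span (exps V))
      (mon_span (nf_exps V \<Delta>) :: (('v \<Rightarrow>\<^sub>0 nat) \<Rightarrow>\<^sub>0 'k) set) \<Longrightarrow> d = ereal (real (card F))"
proof -
  let ?R = "{rs. set rs \<subseteq> irrelevant_ideal V \<and>
    regular_sequence (mpoly_ring V) (SR_module V \<Delta> :: (('v \<Rightarrow>\<^sub>0 nat) \<Rightarrow>\<^sub>0 'k, _) module) rs}"
  \<comment> \<open>The unreversed list serves \<open>koszul_vanish_facet_bound\<close>, the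
    reversed one the first claim.\<close>
  have van: "koszul_vanish ys (length rs) (mon_span (exps V)) (mon_span (nf_exps V \<Delta>))"
    if "rs \<in> ?R" "ys = esyms V (card V) \<or> ys = rev (esyms V (card V))"
    for rs ys :: "(('v \<Rightarrow>\<^sub>0 nat) \<Rightarrow>\<^sub>0 'k) list"
    by (rule regular_sequence_koszul_vanish[OF V \<Delta>])
      (use that in \<open>auto simp: set_esyms esym_mem[OF V]\<close>)
  have le: "length rs \<le> card F" if "rs \<in> ?R" for rs
    using koszul_vanish_facet_bound[OF V \<Delta> F facet] van[OF that] by blast
  have d: "d = ereal (real (card F)) \<longleftrightarrow> (\<exists>rs\<in>?R. length rs = card F)"
    unfolding d_def depth_def by (rule SUP_length_eq_iff[OF le])
  show "koszul_vanish (rev (esyms V (card V))) (card F) (mon_span (exps V))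
      (mon_span (nf_exps V \<Delta>) :: (('v \<Rightarrow>\<^sub>0 nat) \<Rightarrow>\<^sub>0 'k) set)" if dF: "d = ereal (real (card F))"
  proof -
    obtain rs where rs: "rs \<in> ?R" "length rs = card F" using dF unfolding d by blast
    from van[OF rs(1) disjI2[OF refl]] show ?thesis unfolding rs(2) .
  qed
  show "d = ereal (real (card F))" if "koszul_vanish (rev (esyms V (card F))) (card F) (mon_span (exps V))
      (mon_span (nf_exps V \<Delta>) :: (('v \<Rightarrow>\<^sub>0 nat) \<Rightarrow>\<^sub>0 'k) set)"
  proof -
    have "\<Delta> \<noteq> {}" using F by blast
    note * = koszul_vanish_regular_sequence[OF V \<Delta> this that]
    show ?thesis unfolding d by (rule bexI[of _ "esyms V (card F)"]) (simp_all add: *)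
  qed
qed

lemma nf_subset_face_prime: "F \<in> \<Delta> \<Longrightarrow> simplicial_complex_on V \<Delta> \<Longrightarrow> mon_span (nf_exps V \<Delta>) \<subseteq> face_prime V F"
  unfolding face_prime_def using simplicial_subset
  by (intro mon_span_mono) (auto simp: nf_exps_def)

text \<open>Otherwise the product of the variables outside \<open>P\<close> lies in I_\<Delta>,
  hence in \<open>P\<close>, against primality.\<close>

lemma face_of_prime:
  fixes P :: "(('v \<Rightarrow>\<^sub>0 nat) \<Rightarrow>\<^sub>0 'k::field) set"
  assumes V: "finite V" and P: "primeideal P (mpoly_ring V)" and sub: "mon_span (nf_exps V \<Delta>) \<subseteq> P"
  shows "{v\<in>V. mpoly_var v \<notin> P} \<in> \<Delta>"
proof (rule ccontr)
  let ?F = "{v\<in>V. mpoly_var v \<notin> P}"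
  note P' = primeideal_submod[OF P]
  assume "?F \<notin> \<Delta>"
  then have "Poly_Mapping.single (ind_exp ?F) 1 \<in> (mon_span (nf_exps V \<Delta>) :: (('v \<Rightarrow>\<^sub>0 nat) \<Rightarrow>\<^sub>0 'k) set)"
    using V by (simp add: mon_span_def nf_exps_def exps_def keys_ind_exp)
  then have "(\<Prod>v\<in>?F. mpoly_var v) \<in> P" using sub by (auto simp: prod_mpoly_var)
  moreover have "(\<Prod>v\<in>A. mpoly_var v) \<notin> P \<and> (\<Prod>v\<in>A. mpoly_var v :: ('v \<Rightarrow>\<^sub>0 nat) \<Rightarrow>\<^sub>0 'k) \<in> mon_span (exps V)"
    if "finite A" "A \<subseteq> ?F" for A
    using that
  proof (induction A)
    case empty
    then show ?case using P'(3) mp.S_one by simp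
  next
    case (insert v A)
    then have v: "v \<in> V" "mpoly_var v \<notin> P" by auto
    have x: "(mpoly_var v :: ('v \<Rightarrow>\<^sub>0 nat) \<Rightarrow>\<^sub>0 'k) \<in> mon_span (exps V)" by (rule mpoly_var_mem[OF v(1)])
    have IH: "(\<Prod>v\<in>A. mpoly_var v) \<notin> P" "(\<Prod>v\<in>A. mpoly_var v :: ('v \<Rightarrow>\<^sub>0 nat) \<Rightarrow>\<^sub>0 'k) \<in> mon_span (exps V)"
      using insert by auto
    show ?case
      using P'(4)[OF x IH(2)] mp.S_mult[OF x IH(2)] IH(1) v(2) insert.hyps by auto
  qed
  ultimately show False using V by auto
qed

text \<open>The prime of \<open>F\<close> is the annihilator of x_F, which gives one inequality. For
  the other, let P be the annihilator of f. The support of some monomial of f is a face, contained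
  in a face G with at least |F| vertices; as P f lies in the prime of G and f does not, P lies in
  it.\<close>

lemma indim_SR_module:
  fixes V :: "'v::linorder set" and \<Delta> :: "'v set set"
  assumes V: "finite V" and \<Delta>: "simplicial_complex_on V \<Delta>" and F: "F \<in> \<Delta>"
    and facet: "\<And>G. G \<in> \<Delta> \<Longrightarrow> F \<subseteq> G \<Longrightarrow> G = F"
    and min: "\<And>G. G \<in> \<Delta> \<Longrightarrow> \<exists>H\<in>\<Delta>. G \<subseteq> H \<and> card F \<le> card H"
  shows "indim (mpoly_ring V) (SR_module V \<Delta> :: (('v \<Rightarrow>\<^sub>0 nat) \<Rightarrow>\<^sub>0 'k::field, _) module) = ereal (real (card F))"
proof (rule antisym)
  let ?I = "mon_span (nf_exps V \<Delta>) :: (('v \<Rightarrow>\<^sub>0 nat) \<Rightarrow>\<^sub>0 'k) set"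
  let ?M = "quotient_module (mpoly_ring V) ?I"
  have FV: "F \<subseteq> V" "finite F" using simplicial_vertices[OF \<Delta> F] V finite_subset by auto
  have ass: "face_prime V F \<in> associated_primes (mpoly_ring V) ?M"
  proof -
    let ?x = "Poly_Mapping.single (ind_exp F) 1 :: ('v \<Rightarrow>\<^sub>0 nat) \<Rightarrow>\<^sub>0 'k"
    have x: "?x \<in> mon_span (exps V)" using FV by (auto simp: mon_span_def exps_def keys_ind_exp)
    have "m \<in> exps V \<Longrightarrow> ind_exp F + m \<in> nf_exps V \<Delta> \<longleftrightarrow> \<not> Poly_Mapping.keys m \<subseteq> F" for m
      using facet[of "F \<union> Poly_Mapping.keys m"] F FV
      by (auto simp: nf_exps_def exps_def keys_add_nat keys_ind_exp Un_absorb2)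
    then have "elem_annihilator (mpoly_ring V) ?M (mp_coset V ?I ?x) = face_prime V F"
      unfolding elem_annihilator_quotient[OF ideal_nf[OF \<Delta>] x]
      by (auto simp: face_prime_def mon_span_def keys_single_mult mult.commute[of _ ?x] subset_iff)
    moreover have "mp_coset V ?I ?x \<in> carrier ?M"
      using x by (simp add: quotient_module_simps quot_carrier[OF ideal_nf[OF \<Delta>]])
    ultimately show ?thesis
      unfolding associated_primes_def using primeideal_face_prime by blast
  qed
  have "krull_dim (mpoly_ring V Quot face_prime V F :: (('v \<Rightarrow>\<^sub>0 nat) \<Rightarrow>\<^sub>0 'k) set ring) \<le> ereal (real (card F))"
  proof (rule krull_dim_quotient_le[OF V primeideal.axioms(1)[OF primeideal_face_prime]])
    fix P :: "(('v \<Rightarrow>\<^sub>0 nat) \<Rightarrow>\<^sub>0 'k) set"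
    assume "primeideal P (mpoly_ring V)" and sub: "face_prime V F \<subseteq> P"
    have "(mpoly_var v :: ('v \<Rightarrow>\<^sub>0 nat) \<Rightarrow>\<^sub>0 'k) \<in> face_prime V F" if "v \<in> V" "v \<notin> F" for v
      using that by (auto simp: face_prime_def mon_span_def mpoly_var_def exps_def)
    then have "{v\<in>V. mpoly_var v \<notin> P} \<subseteq> F" using sub by blast
    then show "card {v\<in>V. mpoly_var v \<notin> P} \<le> card F" by (rule card_mono[OF FV(2)])
  qed
  then show "indim (mpoly_ring V) (SR_module V \<Delta> :: (('v \<Rightarrow>\<^sub>0 nat) \<Rightarrow>\<^sub>0 'k, _) module) \<le> ereal (real (card F))"
    unfolding indim_def SR_module_eq[OF V \<Delta>] by (rule INF_lower2[OF ass])
  show "ereal (real (card F)) \<le> indim (mpoly_ring V) (SR_module V \<Delta> :: (('v \<Rightarrow>\<^sub>0 nat) \<Rightarrow>\<^sub>0 'k, _) module)"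
    unfolding indim_def SR_module_eq[OF V \<Delta>]
  proof (rule INF_greatest)
    fix P assume "P \<in> associated_primes (mpoly_ring V) ?M"
    then obtain x where P: "primeideal P (mpoly_ring V)" "x \<in> carrier ?M" "P = elem_annihilator (mpoly_ring V) ?M x"
      by (auto simp: associated_primes_def)
    then obtain f where f: "f \<in> mon_span (exps V)" "x = mp_coset V ?I f"
      by (auto simp: quotient_module_simps quot_carrier[OF ideal_nf[OF \<Delta>]])
    have P_eq: "P = {r \<in> mon_span (exps V). r * f \<in> ?I}"
      unfolding P(3) f(2) by (rule elem_annihilator_quotient[OF ideal_nf[OF \<Delta>] f(1)])
    have "f \<notin> ?I" using primeideal_submod(3)[OF P(1)] mp.S_one unfolding P_eq by auto
    then obtain m where m: "m \<in> Poly_Mapping.keys f" "Poly_Mapping.keys m \<in> \<Delta>"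
      using f(1) by (auto simp: mon_span_def nf_exps_def)
    then obtain G where G: "G \<in> \<Delta>" "Poly_Mapping.keys m \<subseteq> G" "card F \<le> card G" using min by blast
    have fG: "f \<notin> face_prime V G" using m G by (auto simp: face_prime_def mon_span_def)
    have "P \<subseteq> face_prime V G"
    proof
      fix r assume r: "r \<in> P"
      then have "r * f \<in> face_prime V G" using nf_subset_face_prime[OF G(1) \<Delta>] unfolding P_eq by blast
      then show "r \<in> face_prime V G"
        using primeideal_submod(4)[OF primeideal_face_prime[of V G, where 'k='k], of r f] fG r f(1) unfolding P_eq by blast
    qed
    then have "ereal (real (card G)) \<le> krull_dim (mpoly_ring V Quot P)"
      by (rule krull_dim_quotient_ge[OF V simplicial_vertices[OF \<Delta> G(1)] primeideal.axioms(1)[OF P(1)]])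
    then show "ereal (real (card F)) \<le> krull_dim (mpoly_ring V Quot P)"
      using G(3) by (meson ereal_less_eq(3) of_nat_le_iff order_trans)
  qed
qed

text \<open>Above, the variables outside a prime containing I_\<Delta> form a face by
  \<open>face_of_prime\<close>; below, a largest face supplies a chain.\<close>

lemma module_dim_SR_module:
  fixes V :: "'v::linorder set" and \<Delta> :: "'v set set"
  assumes V: "finite V" and \<Delta>: "simplicial_complex_on V \<Delta>" and F: "F \<in> \<Delta>"
    and max: "\<And>G. G \<in> \<Delta> \<Longrightarrow> card G \<le> card F"
  shows "module_dim (mpoly_ring V) (SR_module V \<Delta> :: (('v \<Rightarrow>\<^sub>0 nat) \<Rightarrow>\<^sub>0 'k::field, _) module) = ereal (real (card F))"
  unfolding module_dim_def SR_module_eq[OF V \<Delta>] annihilator_quotient[OF ideal_nf[OF \<Delta>]]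
proof (rule antisym)
  show "krull_dim (mpoly_ring V Quot (mon_span (nf_exps V \<Delta>) :: (('v \<Rightarrow>\<^sub>0 nat) \<Rightarrow>\<^sub>0 'k) set)) \<le> ereal (real (card F))"
    by (rule krull_dim_quotient_le[OF V ideal_nf[OF \<Delta>]]) (intro max face_of_prime[OF V])
  show "ereal (real (card F)) \<le> krull_dim (mpoly_ring V Quot (mon_span (nf_exps V \<Delta>) :: (('v \<Rightarrow>\<^sub>0 nat) \<Rightarrow>\<^sub>0 'k) set))"
    by (rule krull_dim_quotient_ge[OF V simplicial_vertices[OF \<Delta> F] ideal_nf[OF \<Delta>] nf_subset_face_prime[OF F \<Delta>]])
qed

text \<open>The last property holds because every face extends to a facet, and the chosen facet is a
  smallest one.\<close>

lemma minimal_facet: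
  assumes V: "finite V" and \<Delta>: "simplicial_complex_on V \<Delta>" and ne: "\<Delta> \<noteq> {}"
  obtains F where "F \<in> \<Delta>" "\<And>G. G \<in> \<Delta> \<Longrightarrow> F \<subseteq> G \<Longrightarrow> G = F"
    "\<And>G. G \<in> \<Delta> \<Longrightarrow> \<exists>H\<in>\<Delta>. G \<subseteq> H \<and> card F \<le> card H"
proof -
  define facets where "facets = {F \<in> \<Delta>. \<forall>G\<in>\<Delta>. F \<subseteq> G \<longrightarrow> G = F}"
  have fin: "finite \<Delta>"
    using \<Delta> V unfolding simplicial_complex_on_def by (meson finite_Pow_iff finite_subset)
  have ext: "\<exists>H\<in>facets. G \<subseteq> H" if "G \<in> \<Delta>" for G
    using finite_has_maximal2[OF fin that] by (auto simp: facets_def)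
  then have "facets \<noteq> {}" using ne by blast
  then obtain F where F: "F \<in> facets" "\<And>G. G \<in> facets \<Longrightarrow> card F \<le> card G"
    using ex_has_least_nat[of "\<lambda>F. F \<in> facets" _ card] by blast
  show ?thesis
  proof (rule that)
    show "F \<in> \<Delta>" "\<And>G. G \<in> \<Delta> \<Longrightarrow> F \<subseteq> G \<Longrightarrow> G = F" using F(1) by (auto simp: facets_def)
    show "\<exists>H\<in>\<Delta>. G \<subseteq> H \<and> card F \<le> card H" if "G \<in> \<Delta>" for G
      using ext[OF that] F(2) by (auto simp: facets_def)
  qed
qed

theorem theorem1p6:
  fixes n :: nat and \<Delta> :: "nat set set"
  assumes "simplicial_complex_on {1..n} \<Delta>"
  shows "initially_CM_complex TYPE('k :: field) {1..n} \<Delta> \<longleftrightarrow>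
    CM_complex TYPE('k) {1..n} (skeleton (indim_complex TYPE('k) {1..n} \<Delta>) \<Delta>)"
proof (cases "\<Delta> = {}")
  case True
  \<comment> \<open>The index of the skeleton is infinite here, but every skeleton of the void
    complex is void, and the zero module has both properties.\<close>
  then show ?thesis
    using SR_module_trivial_iff[OF _ assms, where 'k='k]
    by (simp add: initially_CM_complex_def CM_complex_def initially_CM_module_def CM_module_def skeleton_def)
next
  case False
  let ?V = "{1..n}"
  have V: "finite ?V" by simp
  obtain F where F: "F \<in> \<Delta>" and facet: "\<And>G. G \<in> \<Delta> \<Longrightarrow> F \<subseteq> G \<Longrightarrow> G = F"
    and min: "\<And>G. G \<in> \<Delta> \<Longrightarrow> \<exists>H\<in>\<Delta>. G \<subseteq> H \<and> card F \<le> card H"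
    using minimal_facet[OF V assms False] by blast
  \<comment> \<open>\<open>F\<close> is a smallest facet of \<open>\<Delta>\<close> and a largest
    face of \<open>\<Gamma>\<close>, so the initial dimension of \<open>\<Delta>\<close> and the
    dimension of \<open>\<Gamma>\<close> agree.\<close>
  define \<Gamma> where "\<Gamma> = {G\<in>\<Delta>. card G \<le> card F}"
  have \<Gamma>: "simplicial_complex_on ?V \<Gamma>" unfolding \<Gamma>_def by (rule simplicial_skeleton[OF V assms])
  have F\<Gamma>: "F \<in> \<Gamma>" and facet\<Gamma>: "\<And>G. G \<in> \<Gamma> \<Longrightarrow> F \<subseteq> G \<Longrightarrow> G = F"
    and max\<Gamma>: "\<And>G. G \<in> \<Gamma> \<Longrightarrow> card G \<le> card F"
    using F facet by (auto simp: \<Gamma>_def)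
  have le: "card F \<le> card ?V" using simplicial_vertices[OF assms F] by (rule card_mono[OF V])
  have indim: "indim (mpoly_ring ?V) (SR_module ?V \<Delta> :: ((nat \<Rightarrow>\<^sub>0 nat) \<Rightarrow>\<^sub>0 'k, _) module) = ereal (real (card F))"
    by (rule indim_SR_module[OF V assms F facet min])
  have dim: "module_dim (mpoly_ring ?V) (SR_module ?V \<Gamma> :: ((nat \<Rightarrow>\<^sub>0 nat) \<Rightarrow>\<^sub>0 'k, _) module) = ereal (real (card F))"
    by (rule module_dim_SR_module[OF V \<Gamma> F\<Gamma> max\<Gamma>])
  have "ereal (real (card F)) - 1 = ereal (real (card F) - 1)" by (simp add: one_ereal_def)
  then have skel: "skeleton (indim_complex TYPE('k) ?V \<Delta>) \<Delta> = \<Gamma>"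
    unfolding skeleton_def indim_complex_def indim by (auto simp: \<Gamma>_def)
  let ?d = "\<lambda>\<Delta>. depth (mpoly_ring ?V) (irrelevant_ideal ?V) (SR_module ?V \<Delta> :: ((nat \<Rightarrow>\<^sub>0 nat) \<Rightarrow>\<^sub>0 'k, _) module)"
  \<comment> \<open>With both dimensions equal to \<open>card F\<close>, the theorem compares two
    depths with one number.\<close>
  have "?d \<Delta> = ereal (real (card F)) \<longleftrightarrow> ?d \<Gamma> = ereal (real (card F))"
  proof
    assume "?d \<Delta> = ereal (real (card F))"
    from koszul_vanish_to_skeleton[OF V assms le depth_SR_module(1)[OF V assms F facet this]]
    show "?d \<Gamma> = ereal (real (card F))"
      unfolding \<Gamma>_def[symmetric] by (intro depth_SR_module(2)[OF V \<Gamma> F\<Gamma> facet\<Gamma>])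
  next
    assume "?d \<Gamma> = ereal (real (card F))"
    from depth_SR_module(1)[OF V \<Gamma> F\<Gamma> facet\<Gamma> this]
    show "?d \<Delta> = ereal (real (card F))"
      unfolding \<Gamma>_def
      by (intro depth_SR_module(2)[OF V assms F facet] koszul_vanish_from_skeleton[OF V assms le])
  qed
  moreover have "\<Gamma> \<noteq> {}" using F\<Gamma> by blast
  ultimately show ?thesis
    unfolding skel initially_CM_complex_def CM_complex_def initially_CM_module_def CM_module_def
      SR_module_trivial_iff[OF V assms] SR_module_trivial_iff[OF V \<Gamma>]
      indim dim
    using False by blast
qed

end
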